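(* Let $N\ge2$, $p\in(1,+\infty)$, let $\Omega\subset\mathbb{R}^N$ be a bounded Lipschitz domain, and let $k\in\mathbb{N}$. Let $\varphi_k$ be any eigenfunction corresponding to the cogenus eigenvalue $\lambda_k(p;\Omega)$, let $\nu(\varphi_k)$ be the number of its nodal domains, and let $\Omega_1,\dots,\Omega_{\nu(\varphi_k)}$ be these nodal domains. Let $\mathcal{L}_i>0$ be such that $$|\Omega_i|\,\lambda_1^{N/p}(p;\Omega_i)\ge\mathcal{L}_i,\quad i\in\{1,\dots,\nu(\varphi_k)\}.$$ Then $$\nu(\varphi_k)\le|\Omega|\,\lambda_k^{N/p}(p;\Omega)\left(\min\{\mathcal{L}_1,\dots,\mathcal{L}_{\nu(\varphi_k)}\}\right)^{-1}.$$
   Context: $\mathbb{N}=\{1,2,\dots\}$; $|\cdot|$ is Lebesgue measure; $\lambda^{N/p}_k(p;\Omega)$ means $(\lambda_k(p;\Omega))^{N/p}$. Let $\mathcal{S}(\Omega)=\{u\in W_0^{1,p}(\Omega):\int_\Omega|u|^p\,dx=1\}$ and $E(u)=\int_\Omega|\nabla u|^p\,dx$. The cogenus eigenvalues are $$\lambda_k(p;\Omega)=\inf_h\max_{u\in h(\mathbb{S}^{k-1})}E(u),$$ the infimum being over all continuous odd maps $h:\mathbb{S}^{k-1}\to\mathcal{S}(\Omega)$, with $\mathbb{S}^{k-1}$ the unit sphere in $\mathbb{R}^k$. For an arbitrary open set $D$ of finite measure, $\lambda_1(p;D)=\inf\{\int_D|\nabla u|^p\,dx:\ u\in W_0^{1,p}(D),\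 \int_D|u|^p\,dx=1\}$. A function $u\in W_0^{1,p}(\Omega)\setminus\{0\}$ is an eigenfunction corresponding to $\lambda$ if $\int_\Omega|\nabla u|^{p-2}\nabla u\cdot\nabla\varphi\,dx=\lambda\int_\Omega|u|^{p-2}u\varphi\,dx$ for all $\varphi\in W_0^{1,p}(\Omega)$ (weak Dirichlet eigenfunction of the $p$-Laplacian). Each $\lambda_k(p;\Omega)$ is an eigenvalue, and eigenfunctions belong to $C^1(\Omega)\cap L^\infty(\Omega)$. The nodal set of an eigenfunction $u$ is $\mathcal{Z}(u)=\overline{\{x\in\Omega:u(x)=0\}}$; nodal domains of $u$ are the connected components of $\Omega\setminus\mathcal{Z}(u)$. Their number $\nu(u)$ is known to be finite. *)

theory Defs
  imports "HOL-Analysis.Analysis"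
begin

(* Elements of Lebesgue and Sobolev spaces over \<Omega> are represented by total functions; only
   their values on \<Omega>, up to null sets, matter. *)

definition lipschitz_domain :: "'a::euclidean_space set \<Rightarrow> bool" where
  "lipschitz_domain \<Omega> \<longleftrightarrow> open \<Omega> \<and> connected \<Omega> \<and> \<Omega> \<noteq> {} \<and>
     (\<forall>x\<^sub>0\<in>frontier \<Omega>. \<exists>r>0. \<exists>e \<gamma> C. norm e = 1 \<and> C-lipschitz_on {y. e \<bullet> y = 0} \<gamma> \<and>
        \<Omega> \<inter> ball x\<^sub>0 r = {x \<in> ball x\<^sub>0 r. \<gamma> (x - (e \<bullet> x) *\<^sub>R e) < e \<bullet> x})"

primrec Ck :: "nat \<Rightarrow> ('a::euclidean_space \<Rightarrow> real) \<Rightarrow> bool" where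
  "Ck 0 f \<longleftrightarrow> continuous_on UNIV f"
| "Ck (Suc n) f \<longleftrightarrow> (\<forall>x. f differentiable (at x)) \<and>
     (\<forall>b\<in>Basis. Ck n (\<lambda>x. frechet_derivative f (at x) b))"

definition test_functions :: "'a::euclidean_space set \<Rightarrow> ('a \<Rightarrow> real) set" where
  "test_functions \<Omega> = {f. (\<forall>n. Ck n f) \<and> compact (closure {x. f x \<noteq> 0}) \<and>
     closure {x. f x \<noteq> 0} \<subseteq> \<Omega>}"

definition Lp :: "real \<Rightarrow> 'a::euclidean_space set \<Rightarrow> ('a \<Rightarrow> 'b::euclidean_space) set" where
  "Lp p \<Omega> = {f \<in> borel_measurable (lebesgue_on \<Omega>).
     integrable (lebesgue_on \<Omega>) (\<lambda>x. norm (f x) powr p)}"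

definition has_weak_gradient ::
    "'a::euclidean_space set \<Rightarrow> ('a \<Rightarrow> real) \<Rightarrow> ('a \<Rightarrow> 'a) \<Rightarrow> bool" where
  "has_weak_gradient \<Omega> u g \<longleftrightarrow>
     (\<forall>K. compact K \<and> K \<subseteq> \<Omega> \<longrightarrow> u absolutely_integrable_on K \<and> g absolutely_integrable_on K) \<and>
     (\<forall>f\<in>test_functions \<Omega>. \<forall>b\<in>Basis.
        (LINT x|lebesgue_on \<Omega>. u x * frechet_derivative f (at x) b) =
        - (LINT x|lebesgue_on \<Omega>. (g x \<bullet> b) * f x))"

(* Weak gradients are unique almost everywhere on open sets, so the choice is immaterial. *)
definition weak_grad :: "'a::euclidean_space set \<Rightarrow> ('a \<Rightarrow> real) \<Rightarrow> 'a \<Rightarrow> 'a" where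
  "weak_grad \<Omega> u = (SOME g. has_weak_gradient \<Omega> u g)"

definition W1p :: "real \<Rightarrow> 'a::euclidean_space set \<Rightarrow> ('a \<Rightarrow> real) set" where
  "W1p p \<Omega> = {u \<in> Lp p \<Omega>. \<exists>g\<in>Lp p \<Omega>. has_weak_gradient \<Omega> u g}"

definition W1p_norm :: "real \<Rightarrow> 'a::euclidean_space set \<Rightarrow> ('a \<Rightarrow> real) \<Rightarrow> real" where
  "W1p_norm p \<Omega> u =
     ((LINT x|lebesgue_on \<Omega>. \<bar>u x\<bar> powr p) +
      (LINT x|lebesgue_on \<Omega>. norm (weak_grad \<Omega> u x) powr p)) powr (1 / p)"

definition W01p :: "real \<Rightarrow> 'a::euclidean_space set \<Rightarrow> ('a \<Rightarrow> real) set" where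
  "W01p p \<Omega> = {u \<in> W1p p \<Omega>. \<exists>f. (\<forall>n::nat. f n \<in> test_functions \<Omega>) \<and>
     (\<lambda>n. W1p_norm p \<Omega> (\<lambda>x. u x - f n x)) \<longlonglongrightarrow> 0}"

definition energy :: "real \<Rightarrow> 'a::euclidean_space set \<Rightarrow> ('a \<Rightarrow> real) \<Rightarrow> real" where
  "energy p \<Omega> u = (LINT x|lebesgue_on \<Omega>. norm (weak_grad \<Omega> u x) powr p)"

definition Lp_sphere :: "real \<Rightarrow> 'a::euclidean_space set \<Rightarrow> ('a \<Rightarrow> real) set" where
  "Lp_sphere p \<Omega> = {u \<in> W01p p \<Omega>. (LINT x|lebesgue_on \<Omega>. \<bar>u x\<bar> powr p) = 1}"

definition lambda_1 :: "real \<Rightarrow> 'a::euclidean_space set \<Rightarrow> real" where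
  "lambda_1 p D = (INF u\<in>Lp_sphere p D. energy p D u)"

(* The unit sphere of R^k is nsphere (k - 1), whose points are real sequences vanishing from
   index k on. Continuity is with respect to the W^{1,p} norm, and oddness is equality of
   elements of W_0^{1,p}, i.e. almost everywhere. *)
definition odd_sphere_maps ::
    "nat \<Rightarrow> real \<Rightarrow> 'a::euclidean_space set \<Rightarrow> ((nat \<Rightarrow> real) \<Rightarrow> 'a \<Rightarrow> real) set" where
  "odd_sphere_maps k p \<Omega> = {h. \<forall>s\<in>topspace (nsphere (k - 1)).
     h s \<in> Lp_sphere p \<Omega> \<and>
     (AE x in lebesgue_on \<Omega>. h (\<lambda>i. - s i) x = - h s x) \<and>
     ((\<lambda>t. W1p_norm p \<Omega> (\<lambda>x. h t x - h s x)) \<longlongrightarrow> 0) (atin (nsphere (k - 1)) s)}"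

definition cogenus_eigenvalue :: "nat \<Rightarrow> real \<Rightarrow> 'a::euclidean_space set \<Rightarrow> real" where
  "cogenus_eigenvalue k p \<Omega> = Inf {m. \<exists>h\<in>odd_sphere_maps k p \<Omega>.
     (\<exists>s\<in>topspace (nsphere (k - 1)). m = energy p \<Omega> (h s)) \<and>
     (\<forall>s\<in>topspace (nsphere (k - 1)). energy p \<Omega> (h s) \<le> m)}"

(* Since 0 powr a = 0, both integrands vanish where the gradient, respectively the function,
   vanishes, also when p < 2. *)
definition eigenfunction ::
    "real \<Rightarrow> 'a::euclidean_space set \<Rightarrow> real \<Rightarrow> ('a \<Rightarrow> real) \<Rightarrow> bool" where
  "eigenfunction p \<Omega> lam u \<longleftrightarrow> u \<in> W01p p \<Omega> \<and> \<not> (AE x in lebesgue_on \<Omega>. u x = 0) \<and>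
     (\<forall>v\<in>W01p p \<Omega>.
        (LINT x|lebesgue_on \<Omega>.
           norm (weak_grad \<Omega> u x) powr (p - 2) * (weak_grad \<Omega> u x \<bullet> weak_grad \<Omega> v x)) =
        lam * (LINT x|lebesgue_on \<Omega>. \<bar>u x\<bar> powr (p - 2) * u x * v x))"

definition nodal_set :: "'a::euclidean_space set \<Rightarrow> ('a \<Rightarrow> real) \<Rightarrow> 'a set" where
  "nodal_set \<Omega> u = closure {x \<in> \<Omega>. u x = 0}"

definition nodal_domains :: "'a::euclidean_space set \<Rightarrow> ('a \<Rightarrow> real) \<Rightarrow> 'a set set" where
  "nodal_domains \<Omega> u = components (\<Omega> - nodal_set \<Omega> u)"

definition nodal_count :: "'a::euclidean_space set \<Rightarrow> ('a \<Rightarrow> real) \<Rightarrow> nat" where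
  "nodal_count \<Omega> u = card (nodal_domains \<Omega> u)"

end

theory Submission
  imports Defs
begin

text \<open>
  The restriction of an eigenfunction \<open>\<phi>\<close> to a nodal domain \<open>D\<close>, extended by zero, lies in
  \<open>W01p p D\<close>, and testing the eigenvalue equation with it shows that its Rayleigh quotient is the
  eigenvalue; so the first eigenvalue of \<open>D\<close> is at most the eigenvalue of \<open>\<phi>\<close>, and summing the
  assumed lower bounds over the disjoint nodal domains gives the estimate.

  Since \<open>\<phi>\<close> is continuous only inside \<open>\<Omega>\<close>, membership in \<open>W01p p D\<close> needs an approximation
  controlled both by \<open>\<phi>\<close> and near the boundary of \<open>\<Omega>\<close>. Let \<open>f n\<close> be test functions converging to \<open>\<phi>\<close>,
  where \<open>\<phi> > 0\<close> on \<open>D\<close>, let \<open>\<theta>\<close> be bounded and vanish on \<open>s \<le> \<epsilon>\<close>, and let \<open>\<psi>\<close> vanish near \<open>0\<close> with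
  \<open>\<psi> = 1\<close> on \<open>s > \<epsilon>\<close>. The set of points of \<open>D\<close> where \<open>\<phi> \<ge> \<epsilon>\<close> inside the support of \<open>f n\<close> is a compact
  subset of \<open>D\<close>; with a cutoff \<open>\<eta>\<close> equal to \<open>1\<close> there, \<open>\<theta> (f m) * \<psi> (f n) * \<eta>\<close> is a test function
  in \<open>D\<close>. Letting first \<open>m\<close>, then \<open>n\<close> tend to infinity, and finally \<open>\<theta>\<close> to the identity, yields the claim.
\<close>

section \<open>Smooth functions\<close>

text \<open>Two simpler approximations fail. \<open>\<theta> (f m)\<close> restricted to
  \<open>D\<close> need not be smooth, since \<open>f m\<close> need not vanish on the boundary of
  \<open>D\<close>; and \<open>\<theta> (\<phi>)\<close> on \<open>D\<close>, though zero near the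
  points of that boundary inside \<open>\<Omega>\<close>, may live arbitrarily close to the boundary
  of \<open>\<Omega>\<close>, where \<open>\<phi>\<close> has no pointwise control. The factor
  \<open>\<psi> (f n)\<close> with \<open>n\<close> frozen confines everything to one compact subset
  of \<open>\<Omega>\<close>, so that one cutoff \<open>\<eta>\<close> serves all \<open>m\<close>.
  The gradient of \<open>\<eta>\<close> is not controlled as \<open>n\<close> grows, which dictates
  the order of the limits: once \<open>m\<close> has gone to infinity, that gradient is multiplied
  by \<open>\<theta> (\<phi>) * \<psi> (f n)\<close>, and at each point of \<open>D\<close> one of
  the factors vanishes. In the last limit the derivative of \<open>\<theta>\<close> must stay
  bounded while the region where \<open>\<theta>\<close> is zero shrinks; this holds by scale
  invariance when \<open>\<theta>\<close> is \<open>s\<close> times a function of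
  \<open>J * s\<close> and \<open>s / J\<close>.\<close>

lemma Ck_Suc_imp: "Ck (Suc n) f \<Longrightarrow> Ck n f"
proof (induction n arbitrary: f)
  case 0
  then show ?case
    by (auto intro!: differentiable_imp_continuous_on simp: differentiable_on_def
        intro: differentiable_at_withinI)
qed auto

lemma Ck_const [intro]: "Ck n (\<lambda>x::'a::euclidean_space. c)"
  by (induction n arbitrary: c) (auto simp: frechet_derivative_const)

text \<open>Derivatives are unique, so an exhibited derivative may stand in for the chosen
  \<open>frechet_derivative\<close> in the recursion of \<open>Ck\<close>. The closure properties
  below rest on this form.\<close>

lemma Ck_SucI:
  fixes f :: "'a::euclidean_space \<Rightarrow> real"
  assumes "\<And>x. (f has_derivative f' x) (at x)" and "\<And>b. b \<in> Basis \<Longrightarrow> Ck n (\<lambda>x. f' x b)"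
  shows "Ck (Suc n) f"
proof -
  have "frechet_derivative f (at x) = f' x" for x
    using assms(1) frechet_derivative_at by metis
  with assms show ?thesis
    by (auto simp: differentiable_def)
qed

lemma Ck_Suc_has_derivative:
  "Ck (Suc n) f \<Longrightarrow> (f has_derivative frechet_derivative f (at x)) (at x)"
  by (simp add: frechet_derivative_works)

lemma Ck_add:
  assumes "Ck n f" "Ck n g"
  shows "Ck n (\<lambda>x. f x + g x)"
  using assms
proof (induction n arbitrary: f g)
  case 0
  then show ?case by (auto intro: continuous_on_add)
next
  case (Suc n)
  show ?case
    by (rule Ck_SucI, rule has_derivative_add[OF Ck_Suc_has_derivative[OF Suc.prems(1)]
          Ck_Suc_has_derivative[OF Suc.prems(2)]]) (use Suc in auto)
qed

lemma Ck_mult: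
  assumes "Ck n f" "Ck n g"
  shows "Ck n (\<lambda>x. f x * g x)"
  using assms
proof (induction n arbitrary: f g)
  case 0
  then show ?case by (auto intro: continuous_on_mult)
next
  case (Suc n)
  show ?case
    by (rule Ck_SucI, rule has_derivative_mult[OF Ck_Suc_has_derivative[OF Suc.prems(1)]
          Ck_Suc_has_derivative[OF Suc.prems(2)]])
       (use Suc Ck_Suc_imp[OF Suc.prems(1)] Ck_Suc_imp[OF Suc.prems(2)] in \<open>auto intro!: Ck_add\<close>)
qed

lemma Ck_diff:
  assumes "Ck n f" "Ck n g"
  shows "Ck n (\<lambda>x. f x - g x)"
  using Ck_add[OF assms(1) Ck_mult[OF Ck_const[of n "-1"] assms(2)]] by simp

lemma Ck_sum:
  assumes "finite A" "\<And>i. i \<in> A \<Longrightarrow> Ck n (f i)"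
  shows "Ck n (\<lambda>x. \<Sum>i\<in>A. f i x)"
  using assms by (induction A rule: finite_induct) (auto intro: Ck_add)

lemma Ck_inverse:
  assumes "Ck n f" "\<And>x. f x \<noteq> 0"
  shows "Ck n (\<lambda>x. inverse (f x))"
  using assms
proof (induction n arbitrary: f)
  case 0
  then show ?case by (auto intro: continuous_on_inverse)
next
  case (Suc n)
  have *: "((\<lambda>x. inverse (f x)) has_derivative
      (\<lambda>h. 0 - inverse (f x) * frechet_derivative f (at x) h * inverse (f x))) (at x)" for x
    using Deriv.has_derivative_inverse[OF Suc.prems(2) Ck_Suc_has_derivative[OF Suc.prems(1)]] by simp
  show ?case
    by (rule Ck_SucI, rule *)
       (use Suc Ck_Suc_imp[OF Suc.prems(1)] in \<open>auto intro!: Ck_mult Ck_diff simp del: diff_0\<close>)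
qed

lemma Ck_real_SucI:
  fixes h :: "real \<Rightarrow> real"
  assumes "\<And>x. (h has_real_derivative h' x) (at x)" and "Ck n h'"
  shows "Ck (Suc n) h"
  by (rule Ck_SucI, rule assms(1)[unfolded has_field_derivative_def]) (use assms in auto)

lemma Ck_real_Suc_deriv:
  fixes h :: "real \<Rightarrow> real"
  assumes "Ck (Suc n) h"
  shows "(h has_real_derivative deriv h x) (at x)" "Ck n (deriv h)"
proof -
  show *: "(h has_real_derivative deriv h x) (at x)" for x
    using assms by (auto simp: DERIV_deriv_iff_real_differentiable)
  have "frechet_derivative h (at x) 1 = deriv h x" for x
    using frechet_derivative_at[OF *[unfolded has_field_derivative_def], of x] by (metis mult.right_neutral)
  with assms show "Ck n (deriv h)" by simp
qed

lemma Ck_compose: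
  fixes h :: "real \<Rightarrow> real"
  assumes "Ck n h" "Ck n f"
  shows "Ck n (\<lambda>x. h (f x))"
  using assms
proof (induction n arbitrary: f h)
  case 0
  then show ?case by (auto intro: continuous_on_compose2)
next
  case (Suc n)
  have *: "((\<lambda>x. h (f x)) has_derivative
      (\<lambda>v. deriv h (f x) * frechet_derivative f (at x) v)) (at x)" for x
    by (rule has_derivative_compose[OF Ck_Suc_has_derivative[OF Suc.prems(2)]
          Ck_real_Suc_deriv(1)[OF Suc.prems(1), unfolded has_field_derivative_def]])
  show ?case
    by (rule Ck_SucI, rule *)
       (use Suc Ck_Suc_imp[OF Suc.prems(2)] Ck_real_Suc_deriv(2)[OF Suc.prems(1)] in \<open>auto intro!: Ck_mult\<close>)
qed

lemma Ck_inner: "Ck n (\<lambda>x. (x - a) \<bullet> b)"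
proof (cases n)
  case (Suc m)
  show ?thesis unfolding Suc
    by (rule Ck_SucI[where f' = "\<lambda>x v. v \<bullet> b"]) (auto intro!: derivative_eq_intros)
qed (auto intro!: continuous_intros)

lemma Ck_dist_sq: "Ck n (\<lambda>x. (x - a) \<bullet> (x - a))"
proof (cases n)
  case (Suc m)
  have "((\<lambda>x. (x - a) \<bullet> (x - a)) has_derivative (\<lambda>v. (x - a) \<bullet> v + (x - a) \<bullet> v)) (at x)" for x
    by (rule has_derivative_eq_rhs, rule has_derivative_inner)
      (auto intro!: derivative_eq_intros simp: inner_commute[of "x - a"])
  then show ?thesis unfolding Suc
    by (rule Ck_SucI) (intro Ck_add Ck_inner)
qed (auto intro!: continuous_intros)

section \<open>A smooth step function\<close>

text \<open>The functions \<open>(1/x)^k exp (-1/x)\<close>: their derivatives are combinations of functions of the same family.\<close>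

definition flat_exp :: "nat \<Rightarrow> real \<Rightarrow> real" where
  "flat_exp k x = (if x \<le> 0 then 0 else inverse x ^ k * exp (- inverse x))"

text \<open>With \<open>y = 1/x\<close>, the single term \<open>y ^ (k + 2) / fact (k + 2)\<close>
  of the exponential series bounds \<open>exp y\<close> from below. The exponent
  \<open>k + 2\<close> instead of \<open>k\<close> is what leaves the factor
  \<open>x\<^sup>2\<close>, so that the difference quotient at 0 tends to 0.\<close>

lemma flat_exp_bound:
  fixes x :: real
  assumes "x > 0"
  shows "inverse x ^ k * exp (- inverse x) \<le> fact (k + 2) * x\<^sup>2"
proof -
  define y where "y = inverse x"
  have y: "y > 0" using assms unfolding y_def by simp
  have "y ^ (k + 2) / fact (k + 2) \<le> exp y"
  proof -
    have "(\<Sum>n\<in>{k+2}. y ^ n /\<^sub>R fact n) \<le> exp y"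
      unfolding exp_def
      by (rule sum_le_suminf) (use y summable_exp_generic[of y] in auto)
    then show ?thesis by (simp del: fact_Suc add: divide_inverse mult.commute)
  qed
  then have "y ^ (k + 2) \<le> fact (k + 2) * exp y"
    by (simp only: pos_divide_le_eq[OF fact_gt_zero] mult.commute)
  then have "y ^ (k + 2) * exp (- y) / y\<^sup>2 \<le> fact (k + 2) * exp y * exp (- y) / y\<^sup>2"
    by (intro divide_right_mono mult_right_mono) auto
  then have "y ^ k * exp (- y) \<le> fact (k + 2) / y\<^sup>2"
    using y by (simp add: power_add mult.assoc exp_minus_inverse del: fact_Suc add_2_eq_Suc')
  then show ?thesis by (simp add: y_def power_inverse divide_inverse)
qed

lemma flat_exp_deriv:
  "(flat_exp k has_real_derivative (flat_exp (k + 2) x - real k * flat_exp (k + 1) x)) (at x)"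
proof -
  consider "x < 0" | "x > 0" | "x = 0" by linarith
  then show ?thesis
  proof cases
    case 1
    have "((\<lambda>x. 0) has_real_derivative 0) (at x)" by simp
    then have "(flat_exp k has_real_derivative 0) (at x)"
      by (rule has_field_derivative_transform_within_open[where S = "{..<0}"])
        (use 1 in \<open>auto simp: flat_exp_def\<close>)
    then show ?thesis using 1 by (simp add: flat_exp_def)
  next
    case 2
    have "((\<lambda>x. inverse x ^ k * exp (- inverse x)) has_real_derivative
        (inverse x ^ (k+2) * exp (- inverse x) - real k * (inverse x ^ (k+1) * exp (- inverse x)))) (at x)"
    proof -
      \<comment> \<open>The exponent in the power rule is a truncated subtraction: for
        \<open>k = 0\<close> it is 0 and not -1, but then the factor \<open>real k\<close> is
        0.\<close>
      have "real k * x ^ (k - Suc 0) * x = real k * x ^ k"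
        by (cases k) auto
      with 2 show ?thesis
        by (auto intro!: derivative_eq_intros simp: field_simps power2_eq_square)
    qed
    then have "(flat_exp k has_real_derivative
        (inverse x ^ (k+2) * exp (- inverse x) - real k * (inverse x ^ (k+1) * exp (- inverse x)))) (at x)"
      by (rule has_field_derivative_transform_within_open[where S = "{0<..}"])
        (use 2 in \<open>auto simp: flat_exp_def\<close>)
    then show ?thesis using 2 by (simp add: flat_exp_def)
  next
    case 3
    \<comment> \<open>All members of the family vanish at 0 and to its left, so only the quotient
      from the right is in question, and the quadratic bound settles it.\<close>
    have "((\<lambda>h. flat_exp k h / h) \<longlongrightarrow> 0) (at 0)"
    proof (rule Lim_null_comparison)
      show "((\<lambda>h::real. fact (k + 2) * \<bar>h\<bar>) \<longlongrightarrow> 0) (at 0)"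
        by (auto intro!: tendsto_eq_intros)
      show "\<forall>\<^sub>F h in at 0. norm (flat_exp k h / h) \<le> fact (k + 2) * \<bar>h\<bar>"
      proof (rule always_eventually, rule allI)
        fix h :: real
        show "norm (flat_exp k h / h) \<le> fact (k + 2) * \<bar>h\<bar>"
        proof (cases "h > 0")
          case True
          then have "flat_exp k h \<le> fact (k + 2) * h\<^sup>2" "0 \<le> flat_exp k h"
            using flat_exp_bound[of h k] by (auto simp: flat_exp_def)
          with True show ?thesis
            using divide_right_mono[of "flat_exp k h" "fact (k + 2) * h\<^sup>2" h]
            by (simp add: power2_eq_square del: fact_Suc add_2_eq_Suc')
        qed (simp add: flat_exp_def not_less mult_nonneg_nonpos del: fact_Suc add_2_eq_Suc')
      qed
    qed
    then show ?thesis using 3 by (simp add: DERIV_def flat_exp_def)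
  qed
qed

lemma Ck_flat_exp: "Ck n (flat_exp k)"
proof (induction n arbitrary: k)
  case 0
  have "continuous_on UNIV (flat_exp k)"
    by (intro DERIV_continuous_on) (use flat_exp_deriv in \<open>auto intro: has_field_derivative_at_within\<close>)
  then show ?case by simp
next
  case (Suc n)
  show ?case
    by (rule Ck_real_SucI, rule flat_exp_deriv) (auto intro!: Ck_diff Ck_mult Suc)
qed

text \<open>The transition lies in [1,2] and not in [0,1], so that compositions with it vanish on a
  whole neighbourhood of 0. With the argument rescaled it cuts off both small and large
  values.\<close>

definition smooth_step :: "real \<Rightarrow> real" where
  "smooth_step t = flat_exp 0 (t - 1) * inverse (flat_exp 0 (t - 1) + flat_exp 0 (2 - t))"

lemma flat_exp_nonneg: "0 \<le> flat_exp k x" by (simp add: flat_exp_def)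

lemma flat_exp_0_pos_iff: "0 < flat_exp 0 x \<longleftrightarrow> 0 < x" by (simp add: flat_exp_def)

lemma smooth_step_denom_pos: "0 < flat_exp 0 (t - 1) + flat_exp 0 (2 - t)"
  using flat_exp_nonneg[of 0 "t - 1"] flat_exp_nonneg[of 0 "2 - t"]
    flat_exp_0_pos_iff[of "t - 1"] flat_exp_0_pos_iff[of "2 - t"] by linarith

lemma Ck_smooth_step: "Ck n smooth_step"
proof -
  have *: "Ck n (\<lambda>t::real. flat_exp 0 (t - 1))"
    using Ck_compose[OF Ck_flat_exp[of n 0] Ck_inner[of n 1 "1::real"]] by simp
  have "Ck n (\<lambda>t::real. flat_exp 0 (2 - t))"
    using Ck_compose[OF Ck_flat_exp[of n 0] Ck_inner[of n 2 "-1::real"]] by simp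
  with * show ?thesis unfolding smooth_step_def[abs_def]
    by (intro Ck_mult Ck_inverse Ck_add) (use smooth_step_denom_pos in \<open>auto simp: less_le\<close>)
qed

lemma smooth_step_eq_0: "t \<le> 1 \<Longrightarrow> smooth_step t = 0"
  by (simp add: smooth_step_def flat_exp_def)

lemma smooth_step_eq_1: "t \<ge> 2 \<Longrightarrow> smooth_step t = 1"
  by (simp add: smooth_step_def flat_exp_def)

lemma smooth_step_bounds: "0 \<le> smooth_step t" "smooth_step t \<le> 1"
  using smooth_step_denom_pos[of t] flat_exp_nonneg[of 0 "t - 1"] flat_exp_nonneg[of 0 "2 - t"]
  by (auto simp: smooth_step_def divide_inverse[symmetric])

lemma smooth_step_deriv:
  "(smooth_step has_real_derivative deriv smooth_step t) (at t)"
  using Ck_real_Suc_deriv(1)[OF Ck_smooth_step] .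

lemma deriv_smooth_step_eq_0:
  assumes "t \<notin> {1..2}"
  shows "deriv smooth_step t = 0"
proof (cases "t < 1")
  case True
  have "(smooth_step has_real_derivative 0) (at t)"
    by (rule has_field_derivative_transform_within_open[OF DERIV_const[of 0], where S = "{..<1}"])
       (use True in \<open>auto simp: smooth_step_eq_0\<close>)
  then show ?thesis by (rule DERIV_imp_deriv)
next
  case False
  have "(smooth_step has_real_derivative 0) (at t)"
    by (rule has_field_derivative_transform_within_open[OF DERIV_const[of 1], where S = "{2<..}"])
       (use False assms in \<open>auto simp: smooth_step_eq_1\<close>)
  then show ?thesis by (rule DERIV_imp_deriv)
qed

lemma deriv_smooth_step_bounded:
  obtains C where "C > 0" "\<And>t. \<bar>deriv smooth_step t\<bar> \<le> C"
proof -
  have "continuous_on UNIV (deriv smooth_step)"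
    using Ck_real_Suc_deriv(2)[OF Ck_smooth_step[of "Suc 0"]] by simp
  then have "compact (deriv smooth_step ` {1..2})"
    by (intro compact_continuous_image) (auto intro: continuous_on_subset)
  then obtain C where C: "C > 0" "\<forall>y \<in> deriv smooth_step ` {1..2}. norm y \<le> C"
    using compact_imp_bounded bounded_pos by metis
  have "\<bar>deriv smooth_step t\<bar> \<le> C" for t
    using C deriv_smooth_step_eq_0[of t] by (cases "t \<in> {1..2}") auto
  with C show thesis using that by blast
qed

section \<open>Test functions\<close>

definition grad :: "('a::euclidean_space \<Rightarrow> real) \<Rightarrow> 'a \<Rightarrow> 'a" where
  "grad f x = (\<Sum>b\<in>Basis. frechet_derivative f (at x) b *\<^sub>R b)"

lemma grad_inner_Basis: "b \<in> Basis \<Longrightarrow> grad f x \<bullet> b = frechet_derivative f (at x) b"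
  by (simp add: grad_def inner_sum_left inner_Basis if_distrib sum.If_cases cong: if_cong)

lemma grad_eqI:
  assumes "(f has_derivative (\<lambda>v. g \<bullet> v)) (at x)"
  shows "grad f x = g"
  by (rule euclidean_eqI)
    (simp add: grad_inner_Basis frechet_derivative_at[OF assms, symmetric])

lemma has_derivative_grad:
  assumes "f differentiable (at x)"
  shows "(f has_derivative (\<lambda>v. grad f x \<bullet> v)) (at x)"
proof -
  let ?f' = "frechet_derivative f (at x)"
  have *: "(f has_derivative ?f') (at x)"
    using assms by (simp add: frechet_derivative_works)
  then interpret linear ?f'
    by (rule has_derivative_linear)
  have "?f' v = grad f x \<bullet> v" for v
  proof -
    have "?f' v = ?f' (\<Sum>b\<in>Basis. (v \<bullet> b) *\<^sub>R b)" by (simp add: euclidean_representation)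
    also have "\<dots> = grad f x \<bullet> v"
      by (simp add: sum scale grad_def inner_sum_left inner_commute[of v] mult.commute)
    finally show ?thesis .
  qed
  then have "?f' = (\<lambda>v. grad f x \<bullet> v)" by blast
  with * show ?thesis by simp
qed

lemma Ck_has_derivative_grad: "Ck (Suc 0) f \<Longrightarrow> (f has_derivative (\<lambda>v. grad f x \<bullet> v)) (at x)"
  by (rule has_derivative_grad) simp

lemma grad_mult:
  assumes "Ck (Suc 0) f" "Ck (Suc 0) g"
  shows "grad (\<lambda>x. f x * g x) x = g x *\<^sub>R grad f x + f x *\<^sub>R grad g x"
  by (rule grad_eqI, rule has_derivative_eq_rhs[OF has_derivative_mult[OF
        assms[THEN Ck_has_derivative_grad]]]) (auto simp: inner_add_left algebra_simps)

lemma grad_compose: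
  assumes "Ck (Suc 0) h" "Ck (Suc 0) f"
  shows "grad (\<lambda>x. h (f x)) x = deriv h (f x) *\<^sub>R grad f x"
  by (rule grad_eqI, rule has_derivative_eq_rhs[OF has_derivative_compose[OF
        Ck_has_derivative_grad[OF assms(2)] Ck_real_Suc_deriv(1)[OF assms(1), unfolded has_field_derivative_def]]])
    auto

lemma continuous_on_grad:
  assumes "Ck (Suc 0) f"
  shows "continuous_on UNIV (grad f)"
  unfolding grad_def[abs_def] using assms by (intro continuous_intros) auto

lemma test_functions_Ck: "f \<in> test_functions \<Omega> \<Longrightarrow> Ck n f"
  by (simp add: test_functions_def)

lemma test_functions_compact_support:
  "f \<in> test_functions \<Omega> \<Longrightarrow> compact (closure {x. f x \<noteq> 0})"
  by (simp add: test_functions_def)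

lemma test_functions_continuous:
  assumes "f \<in> test_functions \<Omega>"
  shows "continuous_on UNIV f" "continuous_on UNIV (grad f)"
  using continuous_on_grad[of f] test_functions_Ck[OF assms, of 0] test_functions_Ck[OF assms, of "Suc 0"]
  by simp_all

lemma test_functions_mono: "\<Omega> \<subseteq> \<Omega>' \<Longrightarrow> test_functions \<Omega> \<subseteq> test_functions \<Omega>'"
  by (auto simp: test_functions_def)

lemma test_functionsI:
  assumes "\<And>n. Ck n f" "{x. f x \<noteq> 0} \<subseteq> K" "compact K" "K \<subseteq> \<Omega>"
  shows "f \<in> test_functions \<Omega>"
proof -
  have "closure {x. f x \<noteq> 0} \<subseteq> K"
    using assms by (simp add: closure_minimal compact_imp_closed)
  with assms show ?thesis
    unfolding test_functions_def
    by (auto intro: compact_closure[THEN iffD2] bounded_subset[OF compact_imp_bounded])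
qed

lemma test_functions_support_subset:
  assumes "f \<in> test_functions \<Omega>" "\<And>n. Ck n g" "{x. g x \<noteq> 0} \<subseteq> {x. f x \<noteq> 0}"
  shows "g \<in> test_functions \<Omega>"
  using assms(2) subset_trans[OF assms(3) closure_subset] test_functions_compact_support[OF assms(1)]
  by (rule test_functionsI) (use assms(1) in \<open>simp add: test_functions_def\<close>)

lemma test_functions_mult:
  assumes "f \<in> test_functions \<Omega>" "\<And>n. Ck n g"
  shows "(\<lambda>x. g x * f x) \<in> test_functions \<Omega>"
  by (rule test_functions_support_subset[OF assms(1)])
    (use assms in \<open>auto intro!: Ck_mult simp: test_functions_Ck\<close>)

lemma grad_eq_0_outside:
  assumes "x \<notin> closure {x. f x \<noteq> 0}"
  shows "grad f x = 0"
proof (rule grad_eqI)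
  show "(f has_derivative (\<lambda>v. 0 \<bullet> v)) (at x)"
    by (rule has_derivative_transform_within_open[where f = "\<lambda>_. 0" and s = "- closure {x. f x \<noteq> 0}"])
      (use assms closure_subset[of "{x. f x \<noteq> 0}"] in auto)
qed

lemma test_functions_eq_0:
  assumes "f \<in> test_functions \<Omega>" "x \<notin> \<Omega>"
  shows "f x = 0" "grad f x = 0"
proof -
  have "x \<notin> closure {x. f x \<noteq> 0}" using assms by (auto simp: test_functions_def)
  then show "f x = 0" "grad f x = 0"
    using grad_eq_0_outside[of x f] closure_subset[of "{x. f x \<noteq> 0}"] by auto
qed

section \<open>Cutoff functions and integrals of partial derivatives\<close>

lemma continuous_integrable_lebesgue:
  fixes f :: "'a::euclidean_space \<Rightarrow> 'b::euclidean_space"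
  assumes "continuous_on UNIV f" "compact K" "\<And>x. x \<notin> K \<Longrightarrow> f x = 0"
  shows "integrable lebesgue f"
proof -
  have "integrable lborel (\<lambda>x. indicator K x *\<^sub>R f x)"
    by (rule borel_integrable_compact) (use assms continuous_on_subset[OF assms(1)] in auto)
  moreover have "(\<lambda>x. indicator K x *\<^sub>R f x) = f"
    using assms(3) by (auto simp: indicator_def)
  ultimately show ?thesis by (simp add: integrable_completion assms(1) borel_measurable_continuous_onI)
qed

text \<open>A finite sum \<open>S\<close> of bumps with centres in \<open>K\<close> is at least 1 on
  \<open>K\<close> and vanishes away from the doubled balls, which lie in \<open>U\<close>. Passing
  to \<open>smooth_step (2 * S)\<close> flattens it to exactly 1 wherever
  \<open>S \<ge> 1\<close>.\<close>

lemma smooth_cutoff_exists: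
  fixes K :: "'a::euclidean_space set"
  assumes "compact K" "open U" "K \<subseteq> U"
  obtains \<eta> where "\<eta> \<in> test_functions U" "\<And>x. x \<in> K \<Longrightarrow> \<eta> x = 1" "\<And>x. 0 \<le> \<eta> x" "\<And>x. \<eta> x \<le> 1"
proof -
  have "\<exists>r>0. cball x (2 * r) \<subseteq> U" if x: "x \<in> K" for x
  proof -
    obtain e where "e > 0" "cball x e \<subseteq> U"
      using x assms(2,3) open_contains_cball_eq[of U] by blast
    then show ?thesis by (intro exI[of _ "e / 2"]) auto
  qed
  then obtain r where r: "\<And>x. x \<in> K \<Longrightarrow> r x > 0" "\<And>x. x \<in> K \<Longrightarrow> cball x (2 * r x) \<subseteq> U"
    by metis
  have "K \<subseteq> (\<Union>x\<in>K. ball x (r x))" using r(1) by (auto intro: UN_I[of x for x])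
  then obtain F where F: "F \<subseteq> K" "finite F" "K \<subseteq> (\<Union>x\<in>F. ball x (r x))"
    using compactE_image[OF assms(1), of K "\<lambda>x. ball x (r x)"] by (metis open_ball)
  \<comment> \<open>The squared distance keeps the bump smooth at its centre. The bump is 1 within
    distance \<open>r x\<close> and 0 from distance \<open>sqrt 2 * r x\<close> on, which is below
    the \<open>2 * r x\<close> reserved for the support.\<close>
  define b where "b x y = 1 - smooth_step (((y - x) \<bullet> (y - x)) * inverse ((r x)\<^sup>2))" for x y
  define S where "S y = (\<Sum>x\<in>F. b x y)" for y
  have b01: "0 \<le> b x y" "b x y \<le> 1" for x y
    using smooth_step_bounds by (auto simp: b_def)
  have Ck_b: "Ck n (b x)" for n x
    unfolding b_def[abs_def]
    by (intro Ck_diff Ck_const Ck_compose[OF Ck_smooth_step] Ck_mult Ck_dist_sq)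
  have Ck_S: "Ck n S" for n
    unfolding S_def[abs_def] using F Ck_b by (intro Ck_sum) auto
  show thesis
  proof
    show "(\<lambda>y. smooth_step (2 * S y)) \<in> test_functions U"
    proof (rule test_functionsI[where K = "\<Union>x\<in>F. cball x (2 * r x)"])
      show "Ck n (\<lambda>y. smooth_step (2 * S y))" for n
        by (intro Ck_compose[OF Ck_smooth_step] Ck_mult Ck_const Ck_S)
      show "{y. smooth_step (2 * S y) \<noteq> 0} \<subseteq> (\<Union>x\<in>F. cball x (2 * r x))"
      proof safe
        fix y assume y: "smooth_step (2 * S y) \<noteq> 0"
        then have "S y \<noteq> 0" by (auto simp: smooth_step_eq_0)
        then obtain x where x: "x \<in> F" "b x y \<noteq> 0"
          unfolding S_def by (meson sum.neutral)
        then have "\<not> ((y - x) \<bullet> (y - x)) * inverse ((r x)\<^sup>2) \<ge> 2"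
          by (auto simp: b_def smooth_step_eq_1)
        moreover have rx: "r x > 0" using x F r by auto
        ultimately have "(norm (y - x))\<^sup>2 < 2 * (r x)\<^sup>2"
          by (simp add: divide_inverse[symmetric] pos_le_divide_eq power2_norm_eq_inner)
        also have "\<dots> \<le> (2 * r x)\<^sup>2" by (simp add: power2_eq_square)
        finally have "norm (y - x) < 2 * r x"
          by (rule power2_less_imp_less) (use rx in simp)
        with x show "y \<in> (\<Union>x\<in>F. cball x (2 * r x))"
          by (auto simp: dist_norm norm_minus_commute intro!: bexI[of _ x] less_imp_le)
      qed
      show "(\<Union>x\<in>F. cball x (2 * r x)) \<subseteq> U" using F r by blast
    qed (use F in auto)
    show "smooth_step (2 * S y) = 1" if y: "y \<in> K" for y
    proof -
      obtain x where x: "x \<in> F" "y \<in> ball x (r x)" using y F(3) by blast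
      then have "r x > 0" using F r by auto
      have "(norm (y - x))\<^sup>2 \<le> (r x)\<^sup>2"
        by (rule power_mono) (use x in \<open>auto simp: dist_norm norm_minus_commute\<close>)
      with \<open>r x > 0\<close> have "((y - x) \<bullet> (y - x)) * inverse ((r x)\<^sup>2) \<le> 1"
        by (simp add: divide_inverse[symmetric] power2_norm_eq_inner)
      then have "b x y = 1" by (simp add: b_def smooth_step_eq_0)
      then have "1 \<le> S y"
        unfolding S_def using member_le_sum[of x F "\<lambda>x. b x y"] x F b01 by auto
      then show ?thesis by (simp add: smooth_step_eq_1)
    qed
  qed (use smooth_step_bounds in auto)
qed

text \<open>Translation invariance makes the integral of every difference quotient zero. The
  quotients converge pointwise to the derivative, and the mean value theorem bounds them by its
  maximum.\<close>

lemma integral_partial_derivative_eq_0: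
  fixes f :: "'a::euclidean_space \<Rightarrow> real"
  assumes f: "f \<in> test_functions \<Omega>" and b: "b \<in> Basis"
  shows "(LINT x|lebesgue. frechet_derivative f (at x) b) = 0"
proof -
  let ?K = "closure {x. f x \<noteq> 0}"
  define g where "g x = grad f x \<bullet> b" for x
  have cf: "continuous_on UNIV f" and cg: "continuous_on UNIV g"
    using test_functions_continuous[OF f] by (auto simp: g_def[abs_def] intro!: continuous_intros)
  then have f_meas: "f \<in> borel_measurable borel" and g_meas: "g \<in> borel_measurable borel"
    by (auto intro: borel_measurable_continuous_onI)
  have K: "compact ?K" using f by (rule test_functions_compact_support)
  have out: "x \<notin> ?K \<Longrightarrow> f x = 0" "x \<notin> ?K \<Longrightarrow> g x = 0" for x
    using closure_subset[of "{x. f x \<noteq> 0}"] grad_eq_0_outside[of x f] by (auto simp: g_def)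
  obtain R where R: "\<And>x. x \<in> ?K \<Longrightarrow> norm x \<le> R"
    using compact_imp_bounded[OF K] bounded_iff by blast
  have "compact (g ` ?K)"
    by (intro compact_continuous_image K continuous_on_subset[OF cg]) auto
  then obtain M where M: "M > 0" "\<And>y. y \<in> g ` ?K \<Longrightarrow> norm y \<le> M"
    by (meson bounded_pos compact_imp_bounded)
  have gM: "\<bar>g x\<bar> \<le> M" for x
    using M out(2)[of x] by (cases "x \<in> ?K") auto
  define t where "t n = inverse (real (Suc n))" for n
  have t: "t n > 0" "t n \<le> 1" for n by (auto simp: t_def field_simps)
  have deriv: "((\<lambda>s. f (x + s *\<^sub>R b)) has_real_derivative g (x + s *\<^sub>R b)) (at s)" for x s
  proof -
    have 1: "(f has_derivative (\<lambda>v. grad f (x + s *\<^sub>R b) \<bullet> v)) (at (x + s *\<^sub>R b))"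
      by (rule Ck_has_derivative_grad) (rule test_functions_Ck[OF f])
    have 2: "((\<lambda>s. x + s *\<^sub>R b) has_derivative (\<lambda>h. h *\<^sub>R b)) (at s)"
      by (auto intro!: derivative_eq_intros)
    have "((\<lambda>s. f (x + s *\<^sub>R b)) has_derivative (\<lambda>h. grad f (x + s *\<^sub>R b) \<bullet> (h *\<^sub>R b))) (at s)"
      by (rule has_derivative_compose[OF 2 1])
    then show ?thesis
      by (simp add: has_field_derivative_def g_def mult.commute[of _ "grad f _ \<bullet> b"])
  qed
  define q where "q n x = (f (x + t n *\<^sub>R b) - f x) / t n" for n x
  have "continuous_on UNIV (\<lambda>x. f (x + c))" for c
    by (rule continuous_on_compose2[OF cf]) (auto intro!: continuous_intros)
  then have f_shift_meas: "(\<lambda>x. f (x + c)) \<in> borel_measurable borel" for c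
    by (rule borel_measurable_continuous_onI)
  have q_meas: "q n \<in> borel_measurable borel" for n
    unfolding q_def[abs_def]
    by (intro borel_measurable_divide borel_measurable_diff f_meas f_shift_meas borel_measurable_const)
  have f_int: "integrable lborel f"
    using continuous_integrable_lebesgue[OF cf K out(1)] by (simp add: integrable_completion f_meas)
  have f_sh: "integrable lborel (\<lambda>x. f (x + c))" "(LINT x|lborel. f (x + c)) = (LINT x|lborel. f x)" for c
  proof -
    have m: "(\<lambda>x. c + x) \<in> lborel \<rightarrow>\<^sub>M borel" by simp
    show "integrable lborel (\<lambda>x. f (x + c))"
      using integrable_distr_eq[OF m f_meas] f_int unfolding lborel_distr_plus add.commute[of _ c] by simp
    show "(LINT x|lborel. f (x + c)) = (LINT x|lborel. f x)"
      using integral_distr[OF m f_meas] unfolding lborel_distr_plus add.commute[of _ c] by simp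
  qed
  have q_0: "(LINT x|lborel. q n x) = 0" for n
    unfolding q_def by (simp add: Bochner_Integration.integral_diff f_sh f_int)
  \<comment> \<open>The support lies in the ball of radius \<open>R\<close> and the steps
    \<open>t n\<close> are at most 1, so all difference quotients vanish outside the ball of radius
    \<open>R + 1\<close>.\<close>
  have q_lim: "(\<lambda>n. LINT x|lborel. q n x) \<longlonglongrightarrow> (LINT x|lborel. g x)"
  proof (rule integral_dominated_convergence[where w = "\<lambda>x. indicator (cball (0::'a) (R + 1)) x *\<^sub>R M"])
    show "integrable lborel (\<lambda>x. indicator (cball (0::'a) (R + 1)) x *\<^sub>R M)"
      by (rule borel_integrable_compact) auto
    show "AE x in lborel. norm (q n x) \<le> indicator (cball (0::'a) (R + 1)) x *\<^sub>R M" for n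
    proof (rule AE_I2)
      fix x
      show "norm (q n x) \<le> indicator (cball (0::'a) (R + 1)) x *\<^sub>R M"
      proof (cases "x \<in> cball 0 (R + 1)")
        case True
        have "\<exists>z. z > 0 \<and> z < t n \<and> f (x + t n *\<^sub>R b) - f (x + 0 *\<^sub>R b) = (t n - 0) * g (x + z *\<^sub>R b)"
          by (rule MVT2) (use t deriv in auto)
        then obtain z where "f (x + t n *\<^sub>R b) - f x = t n * g (x + z *\<^sub>R b)" by auto
        then have "q n x = g (x + z *\<^sub>R b)" using t[of n] by (simp add: q_def)
        then show ?thesis using gM True by auto
      next
        case False
        then have n: "norm x > R + 1" by auto
        have "norm x \<le> norm (x + t n *\<^sub>R b) + norm (t n *\<^sub>R b)"
          by (metis add_diff_cancel norm_triangle_ineq4)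
        moreover have "norm (t n *\<^sub>R b) \<le> 1" using t[of n] b by simp
        ultimately have "norm (x + t n *\<^sub>R b) > R" using n by linarith
        then have "x + t n *\<^sub>R b \<notin> ?K" "x \<notin> ?K"
          using R[of "x + t n *\<^sub>R b"] R[of x] n by (linarith | force)+
        then have "f (x + t n *\<^sub>R b) = 0" "f x = 0" using out(1) by blast+
        then show ?thesis using M by (simp add: q_def)
      qed
    qed
    show "AE x in lborel. (\<lambda>n. q n x) \<longlonglongrightarrow> g x"
    proof (rule AE_I2)
      fix x
      have "((\<lambda>h. (f (x + (0 + h) *\<^sub>R b) - f (x + 0 *\<^sub>R b)) / h) \<longlongrightarrow> g (x + 0 *\<^sub>R b)) (at 0)"
        using deriv[of x 0] by (simp add: DERIV_def)
      moreover have "filterlim t (at 0) sequentially"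
      proof (rule filterlim_atI)
        show "t \<longlonglongrightarrow> 0" unfolding t_def by (rule LIMSEQ_inverse_real_of_nat)
        show "\<forall>\<^sub>F n in sequentially. t n \<noteq> 0"
          by (rule always_eventually, rule allI) (metis t(1) less_irrefl)
      qed
      ultimately have "(\<lambda>n. (f (x + (0 + t n) *\<^sub>R b) - f (x + 0 *\<^sub>R b)) / t n) \<longlonglongrightarrow> g (x + 0 *\<^sub>R b)"
        by (rule filterlim_compose)
      then show "(\<lambda>n. q n x) \<longlonglongrightarrow> g x" by (simp add: q_def)
    qed
    show "g \<in> borel_measurable lborel" using g_meas by simp
    show "q n \<in> borel_measurable lborel" for n using q_meas[of n] by simp
  qed
  have "(LINT x|lborel. g x) = 0"
    by (rule LIMSEQ_unique[OF q_lim]) (simp add: q_0)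
  then have "(LINT x|lebesgue. g x) = 0"
    by (simp add: integral_completion g_meas)
  then show ?thesis by (simp add: g_def grad_inner_Basis[OF b])
qed

section \<open>Weak gradients\<close>

definition locally_integrable :: "'a::euclidean_space set \<Rightarrow> ('a \<Rightarrow> 'b::euclidean_space) \<Rightarrow> bool" where
  "locally_integrable \<Omega> f \<longleftrightarrow> (\<forall>K. compact K \<and> K \<subseteq> \<Omega> \<longrightarrow> f absolutely_integrable_on K)"

lemma locally_integrableD:
  "locally_integrable \<Omega> f \<Longrightarrow> compact K \<Longrightarrow> K \<subseteq> \<Omega> \<Longrightarrow> integrable lebesgue (\<lambda>x. indicator K x *\<^sub>R f x)"
  by (auto simp: locally_integrable_def set_integrable_def)

lemma integrable_imp_locally_integrable:
  assumes "integrable lebesgue (f :: 'a::euclidean_space \<Rightarrow> 'b::euclidean_space)"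
  shows "locally_integrable \<Omega> f"
  unfolding locally_integrable_def set_integrable_def
  using assms by (auto intro!: integrable_mult_indicator compact_imp_closed borel_closed)

lemma locally_integrable_inner:
  assumes "locally_integrable \<Omega> g"
  shows "locally_integrable \<Omega> (\<lambda>x. g x \<bullet> b)"
  unfolding locally_integrable_def set_integrable_def
proof (intro allI impI)
  fix K assume K: "compact K \<and> K \<subseteq> \<Omega>"
  have "integrable lebesgue (\<lambda>x. (indicator K x *\<^sub>R g x) \<bullet> b)"
    using locally_integrableD[OF assms] K by (intro integrable_inner_left) blast
  then show "integrable lebesgue (\<lambda>x. indicator K x *\<^sub>R (g x \<bullet> b))"
    by simp
qed

lemma locally_integrable_diff:
  "locally_integrable \<Omega> f \<Longrightarrow> locally_integrable \<Omega> g \<Longrightarrow> locally_integrable \<Omega> (\<lambda>x. f x - g x)"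
  by (simp add: locally_integrable_def set_integral_diff(1))

lemma has_weak_gradient_iff:
  "has_weak_gradient \<Omega> u g \<longleftrightarrow> locally_integrable \<Omega> u \<and> locally_integrable \<Omega> g \<and>
     (\<forall>f\<in>test_functions \<Omega>. \<forall>b\<in>Basis.
        (LINT x|lebesgue_on \<Omega>. u x * (grad f x \<bullet> b)) = - (LINT x|lebesgue_on \<Omega>. (g x \<bullet> b) * f x))"
  by (auto simp: has_weak_gradient_def locally_integrable_def grad_inner_Basis cong: ball_cong)

text \<open>The basic notions integrate over the domain, while functions over \<open>D\<close> have
  to be compared with functions over \<open>\<Omega>\<close>; extension by zero brings all integrals
  to one measure space.\<close>

lemma integral_lebesgue_on_eq:
  fixes F :: "'a::euclidean_space \<Rightarrow> 'b::euclidean_space"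
  assumes "\<Omega> \<in> sets lebesgue" "\<And>x. x \<notin> \<Omega> \<Longrightarrow> F x = 0"
  shows "(LINT x|lebesgue_on \<Omega>. F x) = (LINT x|lebesgue. F x)"
proof -
  have "(\<lambda>x. indicator \<Omega> x *\<^sub>R F x) = F" using assms(2) by (auto simp: indicator_def)
  then show ?thesis using integral_restrict_space[of \<Omega> lebesgue F] assms(1) by simp
qed

lemma integrable_lebesgue_on_iff:
  fixes F :: "'a::euclidean_space \<Rightarrow> 'b::euclidean_space"
  assumes "\<Omega> \<in> sets lebesgue" "\<And>x. x \<notin> \<Omega> \<Longrightarrow> F x = 0"
  shows "integrable (lebesgue_on \<Omega>) F \<longleftrightarrow> integrable lebesgue F"
proof -
  have "(\<lambda>x. indicator \<Omega> x *\<^sub>R F x) = F" using assms(2) by (auto simp: indicator_def)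
  then show ?thesis using integrable_restrict_space[of \<Omega> lebesgue F] assms(1) by simp
qed

lemma borel_measurable_lebesgue_continuous:
  "continuous_on UNIV f \<Longrightarrow> f \<in> borel_measurable lebesgue"
  by (rule measurable_completion) (simp add: borel_measurable_continuous_onI)

lemma locally_integrable_mult:
  assumes F: "locally_integrable \<Omega> F" and \<eta>: "continuous_on UNIV \<eta>"
    and K: "compact K" "K \<subseteq> \<Omega>" "\<And>x. x \<notin> K \<Longrightarrow> \<eta> x = 0"
  shows "integrable lebesgue (\<lambda>x. F x * \<eta> x :: real)"
proof -
  have 1: "integrable lebesgue (\<lambda>x. indicator K x *\<^sub>R F x)"
    using locally_integrableD[OF F K(1,2)] .
  have "compact (\<eta> ` K)"
    by (intro compact_continuous_image K continuous_on_subset[OF \<eta>]) auto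
  then obtain M where M: "M > 0" "\<And>y. y \<in> \<eta> ` K \<Longrightarrow> norm y \<le> M"
    by (meson bounded_pos compact_imp_bounded)
  have bnd: "\<bar>\<eta> x\<bar> \<le> M" for x
    using M K(3)[of x] by (cases "x \<in> K") auto
  have eq: "F x * \<eta> x = (indicator K x *\<^sub>R F x) * \<eta> x" for x
    using K(3)[of x] by (cases "x \<in> K") auto
  show ?thesis
  proof (rule Bochner_Integration.integrable_bound[where f = "\<lambda>x. M * (indicator K x *\<^sub>R F x)"])
    show "integrable lebesgue (\<lambda>x. M * (indicator K x *\<^sub>R F x))"
      using 1 by simp
    show "(\<lambda>x. F x * \<eta> x) \<in> borel_measurable lebesgue"
      unfolding eq
      by (intro borel_measurable_times borel_measurable_integrable[OF 1] borel_measurable_lebesgue_continuous \<eta>)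
    show "AE x in lebesgue. norm (F x * \<eta> x) \<le> norm (M * (indicator K x *\<^sub>R F x))"
    proof (rule AE_I2)
      fix x
      have "norm (F x * \<eta> x) = \<bar>\<eta> x\<bar> * \<bar>indicator K x *\<^sub>R F x\<bar>"
        unfolding eq by (simp add: abs_mult)
      also have "\<dots> \<le> M * \<bar>indicator K x *\<^sub>R F x\<bar>"
        by (intro mult_right_mono bnd) simp
      finally show "norm (F x * \<eta> x) \<le> norm (M * (indicator K x *\<^sub>R F x))"
        using M(1) by (simp add: abs_mult)
    qed
  qed
qed

lemma test_functions_support_eq_0:
  assumes "x \<notin> closure {x. f x \<noteq> 0}"
  shows "f x = 0" "grad f x \<bullet> b = 0"
  using assms grad_eq_0_outside[of x f] closure_subset[of "{x. f x \<noteq> 0}"] by auto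

lemma locally_integrable_mult_test:
  assumes "locally_integrable \<Omega> F" "f \<in> test_functions \<Omega>"
  shows "integrable lebesgue (\<lambda>x. F x * f x :: real)" "integrable lebesgue (\<lambda>x. F x * (grad f x \<bullet> b))"
proof -
  have K: "compact (closure {x. f x \<noteq> 0})" "closure {x. f x \<noteq> 0} \<subseteq> \<Omega>"
    using assms(2) by (auto simp: test_functions_def)
  note c = test_functions_continuous[OF assms(2)]
  show "integrable lebesgue (\<lambda>x. F x * f x :: real)"
    by (rule locally_integrable_mult[OF assms(1) c(1) K]) (rule test_functions_support_eq_0(1))
  have c2: "continuous_on UNIV (\<lambda>x. grad f x \<bullet> b)"
    by (intro continuous_intros c)
  show "integrable lebesgue (\<lambda>x. F x * (grad f x \<bullet> b))"
    by (rule locally_integrable_mult[OF assms(1) c2 K]) (rule test_functions_support_eq_0(2))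
qed

lemma test_functions_integrable:
  assumes "f \<in> test_functions \<Omega>"
  shows "integrable lebesgue f" "integrable lebesgue (grad f)"
proof -
  note c = test_functions_continuous[OF assms] and K = test_functions_compact_support[OF assms]
  show "integrable lebesgue f"
    by (rule continuous_integrable_lebesgue[OF c(1) K]) (rule test_functions_support_eq_0(1))
  show "integrable lebesgue (grad f)"
    by (rule continuous_integrable_lebesgue[OF c(2) K]) (rule grad_eq_0_outside)
qed

text \<open>The product \<open>f * h\<close> is again a test function, so its partial derivatives
  have integral zero; the product rule turns this into integration by parts.\<close>

lemma has_weak_gradient_test_function:
  assumes \<Omega>: "\<Omega> \<in> sets lebesgue" and f: "f \<in> test_functions \<Omega>"
  shows "has_weak_gradient \<Omega> f (grad f)"
  unfolding has_weak_gradient_iff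
proof (intro conjI ballI)
  show "locally_integrable \<Omega> f" "locally_integrable \<Omega> (grad f)"
    using test_functions_integrable[OF f] by (auto intro: integrable_imp_locally_integrable)
  then have gl: "locally_integrable \<Omega> (\<lambda>x. grad f x \<bullet> b)" for b
    by (intro locally_integrable_inner)
  fix h and b :: 'a assume h: "h \<in> test_functions \<Omega>" and b: "b \<in> Basis"
  have prod: "(\<lambda>x. f x * h x) \<in> test_functions \<Omega>"
    using test_functions_mult[OF h] f test_functions_Ck by blast
  have "grad (\<lambda>x. f x * h x) x \<bullet> b = f x * (grad h x \<bullet> b) + (grad f x \<bullet> b) * h x" for x
    by (simp add: grad_mult[OF test_functions_Ck[OF f] test_functions_Ck[OF h]] inner_add_left)
  then have "0 = (LINT x|lebesgue. f x * (grad h x \<bullet> b) + (grad f x \<bullet> b) * h x)"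
    using integral_partial_derivative_eq_0[OF prod b] by (simp add: grad_inner_Basis[OF b, symmetric])
  also have "\<dots> = (LINT x|lebesgue. f x * (grad h x \<bullet> b)) + (LINT x|lebesgue. (grad f x \<bullet> b) * h x)"
    using locally_integrable_mult_test[OF gl h] locally_integrable_mult_test[OF \<open>locally_integrable \<Omega> f\<close> h]
    by (intro Bochner_Integration.integral_add)
  finally show "(LINT x|lebesgue_on \<Omega>. f x * (grad h x \<bullet> b)) = - (LINT x|lebesgue_on \<Omega>. (grad f x \<bullet> b) * h x)"
    using test_functions_eq_0[OF f] by (simp add: integral_lebesgue_on_eq[OF \<Omega>])
qed

lemma has_weak_gradient_diff:
  assumes \<Omega>: "\<Omega> \<in> sets lebesgue" and u: "has_weak_gradient \<Omega> u g" and v: "has_weak_gradient \<Omega> v h"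
  shows "has_weak_gradient \<Omega> (\<lambda>x. u x - v x) (\<lambda>x. g x - h x)"
  unfolding has_weak_gradient_iff
proof (intro conjI ballI)
  show "locally_integrable \<Omega> (\<lambda>x. u x - v x)" "locally_integrable \<Omega> (\<lambda>x. g x - h x)"
    using u v by (auto simp: has_weak_gradient_iff intro: locally_integrable_diff)
  fix f and b :: 'a assume f: "f \<in> test_functions \<Omega>" and b: "b \<in> Basis"
  have int: "integrable (lebesgue_on \<Omega>) (\<lambda>x. F x * f x)"
    "integrable (lebesgue_on \<Omega>) (\<lambda>x. F x * (grad f x \<bullet> b))" if "locally_integrable \<Omega> F" for F
    using test_functions_eq_0[OF f] locally_integrable_mult_test[OF that f]
    by (auto simp: integrable_lebesgue_on_iff[OF \<Omega>])
  have l: "locally_integrable \<Omega> u" "locally_integrable \<Omega> v"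
    "locally_integrable \<Omega> (\<lambda>x. g x \<bullet> b)" "locally_integrable \<Omega> (\<lambda>x. h x \<bullet> b)"
    using u v by (auto simp: has_weak_gradient_iff intro: locally_integrable_inner)
  show "(LINT x|lebesgue_on \<Omega>. (u x - v x) * (grad f x \<bullet> b)) =
      - (LINT x|lebesgue_on \<Omega>. ((g x - h x) \<bullet> b) * f x)"
    using u v f b
    by (simp add: left_diff_distrib inner_diff_left has_weak_gradient_iff
        Bochner_Integration.integral_diff int l)
qed

section \<open>The fundamental lemma of the calculus of variations and uniqueness of weak
  gradients\<close>

lemma fundamental_lemma_compact:
  fixes h :: "'a::euclidean_space \<Rightarrow> real"
  assumes \<Omega>: "open \<Omega>" and h: "locally_integrable \<Omega> h"
    and zero: "\<And>f. f \<in> test_functions \<Omega> \<Longrightarrow> (LINT x|lebesgue. h x * f x) = 0"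
    and K: "compact K" "K \<subseteq> \<Omega>"
  shows "(LINT x|lebesgue. indicator K x * h x) = 0"
proof (cases "K = {}")
  case False
  \<comment> \<open>Integrability of \<open>h\<close> is available over compact subsets of
    \<open>\<Omega>\<close>, so the dominating function lives on a compact neighbourhood
    \<open>C\<close> of \<open>K\<close> inside \<open>\<Omega>\<close>. The cutoffs
    \<open>\<eta> n\<close> are supported in shrinking neighbourhoods within \<open>C\<close> and
    converge pointwise to the indicator of \<open>K\<close>.\<close>
  obtain e where e: "e > 0" "{x. infdist x K \<le> e} \<subseteq> \<Omega>"
    using compact_in_open_separated[OF False K(1) \<Omega> K(2)] .
  define C where "C = {x. infdist x K \<le> e}"
  have C: "compact C" "C \<subseteq> \<Omega>"
    using compact_infdist_le[OF False K(1) e(1)] e(2) by (auto simp: C_def)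
  define U where "U n = {x. infdist x K < e / real (Suc n)}" for n
  have eSn: "0 < e / real (Suc n)" "e / real (Suc n) \<le> e" for n
    using e(1) by (auto simp: field_simps)
  have U: "open (U n)" "K \<subseteq> U n" "U n \<subseteq> C" for n
  proof -
    show "open (U n)" unfolding U_def by (intro open_Collect_less continuous_intros)
    show "K \<subseteq> U n" using eSn(1)[of n] by (auto simp: U_def)
    show "U n \<subseteq> C" using eSn(2)[of n] unfolding U_def C_def by force
  qed
  have "\<exists>\<eta>. \<eta> \<in> test_functions (U n) \<and> (\<forall>x\<in>K. \<eta> x = 1) \<and> (\<forall>x. 0 \<le> \<eta> x \<and> \<eta> x \<le> 1)" for n
    by (rule smooth_cutoff_exists[OF K(1) U(1,2)[of n]]) blast
  then obtain \<eta> where \<eta>: "\<And>n. \<eta> n \<in> test_functions (U n)" "\<And>n x. x \<in> K \<Longrightarrow> \<eta> n x = 1"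
    "\<And>n x. 0 \<le> \<eta> n x" "\<And>n x. \<eta> n x \<le> 1"
    by metis
  have \<eta>\<Omega>: "\<eta> n \<in> test_functions \<Omega>" for n
    using \<eta>(1) test_functions_mono[of "U n" \<Omega>] U(3)[of n] C(2) by blast
  have hK: "integrable lebesgue (\<lambda>x. indicator K x *\<^sub>R h x)"
    and hC: "integrable lebesgue (\<lambda>x. indicator C x *\<^sub>R h x)"
    using locally_integrableD[OF h] K C by auto
  have "(\<lambda>n. LINT x|lebesgue. h x * \<eta> n x) \<longlonglongrightarrow> (LINT x|lebesgue. indicator K x *\<^sub>R h x)"
  proof (rule integral_dominated_convergence[where w = "\<lambda>x. norm (indicator C x *\<^sub>R h x)"])
    show "(\<lambda>x. indicator K x *\<^sub>R h x) \<in> borel_measurable lebesgue"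
      using hK by (rule borel_measurable_integrable)
    show "(\<lambda>x. h x * \<eta> n x) \<in> borel_measurable lebesgue" for n
      using locally_integrable_mult_test(1)[OF h \<eta>\<Omega>] by (rule borel_measurable_integrable)
    show "integrable lebesgue (\<lambda>x. norm (indicator C x *\<^sub>R h x))"
      using hC by (rule integrable_norm)
    show "AE x in lebesgue. norm (h x * \<eta> n x) \<le> norm (indicator C x *\<^sub>R h x)" for n
    proof (rule AE_I2)
      fix x
      show "norm (h x * \<eta> n x) \<le> norm (indicator C x *\<^sub>R h x)"
      proof (cases "x \<in> C")
        case True
        have "\<bar>h x\<bar> * \<bar>\<eta> n x\<bar> \<le> \<bar>h x\<bar> * 1"
          using \<eta>(3,4)[of n x] by (intro mult_left_mono) auto
        with True show ?thesis by (simp add: abs_mult)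
      next
        case False
        then have "\<eta> n x = 0" using test_functions_eq_0(1)[OF \<eta>(1)] U(3) by blast
        then show ?thesis by simp
      qed
    qed
    show "AE x in lebesgue. (\<lambda>n. h x * \<eta> n x) \<longlonglongrightarrow> indicator K x *\<^sub>R h x"
    proof (rule AE_I2)
      fix x
      show "(\<lambda>n. h x * \<eta> n x) \<longlonglongrightarrow> indicator K x *\<^sub>R h x"
      proof (cases "x \<in> K")
        case True
        then show ?thesis by (simp add: \<eta>(2))
      next
        case x: False
        have "infdist x K > 0"
          by (rule infdist_pos_not_in_closed) (use x False K compact_imp_closed in auto)
        moreover have "(\<lambda>n. e / real (Suc n)) \<longlonglongrightarrow> 0"
          by (rule LIMSEQ_Suc[OF lim_const_over_n])
        ultimately have "\<forall>\<^sub>F n in sequentially. e / real (Suc n) < infdist x K"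
          by (rule order_tendstoD(2)[rotated])
        then have "\<forall>\<^sub>F n in sequentially. h x * \<eta> n x = 0"
        proof eventually_elim
          case (elim n)
          then have "x \<notin> U n" by (simp add: U_def)
          then show ?case using test_functions_eq_0(1)[OF \<eta>(1)] by simp
        qed
        then show ?thesis using x by (simp add: tendsto_eventually)
      qed
    qed
  qed
  then have "(\<lambda>n::nat. 0) \<longlonglongrightarrow> (LINT x|lebesgue. indicator K x *\<^sub>R h x)"
    by (simp only: zero[OF \<eta>\<Omega>])
  then show ?thesis by (simp add: LIMSEQ_const_iff)
qed simp

text \<open>Up to null sets a measurable set is a countable union of compact sets, and a compact set
  on which \<open>h > 0\<close> is null because \<open>h\<close> has integral zero over it. The
  decomposition is applied twice: to \<open>\<Omega>\<close>, since measurability of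
  \<open>h\<close> is known on compact subsets only, and then to the part of each compact piece
  where \<open>h > 0\<close>.\<close>

lemma fundamental_lemma_pos:
  fixes h :: "'a::euclidean_space \<Rightarrow> real"
  assumes \<Omega>: "open \<Omega>" and h: "locally_integrable \<Omega> h"
    and zero: "\<And>f. f \<in> test_functions \<Omega> \<Longrightarrow> (LINT x|lebesgue. h x * f x) = 0"
  shows "AE x in lebesgue. x \<in> \<Omega> \<longrightarrow> h x \<le> 0"
proof -
  have "\<Omega> \<in> sets lebesgue" using \<Omega> by (simp add: borel_open)
  then obtain C0 T0 where C0: "fsigma C0" "T0 \<in> null_sets lebesgue" "C0 \<union> T0 = \<Omega>"
    by (rule lebesgue_set_almost_fsigma)
  from C0(1) obtain F :: "nat \<Rightarrow> 'a set" where F: "range F \<subseteq> Collect compact" "C0 = \<Union> (range F)"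
    unfolding fsigma_Union_compact by blast
  have null: "K \<in> null_sets lebesgue" if K: "compact K" "K \<subseteq> \<Omega>" "\<And>x. x \<in> K \<Longrightarrow> h x > 0" for K
  proof -
    have hK: "integrable lebesgue (\<lambda>x. indicator K x *\<^sub>R h x)"
      using locally_integrableD[OF h K(1,2)] .
    have "AE x in lebesgue. 0 \<le> indicator K x *\<^sub>R h x"
      using K(3) by (intro AE_I2) (auto simp: indicator_def less_imp_le)
    then have "AE x in lebesgue. indicator K x *\<^sub>R h x = 0"
      using integral_nonneg_eq_0_iff_AE[OF hK] fundamental_lemma_compact[OF assms K(1,2)]
      unfolding real_scaleR_def by blast
    then have "AE x in lebesgue. x \<notin> K"
    proof eventually_elim
      case (elim x)
      then show ?case using K(3)[of x] by (auto simp: indicator_def split: if_splits)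
    qed
    then show ?thesis
      using AE_iff_null_sets[of K lebesgue] K(1) by (simp add: compact_imp_closed borel_closed)
  qed
  have "{x \<in> F n. h x > 0} \<in> null_sets lebesgue" for n
  proof -
    have Fn: "compact (F n)" "F n \<subseteq> \<Omega>" using F C0(3) by auto
    have "(\<lambda>x. indicator (F n) x *\<^sub>R h x) \<in> borel_measurable lebesgue"
      using locally_integrableD[OF h Fn] by (rule borel_measurable_integrable)
    then have "{x \<in> space lebesgue. 0 < indicator (F n) x *\<^sub>R h x} \<in> sets lebesgue"
      by (intro borel_measurable_less borel_measurable_const)
    moreover have "{x \<in> space lebesgue. 0 < indicator (F n) x *\<^sub>R h x} = {x \<in> F n. h x > 0}"
      by (auto simp: indicator_def split: if_splits)
    ultimately have "{x \<in> F n. h x > 0} \<in> sets lebesgue" by simp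
    then obtain C T where CT: "fsigma C" "T \<in> null_sets lebesgue" "C \<union> T = {x \<in> F n. h x > 0}"
      by (rule lebesgue_set_almost_fsigma)
    from CT(1) obtain G :: "nat \<Rightarrow> 'a set" where G: "range G \<subseteq> Collect compact" "C = \<Union> (range G)"
      unfolding fsigma_Union_compact by blast
    have "G m \<in> null_sets lebesgue" for m
    proof (rule null)
      have sub: "G m \<subseteq> {x \<in> F n. h x > 0}" using G CT(3) by blast
      show "compact (G m)" using G by auto
      show "G m \<subseteq> \<Omega>" using sub Fn by blast
      show "h x > 0" if "x \<in> G m" for x using sub that by blast
    qed
    then have "C \<in> null_sets lebesgue" unfolding G(2) by (intro null_sets_UN)
    then show ?thesis unfolding CT(3)[symmetric] using CT(2) by (rule null_sets.Un)
  qed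
  then have "(\<Union>n. {x \<in> F n. h x > 0}) \<union> T0 \<in> null_sets lebesgue"
    by (intro null_sets.Un null_sets_UN C0)
  then show ?thesis
    by (rule AE_I') (use F(2) C0(3) in auto)
qed

lemma fundamental_lemma:
  fixes h :: "'a::euclidean_space \<Rightarrow> real"
  assumes \<Omega>: "open \<Omega>" and h: "locally_integrable \<Omega> h"
    and zero: "\<And>f. f \<in> test_functions \<Omega> \<Longrightarrow> (LINT x|lebesgue. h x * f x) = 0"
  shows "AE x in lebesgue. x \<in> \<Omega> \<longrightarrow> h x = 0"
proof -
  have "locally_integrable \<Omega> (\<lambda>x. 0 :: real)"
    by (rule integrable_imp_locally_integrable) simp
  then have "locally_integrable \<Omega> (\<lambda>x. - h x)"
    using locally_integrable_diff[OF _ h, of "\<lambda>x. 0"] by simp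
  then have "AE x in lebesgue. x \<in> \<Omega> \<longrightarrow> - h x \<le> 0"
    by (rule fundamental_lemma_pos[OF \<Omega>]) (simp add: zero)
  moreover have "AE x in lebesgue. x \<in> \<Omega> \<longrightarrow> h x \<le> 0"
    by (rule fundamental_lemma_pos[OF assms])
  ultimately show ?thesis
    by eventually_elim auto
qed

text \<open>\<open>weak_grad\<close> is an arbitrary choice; this uniqueness is what allows an
  explicit gradient to replace it in the norm, in the energy and in the eigenvalue equation.\<close>

lemma has_weak_gradient_unique:
  assumes \<Omega>: "open \<Omega>" and g: "has_weak_gradient \<Omega> u g" and h: "has_weak_gradient \<Omega> u h"
  shows "AE x in lebesgue. x \<in> \<Omega> \<longrightarrow> g x = h x"
proof -
  have \<Omega>': "\<Omega> \<in> sets lebesgue" using \<Omega> by (simp add: borel_open)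
  have l: "locally_integrable \<Omega> g" "locally_integrable \<Omega> h"
    using g h by (auto simp: has_weak_gradient_iff)
  have "AE x in lebesgue. x \<in> \<Omega> \<longrightarrow> g x \<bullet> b - h x \<bullet> b = 0" if b: "b \<in> Basis" for b
  proof (rule fundamental_lemma[OF \<Omega>])
    show "locally_integrable \<Omega> (\<lambda>x. g x \<bullet> b - h x \<bullet> b)"
      using l by (intro locally_integrable_diff locally_integrable_inner)
    fix f assume f: "f \<in> test_functions \<Omega>"
    have "(LINT x|lebesgue. (g x \<bullet> b - h x \<bullet> b) * f x) =
        (LINT x|lebesgue. (g x \<bullet> b) * f x) - (LINT x|lebesgue. (h x \<bullet> b) * f x)"
      unfolding left_diff_distrib
      by (intro Bochner_Integration.integral_diff locally_integrable_mult_test(1)[OF locally_integrable_inner f] l)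
    also have "\<dots> = (LINT x|lebesgue_on \<Omega>. (g x \<bullet> b) * f x) - (LINT x|lebesgue_on \<Omega>. (h x \<bullet> b) * f x)"
      using test_functions_eq_0[OF f] by (simp add: integral_lebesgue_on_eq[OF \<Omega>'])
    also have "\<dots> = 0" using g h f b by (simp add: has_weak_gradient_iff)
    finally show "(LINT x|lebesgue. (g x \<bullet> b - h x \<bullet> b) * f x) = 0" .
  qed
  then have "AE x in lebesgue. \<forall>b\<in>Basis. x \<in> \<Omega> \<longrightarrow> g x \<bullet> b - h x \<bullet> b = 0"
    by (subst AE_finite_all) auto
  then show ?thesis
    by eventually_elim (auto intro: euclidean_eqI)
qed

section \<open>Convergence in the p-th mean\<close>

text \<open>A crude substitute for Minkowski's inequality: it serves to prove finiteness and
  convergence to zero, for which the factor \<open>2 powr p\<close> is harmless, and it permits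
  working with p-th powers instead of roots.\<close>

lemma norm_add_powr_le:
  fixes a b :: "'a::real_normed_vector"
  assumes "p \<ge> 0"
  shows "norm (a + b) powr p \<le> 2 powr p * (norm a powr p + norm b powr p)"
proof -
  have "norm (a + b) \<le> 2 * max (norm a) (norm b)"
    using norm_triangle_ineq[of a b] by linarith
  then have "norm (a + b) powr p \<le> (2 * max (norm a) (norm b)) powr p"
    using assms by (intro powr_mono2) auto
  also have "\<dots> = 2 powr p * max (norm a) (norm b) powr p"
    by (simp add: powr_mult)
  also have "\<dots> \<le> 2 powr p * (norm a powr p + norm b powr p)"
    by (intro mult_left_mono) (auto simp: max_def)
  finally show ?thesis .
qed

text \<open>This is the p-th power of the usual distance. Values in \<open>ennreal\<close> give it a
  meaning before any integrability is known, so that finiteness of a limit can be deduced from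
  convergence.\<close>

definition Lp_dist :: "real \<Rightarrow> ('a::euclidean_space \<Rightarrow> 'b::euclidean_space) \<Rightarrow> ('a \<Rightarrow> 'b) \<Rightarrow> ennreal" where
  "Lp_dist p f g = (\<integral>\<^sup>+x. ennreal (norm (f x - g x) powr p) \<partial>lebesgue)"

definition Lp_tendsto ::
    "real \<Rightarrow> (nat \<Rightarrow> 'a::euclidean_space \<Rightarrow> 'b::euclidean_space) \<Rightarrow> ('a \<Rightarrow> 'b) \<Rightarrow> bool" where
  "Lp_tendsto p F f \<longleftrightarrow> (\<lambda>n. Lp_dist p (F n) f) \<longlonglongrightarrow> 0"

lemma nn_integral_norm_powr_add_le:
  fixes f g :: "'a::euclidean_space \<Rightarrow> 'b::euclidean_space"
  assumes "p \<ge> 0" and [measurable]: "f \<in> borel_measurable lebesgue" "g \<in> borel_measurable lebesgue"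
  shows "(\<integral>\<^sup>+x. ennreal (norm (f x + g x) powr p) \<partial>lebesgue) \<le> ennreal (2 powr p) *
      ((\<integral>\<^sup>+x. ennreal (norm (f x) powr p) \<partial>lebesgue) + (\<integral>\<^sup>+x. ennreal (norm (g x) powr p) \<partial>lebesgue))"
proof -
  have "(\<integral>\<^sup>+x. ennreal (norm (f x + g x) powr p) \<partial>lebesgue) \<le>
      (\<integral>\<^sup>+x. ennreal (2 powr p) * (ennreal (norm (f x) powr p) + ennreal (norm (g x) powr p)) \<partial>lebesgue)"
    using norm_add_powr_le[OF assms(1)]
    by (intro nn_integral_mono)
      (simp add: ennreal_mult[symmetric] ennreal_plus[symmetric] ennreal_leI del: ennreal_plus)
  also have "\<dots> = ennreal (2 powr p) *
      ((\<integral>\<^sup>+x. ennreal (norm (f x) powr p) \<partial>lebesgue) + (\<integral>\<^sup>+x. ennreal (norm (g x) powr p) \<partial>lebesgue))"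
    by (simp add: nn_integral_cmult nn_integral_add)
  finally show ?thesis .
qed

lemma Lp_dist_triangle:
  assumes "p \<ge> 0" "f \<in> borel_measurable lebesgue" "g \<in> borel_measurable lebesgue" "h \<in> borel_measurable lebesgue"
  shows "Lp_dist p f h \<le> ennreal (2 powr p) * (Lp_dist p f g + Lp_dist p g h)"
  using nn_integral_norm_powr_add_le[OF assms(1), of "\<lambda>x. f x - g x" "\<lambda>x. g x - h x"] assms
  by (simp add: Lp_dist_def)

lemma tendsto_ennreal_zero_cmult:
  "(X \<longlongrightarrow> 0) F \<Longrightarrow> ((\<lambda>n. ennreal c * X n) \<longlongrightarrow> 0) F"
  using ennreal_tendsto_cmult[of "ennreal c" X 0 F] by simp

lemma ennreal_tendsto_zero_squeeze:
  fixes X Y :: "'a \<Rightarrow> ennreal"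
  assumes "(Y \<longlongrightarrow> 0) F" "\<And>n. X n \<le> Y n"
  shows "(X \<longlongrightarrow> 0) F"
  by (rule tendsto_sandwich[OF _ _ tendsto_const assms(1)]) (use assms(2) in auto)

lemma Lp_tendsto_triangle:
  assumes "p \<ge> 0" and meas: "\<And>n. F n \<in> borel_measurable lebesgue" "\<And>n. G n \<in> borel_measurable lebesgue"
    "h \<in> borel_measurable lebesgue"
    and "(\<lambda>n. Lp_dist p (F n) (G n)) \<longlonglongrightarrow> 0" "Lp_tendsto p G h"
  shows "Lp_tendsto p F h"
  unfolding Lp_tendsto_def
proof (rule ennreal_tendsto_zero_squeeze)
  have "(\<lambda>n. Lp_dist p (F n) (G n) + Lp_dist p (G n) h) \<longlonglongrightarrow> 0 + 0"
    using assms(5,6) unfolding Lp_tendsto_def by (rule tendsto_add)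
  then show "(\<lambda>n. ennreal (2 powr p) * (Lp_dist p (F n) (G n) + Lp_dist p (G n) h)) \<longlonglongrightarrow> 0"
    by (intro tendsto_ennreal_zero_cmult) simp
qed (rule Lp_dist_triangle[OF assms(1) meas])

lemma Lp_tendsto_add:
  assumes "p \<ge> 0" and meas: "\<And>n. F n \<in> borel_measurable lebesgue" "\<And>n. G n \<in> borel_measurable lebesgue"
    "f \<in> borel_measurable lebesgue" "g \<in> borel_measurable lebesgue"
    and lim: "Lp_tendsto p F f" "Lp_tendsto p G g"
  shows "Lp_tendsto p (\<lambda>n x. F n x + G n x) (\<lambda>x. f x + g x)"
  unfolding Lp_tendsto_def
proof (rule ennreal_tendsto_zero_squeeze)
  have "(\<lambda>n. Lp_dist p (F n) f + Lp_dist p (G n) g) \<longlonglongrightarrow> 0 + 0"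
    using lim unfolding Lp_tendsto_def by (rule tendsto_add)
  then show "(\<lambda>n. ennreal (2 powr p) * (Lp_dist p (F n) f + Lp_dist p (G n) g)) \<longlonglongrightarrow> 0"
    by (intro tendsto_ennreal_zero_cmult) simp
  fix n
  have "(\<lambda>x. F n x - f x) \<in> borel_measurable lebesgue" "(\<lambda>x. G n x - g x) \<in> borel_measurable lebesgue"
    using meas by auto
  from nn_integral_norm_powr_add_le[OF assms(1) this]
  show "Lp_dist p (\<lambda>x. F n x + G n x) (\<lambda>x. f x + g x) \<le> ennreal (2 powr p) * (Lp_dist p (F n) f + Lp_dist p (G n) g)"
    by (simp add: Lp_dist_def algebra_simps)
qed

text \<open>\<open>A n * G n - a * g\<close> splits into \<open>A n * (G n - g)\<close>, controlled
  by the bound \<open>C\<close>, and \<open>(A n - a) * g\<close>, controlled by dominated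
  convergence with majorant \<open>(2 * C) powr p\<close> times the p-th power of
  \<open>norm (g x)\<close>. The limits of product and chain rules below are instances, with the
  nonlinear terms placed in the bounded coefficient.\<close>

lemma Lp_tendsto_scale:
  fixes A :: "nat \<Rightarrow> 'a::euclidean_space \<Rightarrow> real" and G :: "nat \<Rightarrow> 'a \<Rightarrow> 'b::euclidean_space"
  assumes p: "p > 0"
    and meas: "\<And>n. A n \<in> borel_measurable lebesgue" "a \<in> borel_measurable lebesgue"
      "\<And>n. G n \<in> borel_measurable lebesgue" "g \<in> borel_measurable lebesgue"
    and bound: "\<And>n x. \<bar>A n x\<bar> \<le> C" "\<And>x. \<bar>a x\<bar> \<le> C"
    and lim: "AE x in lebesgue. (\<lambda>n. A n x) \<longlonglongrightarrow> a x" "Lp_tendsto p G g"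
    and fin: "(\<integral>\<^sup>+x. ennreal (norm (g x) powr p) \<partial>lebesgue) < \<infinity>"
  shows "Lp_tendsto p (\<lambda>n x. A n x *\<^sub>R G n x) (\<lambda>x. a x *\<^sub>R g x)"
proof (rule Lp_tendsto_triangle)
  have C: "C \<ge> 0" using bound(2)[of 0] by linarith
  show "(\<lambda>n. Lp_dist p (\<lambda>x. A n x *\<^sub>R G n x) (\<lambda>x. A n x *\<^sub>R g x)) \<longlonglongrightarrow> 0"
  proof (rule ennreal_tendsto_zero_squeeze)
    show "(\<lambda>n. ennreal (C powr p) * Lp_dist p (G n) g) \<longlonglongrightarrow> 0"
      using lim(2) by (intro tendsto_ennreal_zero_cmult) (simp add: Lp_tendsto_def)
    fix n
    have "norm (A n x *\<^sub>R G n x - A n x *\<^sub>R g x) powr p \<le> C powr p * norm (G n x - g x) powr p" for x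
    proof -
      have "norm (A n x *\<^sub>R G n x - A n x *\<^sub>R g x) = \<bar>A n x\<bar> * norm (G n x - g x)"
        by (simp add: scaleR_diff_right[symmetric])
      then have "norm (A n x *\<^sub>R G n x - A n x *\<^sub>R g x) powr p = \<bar>A n x\<bar> powr p * norm (G n x - g x) powr p"
        by (simp add: powr_mult)
      also have "\<dots> \<le> C powr p * norm (G n x - g x) powr p"
        using bound(1)[of n x] p by (intro mult_right_mono powr_mono2) auto
      finally show ?thesis .
    qed
    then have "Lp_dist p (\<lambda>x. A n x *\<^sub>R G n x) (\<lambda>x. A n x *\<^sub>R g x) \<le>
        (\<integral>\<^sup>+x. ennreal (C powr p) * ennreal (norm (G n x - g x) powr p) \<partial>lebesgue)"
      unfolding Lp_dist_def
      by (intro nn_integral_mono) (simp add: ennreal_mult[symmetric] ennreal_leI)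
    also have "\<dots> = ennreal (C powr p) * Lp_dist p (G n) g"
      unfolding Lp_dist_def using meas by (intro nn_integral_cmult) measurable
    finally show "Lp_dist p (\<lambda>x. A n x *\<^sub>R G n x) (\<lambda>x. A n x *\<^sub>R g x) \<le> ennreal (C powr p) * Lp_dist p (G n) g" .
  qed
  have "(\<lambda>n. \<integral>\<^sup>+x. ennreal (norm (A n x *\<^sub>R g x - a x *\<^sub>R g x) powr p) \<partial>lebesgue) \<longlonglongrightarrow>
      (\<integral>\<^sup>+x. 0 \<partial>(lebesgue :: 'a measure))"
  proof (rule nn_integral_dominated_convergence[where w = "\<lambda>x. ennreal ((2 * C) powr p) * ennreal (norm (g x) powr p)"])
    show "AE x in lebesgue. ennreal (norm (A n x *\<^sub>R g x - a x *\<^sub>R g x) powr p) \<le>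
        ennreal ((2 * C) powr p) * ennreal (norm (g x) powr p)" for n
    proof (rule AE_I2)
      fix x
      have "norm (A n x *\<^sub>R g x - a x *\<^sub>R g x) = \<bar>A n x - a x\<bar> * norm (g x)"
        by (simp add: scaleR_diff_left[symmetric])
      then have "norm (A n x *\<^sub>R g x - a x *\<^sub>R g x) powr p = \<bar>A n x - a x\<bar> powr p * norm (g x) powr p"
        by (simp add: powr_mult)
      also have "\<dots> \<le> (2 * C) powr p * norm (g x) powr p"
        using bound(1)[of n x] bound(2)[of x] p by (intro mult_right_mono powr_mono2) auto
      finally show "ennreal (norm (A n x *\<^sub>R g x - a x *\<^sub>R g x) powr p) \<le>
        ennreal ((2 * C) powr p) * ennreal (norm (g x) powr p)"
        by (simp add: ennreal_mult[symmetric] ennreal_leI)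
    qed
    have "(\<integral>\<^sup>+x. ennreal ((2 * C) powr p) * ennreal (norm (g x) powr p) \<partial>lebesgue) =
        ennreal ((2 * C) powr p) * (\<integral>\<^sup>+x. ennreal (norm (g x) powr p) \<partial>lebesgue)"
      using meas by (intro nn_integral_cmult) measurable
    then show "(\<integral>\<^sup>+x. ennreal ((2 * C) powr p) * ennreal (norm (g x) powr p) \<partial>lebesgue) < \<infinity>"
      using fin by (simp add: ennreal_mult_less_top)
    show "AE x in lebesgue. (\<lambda>n. ennreal (norm (A n x *\<^sub>R g x - a x *\<^sub>R g x) powr p)) \<longlonglongrightarrow> 0"
      using lim(1)
    proof eventually_elim
      case (elim x)
      have "(\<lambda>n. norm (A n x *\<^sub>R g x - a x *\<^sub>R g x)) \<longlonglongrightarrow> norm (a x *\<^sub>R g x - a x *\<^sub>R g x)"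
        by (intro tendsto_intros elim)
      then have "(\<lambda>n. norm (A n x *\<^sub>R g x - a x *\<^sub>R g x) powr p) \<longlonglongrightarrow> 0"
        using p by (intro tendsto_zero_powrI[where b = p]) auto
      then show ?case
        using tendsto_ennrealI[of _ 0] by (simp add: ennreal_0)
    qed
  qed (use meas in measurable)
  then show "Lp_tendsto p (\<lambda>n x. A n x *\<^sub>R g x) (\<lambda>x. a x *\<^sub>R g x)"
    by (simp add: Lp_tendsto_def Lp_dist_def)
qed (use p meas in auto)

lemma Lp_tendsto_AE_subseq:
  fixes F :: "nat \<Rightarrow> 'a::euclidean_space \<Rightarrow> 'b::euclidean_space"
  assumes p: "p > 0" and meas: "\<And>n. F n \<in> borel_measurable lebesgue" "f \<in> borel_measurable lebesgue"
    and lim: "Lp_tendsto p F f"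
  obtains r where "strict_mono r" "AE x in lebesgue. (\<lambda>n. F (r n) x) \<longlonglongrightarrow> f x"
proof -
  have "\<forall>\<^sub>F n in sequentially. Lp_dist p (F n) f < 1"
    using lim unfolding Lp_tendsto_def by (rule order_tendstoD) simp
  then obtain N where N: "\<And>n. n \<ge> N \<Longrightarrow> Lp_dist p (F n) f < 1"
    unfolding eventually_sequentially by blast
  \<comment> \<open>The first distances may be infinite; the shift by \<open>N\<close> makes every
    \<open>u n\<close> integrable, as the subsequence theorem for convergence in mean
    requires.\<close>
  define u where "u n x = norm (F (n + N) x - f x) powr p" for n x
  have u_meas: "u n \<in> borel_measurable lebesgue" for n
    unfolding u_def[abs_def] using meas(1)[of "n + N"] meas(2) by measurable
  have fin: "(\<integral>\<^sup>+x. ennreal (u n x) \<partial>lebesgue) < \<infinity>" for n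
    using order.strict_trans[OF N[of "n + N"] ennreal_one_less_top] by (simp add: Lp_dist_def u_def)
  have int: "integrable lebesgue (u n)" for n
    using u_meas fin by (intro integrableI_nonneg) (auto simp: u_def)
  have "(\<lambda>n. ennreal (LINT x|lebesgue. u n x)) \<longlonglongrightarrow> ennreal 0"
  proof -
    have "ennreal (LINT x|lebesgue. u n x) = Lp_dist p (F (n + N)) f" for n
    proof -
      have "Lp_dist p (F (n + N)) f = (\<integral>\<^sup>+x. ennreal (u n x) \<partial>lebesgue)"
        by (simp add: u_def Lp_dist_def)
      also have "\<dots> = ennreal (LINT x|lebesgue. u n x)"
        using int by (rule nn_integral_eq_integral) (simp add: u_def)
      finally show ?thesis by simp
    qed
    then show ?thesis
      using LIMSEQ_ignore_initial_segment[OF lim[unfolded Lp_tendsto_def], of N] by simp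
  qed
  then have "(\<lambda>n. LINT x|lebesgue. u n x) \<longlonglongrightarrow> 0"
    by (rule tendsto_ennrealD) (simp_all add: u_def)
  moreover have "norm (u n x) = u n x" for n x
    by (simp add: u_def)
  ultimately have "(\<lambda>n. LINT x|lebesgue. norm (u n x)) \<longlonglongrightarrow> 0"
    by (simp only:)
  from tendsto_L1_AE_subseq[OF int this]
  obtain r where r: "strict_mono r" "AE x in lebesgue. (\<lambda>n. u (r n) x) \<longlonglongrightarrow> 0" by blast
  show thesis
  proof
    show "strict_mono (\<lambda>n. r n + N)" using r(1) by (simp add: strict_mono_def)
    show "AE x in lebesgue. (\<lambda>n. F (r n + N) x) \<longlonglongrightarrow> f x"
      using r(2)
    proof eventually_elim
      case (elim x)
      then have "(\<lambda>n. u (r n) x powr (1 / p)) \<longlonglongrightarrow> 0"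
        using p by (intro tendsto_zero_powrI[where b = "1 / p"]) (auto simp: u_def)
      then have "(\<lambda>n. norm (F (r n + N) x - f x)) \<longlonglongrightarrow> 0"
        using p by (simp add: u_def powr_powr)
      then show ?case
        by (rule LIM_zero_cancel[OF tendsto_norm_zero_cancel])
    qed
  qed
qed

section \<open>Limits of test functions\<close>

text \<open>The gradient is part of the data, and both functions live on the whole space, so that a pair
  over \<open>D\<close> is literally a pair over every larger set.\<close>

definition zero_sobolev ::
    "real \<Rightarrow> 'a::euclidean_space set \<Rightarrow> ('a \<Rightarrow> real) \<Rightarrow> ('a \<Rightarrow> 'a) \<Rightarrow> bool" where
  "zero_sobolev p D u g \<longleftrightarrow> u \<in> borel_measurable lebesgue \<and> g \<in> borel_measurable lebesgue \<and>
     (\<exists>f. (\<forall>n. f n \<in> test_functions D) \<and> Lp_tendsto p f u \<and> Lp_tendsto p (\<lambda>n. grad (f n)) g)"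

lemma test_functions_measurable:
  assumes "f \<in> test_functions \<Omega>"
  shows "f \<in> borel_measurable lebesgue" "grad f \<in> borel_measurable lebesgue"
  using test_functions_continuous[OF assms] by (simp_all add: borel_measurable_lebesgue_continuous)

lemma nn_integral_norm_powr_finite:
  fixes f :: "'a::euclidean_space \<Rightarrow> 'b::euclidean_space"
  assumes "p > 0" "continuous_on UNIV f" "compact K" "\<And>x. x \<notin> K \<Longrightarrow> f x = 0"
  shows "(\<integral>\<^sup>+x. ennreal (norm (f x) powr p) \<partial>lebesgue) < \<infinity>"
proof -
  have "continuous_on UNIV (\<lambda>x. norm (f x) powr p)"
    by (intro continuous_on_powr' continuous_on_norm assms(2) continuous_on_const) (use assms(1) in auto)
  then have "integrable lebesgue (\<lambda>x. norm (f x) powr p)"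
    by (rule continuous_integrable_lebesgue[OF _ assms(3)]) (simp add: assms(4))
  then have "(\<integral>\<^sup>+x. ennreal (norm (f x) powr p) \<partial>lebesgue) = ennreal (LINT x|lebesgue. norm (f x) powr p)"
    by (rule nn_integral_eq_integral) simp
  then show ?thesis by simp
qed

lemma test_functions_Lp_finite:
  assumes "p > 0" "f \<in> test_functions \<Omega>"
  shows "(\<integral>\<^sup>+x. ennreal (norm (f x) powr p) \<partial>lebesgue) < \<infinity>"
    "(\<integral>\<^sup>+x. ennreal (norm (grad f x) powr p) \<partial>lebesgue) < \<infinity>"
proof -
  note c = test_functions_continuous[OF assms(2)] and K = test_functions_compact_support[OF assms(2)]
  show "(\<integral>\<^sup>+x. ennreal (norm (f x) powr p) \<partial>lebesgue) < \<infinity>"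
    by (rule nn_integral_norm_powr_finite[OF assms(1) c(1) K]) (rule test_functions_support_eq_0(1))
  show "(\<integral>\<^sup>+x. ennreal (norm (grad f x) powr p) \<partial>lebesgue) < \<infinity>"
    by (rule nn_integral_norm_powr_finite[OF assms(1) c(2) K]) (rule grad_eq_0_outside)
qed

lemma Lp_tendsto_finite:
  assumes p: "p > 0" and F: "\<And>n. F n \<in> borel_measurable lebesgue" "f \<in> borel_measurable lebesgue"
    and fin: "\<And>n. (\<integral>\<^sup>+x. ennreal (norm (F n x) powr p) \<partial>lebesgue) < \<infinity>"
    and lim: "Lp_tendsto p F f"
  shows "(\<integral>\<^sup>+x. ennreal (norm (f x) powr p) \<partial>lebesgue) < \<infinity>"
proof -
  have "\<forall>\<^sub>F n in sequentially. Lp_dist p (F n) f < 1"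
    using lim unfolding Lp_tendsto_def by (rule order_tendstoD) simp
  then obtain n where n: "Lp_dist p (F n) f < 1"
    unfolding eventually_sequentially by blast
  have "(\<lambda>x. f x - F n x) \<in> borel_measurable lebesgue" using F by auto
  from nn_integral_norm_powr_add_le[OF less_imp_le[OF p] F(1) this, of n]
  have "(\<integral>\<^sup>+x. ennreal (norm (f x) powr p) \<partial>lebesgue) \<le>
      ennreal (2 powr p) * ((\<integral>\<^sup>+x. ennreal (norm (F n x) powr p) \<partial>lebesgue) + Lp_dist p (F n) f)"
    by (simp add: Lp_dist_def norm_minus_commute)
  also have "\<dots> < \<infinity>"
    using fin[of n] order.strict_trans[OF n ennreal_one_less_top] by (simp add: ennreal_mult_less_top)
  finally show ?thesis .
qed

lemma zero_sobolev_finite: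
  assumes "p > 0" "zero_sobolev p D u g"
  shows "(\<integral>\<^sup>+x. ennreal (norm (u x) powr p) \<partial>lebesgue) < \<infinity>"
    "(\<integral>\<^sup>+x. ennreal (norm (g x) powr p) \<partial>lebesgue) < \<infinity>"
proof -
  obtain f where f: "\<And>n. f n \<in> test_functions D" "Lp_tendsto p f u" "Lp_tendsto p (\<lambda>n. grad (f n)) g"
    and meas: "u \<in> borel_measurable lebesgue" "g \<in> borel_measurable lebesgue"
    using assms(2) unfolding zero_sobolev_def by blast
  show "(\<integral>\<^sup>+x. ennreal (norm (u x) powr p) \<partial>lebesgue) < \<infinity>"
    by (rule Lp_tendsto_finite[OF assms(1) _ meas(1) _ f(2)])
      (use test_functions_measurable[OF f(1)] test_functions_Lp_finite[OF assms(1) f(1)] in auto)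
  show "(\<integral>\<^sup>+x. ennreal (norm (g x) powr p) \<partial>lebesgue) < \<infinity>"
    by (rule Lp_tendsto_finite[OF assms(1) _ meas(2) _ f(3)])
      (use test_functions_measurable[OF f(1)] test_functions_Lp_finite[OF assms(1) f(1)] in auto)
qed

text \<open>A diagonal choice: for each \<open>n\<close> one test function is taken that is close to
  \<open>u n\<close> and whose gradient is close to \<open>g n\<close>. Iterated limits thereby
  collapse into a single sequence.\<close>

lemma zero_sobolev_closed:
  assumes p: "p > 0" and u: "\<And>n. zero_sobolev p D (u n) (g n)"
    and meas: "v \<in> borel_measurable lebesgue" "h \<in> borel_measurable lebesgue"
    and lim: "Lp_tendsto p u v" "Lp_tendsto p g h"
  shows "zero_sobolev p D v h"
proof -
  have "\<exists>f. f \<in> test_functions D \<and> Lp_dist p f (u n) < ennreal (1 / real (Suc n)) \<and>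
      Lp_dist p (grad f) (g n) < ennreal (1 / real (Suc n))" for n
  proof -
    obtain f where f: "\<And>n. f n \<in> test_functions D" "Lp_tendsto p f (u n)" "Lp_tendsto p (\<lambda>n. grad (f n)) (g n)"
      using u[of n] unfolding zero_sobolev_def by blast
    have pos: "0 < ennreal (1 / real (Suc n))" by simp
    have "\<forall>\<^sub>F m in sequentially. Lp_dist p (f m) (u n) < ennreal (1 / real (Suc n))"
      "\<forall>\<^sub>F m in sequentially. Lp_dist p (grad (f m)) (g n) < ennreal (1 / real (Suc n))"
      using order_tendstoD(2)[OF f(2)[unfolded Lp_tendsto_def] pos]
        order_tendstoD(2)[OF f(3)[unfolded Lp_tendsto_def] pos] .
    then have "\<forall>\<^sub>F m in sequentially. Lp_dist p (f m) (u n) < ennreal (1 / real (Suc n)) \<and>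
        Lp_dist p (grad (f m)) (g n) < ennreal (1 / real (Suc n))"
      by (rule eventually_conj)
    then obtain m where "Lp_dist p (f m) (u n) < ennreal (1 / real (Suc n))"
        "Lp_dist p (grad (f m)) (g n) < ennreal (1 / real (Suc n))"
      unfolding eventually_sequentially by blast
    with f(1) show ?thesis by blast
  qed
  then obtain f where f: "\<And>n. f n \<in> test_functions D"
      "\<And>n. Lp_dist p (f n) (u n) < ennreal (1 / real (Suc n))"
      "\<And>n. Lp_dist p (grad (f n)) (g n) < ennreal (1 / real (Suc n))"
    by metis
  have um: "u n \<in> borel_measurable lebesgue" and gm: "g n \<in> borel_measurable lebesgue" for n
    using u[of n] by (auto simp: zero_sobolev_def)
  have "(\<lambda>n. 1 / real (Suc n)) \<longlonglongrightarrow> 0"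
    by (rule LIMSEQ_Suc[OF lim_const_over_n])
  then have small: "(\<lambda>n. ennreal (1 / real (Suc n))) \<longlonglongrightarrow> 0"
    using tendsto_ennrealI by fastforce
  have "Lp_tendsto p f v"
    by (rule Lp_tendsto_triangle[OF less_imp_le[OF p] test_functions_measurable(1)[OF f(1)] um meas(1) _ lim(1)],
        rule ennreal_tendsto_zero_squeeze[OF small less_imp_le[OF f(2)]])
  moreover have "Lp_tendsto p (\<lambda>n. grad (f n)) h"
    by (rule Lp_tendsto_triangle[OF less_imp_le[OF p] test_functions_measurable(2)[OF f(1)] gm meas(2) _ lim(2)],
        rule ennreal_tendsto_zero_squeeze[OF small less_imp_le[OF f(3)]])
  ultimately show ?thesis unfolding zero_sobolev_def using f(1) meas by blast
qed

lemma zero_sobolev_mono: "D \<subseteq> \<Omega> \<Longrightarrow> zero_sobolev p D u g \<Longrightarrow> zero_sobolev p \<Omega> u g"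
  unfolding zero_sobolev_def using test_functions_mono by blast

lemma zero_sobolev_scale:
  assumes "p > 0" "zero_sobolev p D u g"
  shows "zero_sobolev p D (\<lambda>x. c *\<^sub>R u x) (\<lambda>x. c *\<^sub>R g x)"
proof -
  obtain f where f: "\<And>n. f n \<in> test_functions D" "Lp_tendsto p f u" "Lp_tendsto p (\<lambda>n. grad (f n)) g"
    and meas: "u \<in> borel_measurable lebesgue" "g \<in> borel_measurable lebesgue"
    using assms(2) unfolding zero_sobolev_def by blast
  have "grad (\<lambda>x. c * f n x) x = c *\<^sub>R grad (f n) x" for n x
  proof (rule grad_eqI)
    show "((\<lambda>x. c * f n x) has_derivative (\<lambda>v. (c *\<^sub>R grad (f n) x) \<bullet> v)) (at x)"
      by (rule has_derivative_eq_rhs[OF has_derivative_mult_right[OF Ck_has_derivative_grad[OF test_functions_Ck[OF f(1)]]]])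
        simp
  qed
  then have gr: "grad (\<lambda>x. c * f n x) = (\<lambda>x. c *\<^sub>R grad (f n) x)" for n
    by blast
  have "Lp_tendsto p (\<lambda>n x. c *\<^sub>R f n x) (\<lambda>x. c *\<^sub>R u x)"
    by (rule Lp_tendsto_scale[where C = "\<bar>c\<bar>"])
      (use assms f meas test_functions_measurable[OF f(1)] zero_sobolev_finite(1)[OF assms] in auto)
  moreover have "Lp_tendsto p (\<lambda>n x. c *\<^sub>R grad (f n) x) (\<lambda>x. c *\<^sub>R g x)"
    by (rule Lp_tendsto_scale[where C = "\<bar>c\<bar>"])
      (use assms f meas test_functions_measurable[OF f(1)] zero_sobolev_finite(2)[OF assms] in auto)
  moreover have "(\<lambda>x. c * f n x) \<in> test_functions D" for n
    by (rule test_functions_mult[OF f(1)]) (rule Ck_const)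
  ultimately show ?thesis
    unfolding zero_sobolev_def
    by (intro conjI exI[of _ "\<lambda>n x. c * f n x"]) (use meas gr in auto)
qed

section \<open>Truncated restriction to a component of the nonzero set\<close>

lemma open_nonzero_set:
  fixes u :: "'a::topological_space \<Rightarrow> real"
  assumes "open \<Omega>" "continuous_on \<Omega> u"
  shows "open {x \<in> \<Omega>. u x \<noteq> 0}"
proof -
  have "{x \<in> \<Omega>. u x \<noteq> 0} = \<Omega> \<inter> u -` (- {0})" by auto
  then show ?thesis
    using continuous_open_preimage[OF assms(2,1) open_Compl[OF closed_singleton]] by simp
qed

text \<open>A component is closed relative to the nonzero set, and
  \<open>\<epsilon> \<le> u x\<close> is a closed condition on \<open>S\<close> that excludes the
  zeros of \<open>u\<close>; within the compact set \<open>S\<close> the two conditions together are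
  therefore closed.\<close>

lemma compact_component_part:
  fixes u :: "'a::euclidean_space \<Rightarrow> real"
  assumes u: "continuous_on \<Omega> u" and S: "compact S" "S \<subseteq> \<Omega>"
    and D: "D \<in> components {x \<in> \<Omega>. u x \<noteq> 0}" and \<epsilon>: "\<epsilon> > 0"
  shows "compact {x \<in> S. \<epsilon> \<le> u x \<and> x \<in> D}"
proof -
  obtain T where T: "closed T" "D = {x \<in> \<Omega>. u x \<noteq> 0} \<inter> T"
    using closedin_component[OF D] unfolding closedin_closed by blast
  have "closedin (top_of_set S) (S \<inter> u -` {\<epsilon>..})"
    by (rule continuous_closedin_preimage) (use continuous_on_subset[OF u S(2)] in auto)
  then have "compact (S \<inter> u -` {\<epsilon>..})" using S(1) closedin_compact by blast
  then have "compact (S \<inter> u -` {\<epsilon>..} \<inter> T)" using T(1) by (rule compact_Int_closed)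
  moreover have "S \<inter> u -` {\<epsilon>..} \<inter> T = {x \<in> S. \<epsilon> \<le> u x \<and> x \<in> D}"
    using T(2) S(2) \<epsilon> by auto
  ultimately show ?thesis by simp
qed

text \<open>\<open>\<psi>\<close> is an auxiliary factor that must leave no trace: it is 1 with
  derivative 0 wherever \<open>\<theta>\<close> is nonzero, so it drops out of the limit, while its
  vanishing at 0 ties the approximants to the support of \<open>f n\<close>. The bounds on both
  functions and their derivatives make each term of the product rule a bounded coefficient times a
  function that converges in the p-th mean or is fixed.\<close>

lemma zero_sobolev_truncation:
  fixes u :: "'a::euclidean_space \<Rightarrow> real"
  assumes p: "p > 0" and \<Omega>: "open \<Omega>" and u: "continuous_on \<Omega> u" and uG: "zero_sobolev p \<Omega> u G"
    and D: "D \<in> components {x \<in> \<Omega>. u x \<noteq> 0}"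
    and smooth: "\<And>n. Ck n \<theta>" "\<And>n. Ck n \<psi>"
    and bound: "\<And>s. \<bar>\<theta> s\<bar> \<le> M" "\<And>s. \<bar>deriv \<theta> s\<bar> \<le> M" "\<And>s. \<bar>\<psi> s\<bar> \<le> M" "\<And>s. \<bar>deriv \<psi> s\<bar> \<le> M"
    and \<theta>_le: "\<And>s. \<bar>\<theta> s\<bar> \<le> \<bar>s\<bar>"
    and \<epsilon>: "\<epsilon> > 0" and \<theta>0: "\<And>s. s \<le> \<epsilon> \<Longrightarrow> \<theta> s = 0" "\<And>s. s \<le> \<epsilon> \<Longrightarrow> deriv \<theta> s = 0"
    and \<psi>0: "\<psi> 0 = 0" "deriv \<psi> 0 = 0"
    and \<psi>1: "\<And>s. s > \<epsilon> \<Longrightarrow> \<psi> s = 1" "\<And>s. s > \<epsilon> \<Longrightarrow> deriv \<psi> s = 0"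
  shows "zero_sobolev p D (\<lambda>x. indicator D x *\<^sub>R \<theta> (u x)) (\<lambda>x. (indicator D x * deriv \<theta> (u x)) *\<^sub>R G x)"
proof -
  obtain f0 where f0: "\<And>n. f0 n \<in> test_functions \<Omega>" "Lp_tendsto p f0 u" "Lp_tendsto p (\<lambda>n. grad (f0 n)) G"
    and um: "u \<in> borel_measurable lebesgue" and Gm: "G \<in> borel_measurable lebesgue"
    using uG unfolding zero_sobolev_def by blast
  \<comment> \<open>Almost everywhere convergence is wanted because the nonlinear factors pass to
    the limit pointwise, by continuity.\<close>
  obtain r where r: "strict_mono r" "AE x in lebesgue. (\<lambda>n. f0 (r n) x) \<longlonglongrightarrow> u x"
    by (rule Lp_tendsto_AE_subseq[OF p test_functions_measurable(1)[OF f0(1)] um f0(2)])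
  define f where "f n = f0 (r n)" for n
  have f: "\<And>n. f n \<in> test_functions \<Omega>" and flim: "AE x in lebesgue. (\<lambda>n. f n x) \<longlonglongrightarrow> u x"
    using f0(1) r(2) by (auto simp: f_def)
  have gradlim: "Lp_tendsto p (\<lambda>n. grad (f n)) G"
    using LIMSEQ_subseq_LIMSEQ[OF f0(3)[unfolded Lp_tendsto_def] r(1)]
    by (simp add: Lp_tendsto_def f_def comp_def)
  note fm = test_functions_measurable[OF f]
  note ufin = zero_sobolev_finite[OF p uG]
  have cont: "continuous_on UNIV \<theta>" "continuous_on UNIV \<psi>"
    "continuous_on UNIV (deriv \<theta>)" "continuous_on UNIV (deriv \<psi>)"
    using smooth(1)[of 0] smooth(2)[of 0] Ck_real_Suc_deriv(2)[OF smooth(1)[of "Suc 0"]]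
      Ck_real_Suc_deriv(2)[OF smooth(2)[of "Suc 0"]] by simp_all
  have comp_meas: "(\<lambda>x. \<theta> (v x)) \<in> borel_measurable lebesgue" "(\<lambda>x. \<psi> (v x)) \<in> borel_measurable lebesgue"
    "(\<lambda>x. deriv \<theta> (v x)) \<in> borel_measurable lebesgue" "(\<lambda>x. deriv \<psi> (v x)) \<in> borel_measurable lebesgue"
    if v: "v \<in> borel_measurable lebesgue" for v :: "'a \<Rightarrow> real"
    using cont[THEN borel_measurable_continuous_on, OF v] by auto
  have comp_lim: "(\<lambda>n. \<theta> (X n)) \<longlonglongrightarrow> \<theta> l" "(\<lambda>n. \<psi> (X n)) \<longlonglongrightarrow> \<psi> l"
    "(\<lambda>n. deriv \<theta> (X n)) \<longlonglongrightarrow> deriv \<theta> l" "(\<lambda>n. deriv \<psi> (X n)) \<longlonglongrightarrow> deriv \<psi> l"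
    if X: "X \<longlonglongrightarrow> l" for X l
    using cont[THEN continuous_on_tendsto_compose, OF X] by auto
  have M: "M \<ge> 0" using bound(1)[of 0] by linarith
  have D\<Omega>: "D \<subseteq> {x \<in> \<Omega>. u x \<noteq> 0}" using in_components_subset[OF D] .
  have oD: "open D" using open_components[OF open_nonzero_set[OF \<Omega> u] D] .
  then have Dm: "(indicator D :: 'a \<Rightarrow> real) \<in> borel_measurable lebesgue"
    by (simp add: borel_open borel_measurable_indicator)
  \<comment> \<open>\<open>U n\<close> and \<open>V n\<close> are the limits in \<open>m\<close> of
    the approximants and of their gradients, for fixed \<open>n\<close> and with the cutoff already
    replaced by the indicator of \<open>D\<close>.\<close>
  define U where "U n x = indicator D x *\<^sub>R (\<psi> (f n x) * \<theta> (u x))" for n x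
  define V where "V n x = (indicator D x * (\<psi> (f n x) * deriv \<theta> (u x))) *\<^sub>R G x +
    (indicator D x * (\<theta> (u x) * deriv \<psi> (f n x))) *\<^sub>R grad (f n) x" for n x
  have mult_bound: "\<bar>a * b\<bar> \<le> M * M" if "\<bar>a\<bar> \<le> M" "\<bar>b\<bar> \<le> M" for a b :: real
    unfolding abs_mult using that M by (intro mult_mono) auto
  have ind_bound: "\<bar>indicator D x * a\<bar> \<le> B" if "\<bar>a\<bar> \<le> B" for a B :: real and x
    using that by (auto simp: indicator_def)
  have stage1: "zero_sobolev p D (U n) (V n)" for n
  proof -
    let ?F = "f n"
    let ?S = "closure {x. ?F x \<noteq> 0}"
    have S: "compact ?S" "?S \<subseteq> \<Omega>" using f[of n] by (auto simp: test_functions_def)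
    define K where "K = {x \<in> ?S. \<epsilon> \<le> u x \<and> x \<in> D}"
    have K: "compact K" "K \<subseteq> D"
      unfolding K_def using compact_component_part[OF u S D \<epsilon>] by auto
    obtain \<eta> where \<eta>: "\<eta> \<in> test_functions D" "\<And>x. x \<in> K \<Longrightarrow> \<eta> x = 1" "\<And>x. 0 \<le> \<eta> x" "\<And>x. \<eta> x \<le> 1"
      by (rule smooth_cutoff_exists[OF K(1) oD K(2)]) blast
    have \<eta>_abs: "\<bar>\<eta> x\<bar> \<le> 1" for x using \<eta>(3,4)[of x] by simp
    note \<eta>m = test_functions_measurable[OF \<eta>(1)]
    define w where "w m x = (\<theta> (f m x) * \<psi> (?F x)) * \<eta> x" for m x
    have Ck_comp: "Ck k (\<lambda>x. \<theta> (f m x))" "Ck k (\<lambda>x. \<psi> (?F x))" for k m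
      by (rule Ck_compose[OF smooth(1) test_functions_Ck[OF f]], rule Ck_compose[OF smooth(2) test_functions_Ck[OF f]])
    have w: "w m \<in> test_functions D" for m
      unfolding w_def[abs_def] by (rule test_functions_mult[OF \<eta>(1)]) (intro Ck_mult Ck_comp)
    have grad_w: "grad (w m) x = (\<eta> x * \<psi> (?F x) * deriv \<theta> (f m x)) *\<^sub>R grad (f m) x +
      (\<eta> x * \<theta> (f m x) * deriv \<psi> (?F x)) *\<^sub>R grad ?F x + (\<theta> (f m x) * \<psi> (?F x)) *\<^sub>R grad \<eta> x" for m x
      unfolding w_def[abs_def] grad_mult[OF Ck_mult[OF Ck_comp] test_functions_Ck[OF \<eta>(1)]] grad_mult[OF Ck_comp]
        grad_compose[OF smooth(1) test_functions_Ck[OF f]] grad_compose[OF smooth(2) test_functions_Ck[OF f]]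
      by (simp add: algebra_simps)
    \<comment> \<open>Here the fixed test function \<open>\<psi> (f n) * \<eta>\<close> takes the
      role of the function in the p-th mean, and \<open>\<theta> (f m)\<close> that of the bounded
      coefficient.\<close>
    have lim0: "Lp_tendsto p (\<lambda>m x. \<theta> (f m x) *\<^sub>R (\<psi> (?F x) * \<eta> x)) (\<lambda>x. \<theta> (u x) *\<^sub>R (\<psi> (?F x) * \<eta> x))"
    proof (rule Lp_tendsto_scale[OF p, where C = M])
      show "AE x in lebesgue. (\<lambda>m. \<theta> (f m x)) \<longlonglongrightarrow> \<theta> (u x)"
        using flim by eventually_elim (rule comp_lim)
      have "(\<lambda>x. \<psi> (?F x) * \<eta> x) \<in> test_functions D"
        by (rule test_functions_mult[OF \<eta>(1) Ck_comp(2)])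
      from test_functions_Lp_finite(1)[OF p this] test_functions_measurable(1)[OF this]
      show "(\<integral>\<^sup>+x. ennreal (norm (\<psi> (?F x) * \<eta> x) powr p) \<partial>lebesgue) < \<infinity>"
        "(\<lambda>x. \<psi> (?F x) * \<eta> x) \<in> borel_measurable lebesgue"
        "(\<lambda>x. \<psi> (?F x) * \<eta> x) \<in> borel_measurable lebesgue" by simp_all
    qed (use bound comp_meas um fm in \<open>simp_all add: Lp_tendsto_def Lp_dist_def p\<close>)
    have lim1: "Lp_tendsto p (\<lambda>m x. (\<eta> x * \<psi> (?F x) * deriv \<theta> (f m x)) *\<^sub>R grad (f m) x)
        (\<lambda>x. (\<eta> x * \<psi> (?F x) * deriv \<theta> (u x)) *\<^sub>R G x)"
    proof (rule Lp_tendsto_scale[OF p _ _ _ _ _ _ _ gradlim ufin(2), where C = "1 * (M * M)"])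
      show "AE x in lebesgue. (\<lambda>m. \<eta> x * \<psi> (?F x) * deriv \<theta> (f m x)) \<longlonglongrightarrow> \<eta> x * \<psi> (?F x) * deriv \<theta> (u x)"
        using flim by eventually_elim (intro tendsto_mult tendsto_const comp_lim)
      show "\<bar>\<eta> x * \<psi> (?F x) * deriv \<theta> (f m x)\<bar> \<le> 1 * (M * M)"
        "\<bar>\<eta> x * \<psi> (?F x) * deriv \<theta> (u x)\<bar> \<le> 1 * (M * M)" for m x
        unfolding abs_mult[of "\<eta> x"] mult.assoc using \<eta>_abs bound
        by (intro mult_mono mult_bound; simp)+
    qed (use comp_meas um fm Gm \<eta>m in \<open>auto intro!: borel_measurable_times\<close>)
    have lim2: "Lp_tendsto p (\<lambda>m x. (\<eta> x * \<theta> (f m x) * deriv \<psi> (?F x)) *\<^sub>R grad ?F x)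
        (\<lambda>x. (\<eta> x * \<theta> (u x) * deriv \<psi> (?F x)) *\<^sub>R grad ?F x)"
    proof (rule Lp_tendsto_scale[OF p _ _ _ _ _ _ _ _ test_functions_Lp_finite(2)[OF p f], where C = "1 * (M * M)"])
      show "AE x in lebesgue. (\<lambda>m. \<eta> x * \<theta> (f m x) * deriv \<psi> (?F x)) \<longlonglongrightarrow> \<eta> x * \<theta> (u x) * deriv \<psi> (?F x)"
        using flim by eventually_elim (intro tendsto_mult tendsto_const comp_lim)
      show "\<bar>\<eta> x * \<theta> (f m x) * deriv \<psi> (?F x)\<bar> \<le> 1 * (M * M)"
        "\<bar>\<eta> x * \<theta> (u x) * deriv \<psi> (?F x)\<bar> \<le> 1 * (M * M)" for m x
        unfolding abs_mult[of "\<eta> x"] mult.assoc using \<eta>_abs bound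
        by (intro mult_mono mult_bound; simp)+
    qed (use comp_meas um fm \<eta>m p in \<open>auto intro!: borel_measurable_times simp: Lp_tendsto_def Lp_dist_def\<close>)
    have lim3: "Lp_tendsto p (\<lambda>m x. (\<theta> (f m x) * \<psi> (?F x)) *\<^sub>R grad \<eta> x)
        (\<lambda>x. (\<theta> (u x) * \<psi> (?F x)) *\<^sub>R grad \<eta> x)"
    proof (rule Lp_tendsto_scale[OF p _ _ _ _ _ _ _ _ test_functions_Lp_finite(2)[OF p \<eta>(1)], where C = "M * M"])
      show "AE x in lebesgue. (\<lambda>m. \<theta> (f m x) * \<psi> (?F x)) \<longlonglongrightarrow> \<theta> (u x) * \<psi> (?F x)"
        using flim by eventually_elim (intro tendsto_mult tendsto_const comp_lim)
      show "\<bar>\<theta> (f m x) * \<psi> (?F x)\<bar> \<le> M * M" "\<bar>\<theta> (u x) * \<psi> (?F x)\<bar> \<le> M * M" for m x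
        using bound by (intro mult_bound; simp)+
    qed (use comp_meas um fm \<eta>m p in \<open>auto intro!: borel_measurable_times simp: Lp_tendsto_def Lp_dist_def\<close>)
    have grad_lim: "Lp_tendsto p (\<lambda>m. grad (w m)) (\<lambda>x. (\<eta> x * \<psi> (?F x) * deriv \<theta> (u x)) *\<^sub>R G x +
        (\<eta> x * \<theta> (u x) * deriv \<psi> (?F x)) *\<^sub>R grad ?F x + (\<theta> (u x) * \<psi> (?F x)) *\<^sub>R grad \<eta> x)"
      unfolding grad_w
      by (intro Lp_tendsto_add[OF less_imp_le[OF p] _ _ _ _ _ lim3] Lp_tendsto_add[OF less_imp_le[OF p] _ _ _ _ lim1 lim2])
        (use comp_meas um fm Gm \<eta>m in \<open>auto intro!: borel_measurable_times borel_measurable_scaleR borel_measurable_add\<close>)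
    \<comment> \<open>In the first case \<open>\<theta>\<close> and its derivative vanish at
      \<open>u x\<close>, in the second \<open>\<psi>\<close> and its derivative vanish at
      \<open>f n x\<close>; in the third \<open>x\<close> has a neighbourhood inside
      \<open>K\<close>, where \<open>\<eta>\<close> is constantly 1. In each case the limit no
      longer sees \<open>\<eta>\<close>.\<close>
    have cases: "u x \<le> \<epsilon> \<or> ?F x = 0 \<or> (\<eta> x = 1 \<and> grad \<eta> x = 0)" if x: "x \<in> D" for x
    proof (cases "u x > \<epsilon> \<and> ?F x \<noteq> 0")
      case True
      define W where "W = {y \<in> D. u y > \<epsilon>} \<inter> {y. ?F y \<noteq> 0}"
      have "continuous_on D u" using continuous_on_subset[OF u] D\<Omega> by blast
      then have "open (D \<inter> u -` {\<epsilon><..})"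
        using continuous_open_preimage[OF _ oD, of u "{\<epsilon><..}"] by simp
      moreover have "D \<inter> u -` {\<epsilon><..} = {y \<in> D. u y > \<epsilon>}" by auto
      moreover have "open {y. ?F y \<noteq> 0}"
        by (intro open_Collect_neq test_functions_continuous(1)[OF f] continuous_on_const)
      ultimately have "open W" unfolding W_def by (metis open_Int)
      have "W \<subseteq> K" using closure_subset[of "{y. ?F y \<noteq> 0}"] by (auto simp: W_def K_def)
      have "x \<in> W" using True x by (simp add: W_def)
      have "grad \<eta> x = 0"
      proof (rule grad_eqI)
        show "(\<eta> has_derivative (\<lambda>v. 0 \<bullet> v)) (at x)"
          by (rule has_derivative_transform_within_open[where f = "\<lambda>_. 1" and s = W])
            (use \<open>open W\<close> \<open>x \<in> W\<close> \<open>W \<subseteq> K\<close> \<eta>(2) in auto)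
      qed
      moreover have "\<eta> x = 1" using \<open>x \<in> W\<close> \<open>W \<subseteq> K\<close> \<eta>(2) by blast
      ultimately show ?thesis by blast
    qed auto
    have U: "U n = (\<lambda>x. \<theta> (u x) *\<^sub>R (\<psi> (?F x) * \<eta> x))"
    proof
      fix x
      show "U n x = \<theta> (u x) *\<^sub>R (\<psi> (?F x) * \<eta> x)"
        using cases[of x] test_functions_eq_0(1)[OF \<eta>(1), of x] \<theta>0 \<psi>0
        by (cases "x \<in> D") (auto simp: U_def)
    qed
    have V: "V n = (\<lambda>x. (\<eta> x * \<psi> (?F x) * deriv \<theta> (u x)) *\<^sub>R G x +
        (\<eta> x * \<theta> (u x) * deriv \<psi> (?F x)) *\<^sub>R grad ?F x + (\<theta> (u x) * \<psi> (?F x)) *\<^sub>R grad \<eta> x)"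
    proof
      fix x
      show "V n x = (\<eta> x * \<psi> (?F x) * deriv \<theta> (u x)) *\<^sub>R G x +
        (\<eta> x * \<theta> (u x) * deriv \<psi> (?F x)) *\<^sub>R grad ?F x + (\<theta> (u x) * \<psi> (?F x)) *\<^sub>R grad \<eta> x"
        using cases[of x] test_functions_eq_0[OF \<eta>(1), of x] \<theta>0 \<psi>0
        by (cases "x \<in> D") (auto simp: V_def)
    qed
    have "U n \<in> borel_measurable lebesgue" "V n \<in> borel_measurable lebesgue"
      unfolding U V using comp_meas um fm Gm \<eta>m
      by (auto intro!: borel_measurable_times borel_measurable_scaleR borel_measurable_add)
    moreover have "Lp_tendsto p w (U n)"
      using lim0 unfolding U w_def[abs_def] by (simp add: mult.assoc)
    ultimately show ?thesis
      unfolding zero_sobolev_def using w grad_lim[folded V] by blast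
  qed
  have Um: "(\<lambda>x. indicator D x *\<^sub>R \<theta> (u x)) \<in> borel_measurable lebesgue"
    using comp_meas(1)[OF um] Dm by (auto intro!: borel_measurable_times)
  have "(\<integral>\<^sup>+x. ennreal (norm (indicator D x *\<^sub>R \<theta> (u x)) powr p) \<partial>lebesgue) \<le>
      (\<integral>\<^sup>+x. ennreal (norm (u x) powr p) \<partial>lebesgue)"
    by (intro nn_integral_mono ennreal_leI powr_mono2) (use \<theta>_le p in \<open>auto simp: indicator_def\<close>)
  then have Ufin: "(\<integral>\<^sup>+x. ennreal (norm (indicator D x *\<^sub>R \<theta> (u x)) powr p) \<partial>lebesgue) < \<infinity>"
    using ufin(1) by (rule order.strict_trans1)
  have Ulim: "Lp_tendsto p (\<lambda>n x. \<psi> (f n x) *\<^sub>R (indicator D x *\<^sub>R \<theta> (u x))) (\<lambda>x. \<psi> (u x) *\<^sub>R (indicator D x *\<^sub>R \<theta> (u x)))"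
  proof (rule Lp_tendsto_scale[OF p _ _ _ _ _ _ _ _ Ufin, where C = M])
    show "AE x in lebesgue. (\<lambda>n. \<psi> (f n x)) \<longlonglongrightarrow> \<psi> (u x)"
      using flim by eventually_elim (rule comp_lim)
  qed (use bound comp_meas um fm Um p in \<open>auto simp: Lp_tendsto_def Lp_dist_def\<close>)
  have V1lim: "Lp_tendsto p (\<lambda>n x. (indicator D x * (\<psi> (f n x) * deriv \<theta> (u x))) *\<^sub>R G x)
      (\<lambda>x. (indicator D x * (\<psi> (u x) * deriv \<theta> (u x))) *\<^sub>R G x)"
  proof (rule Lp_tendsto_scale[OF p _ _ _ _ _ _ _ _ ufin(2), where C = "M * M"])
    show "AE x in lebesgue. (\<lambda>n. indicator D x * (\<psi> (f n x) * deriv \<theta> (u x))) \<longlonglongrightarrow>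
        indicator D x * (\<psi> (u x) * deriv \<theta> (u x))"
      using flim by eventually_elim (intro tendsto_mult tendsto_const comp_lim)
    show "\<bar>indicator D x * (\<psi> (f n x) * deriv \<theta> (u x))\<bar> \<le> M * M"
      "\<bar>indicator D x * (\<psi> (u x) * deriv \<theta> (u x))\<bar> \<le> M * M" for n x
      using bound by (intro ind_bound mult_bound; simp)+
  qed (use comp_meas um fm Gm Dm p in \<open>auto intro!: borel_measurable_times simp: Lp_tendsto_def Lp_dist_def\<close>)
  have V2lim: "Lp_tendsto p (\<lambda>n x. (indicator D x * (\<theta> (u x) * deriv \<psi> (f n x))) *\<^sub>R grad (f n) x)
      (\<lambda>x. (indicator D x * (\<theta> (u x) * deriv \<psi> (u x))) *\<^sub>R G x)"
  proof (rule Lp_tendsto_scale[OF p _ _ _ _ _ _ _ gradlim ufin(2), where C = "M * M"])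
    show "AE x in lebesgue. (\<lambda>n. indicator D x * (\<theta> (u x) * deriv \<psi> (f n x))) \<longlonglongrightarrow>
        indicator D x * (\<theta> (u x) * deriv \<psi> (u x))"
      using flim by eventually_elim (intro tendsto_mult tendsto_const comp_lim)
    show "\<bar>indicator D x * (\<theta> (u x) * deriv \<psi> (f n x))\<bar> \<le> M * M"
      "\<bar>indicator D x * (\<theta> (u x) * deriv \<psi> (u x))\<bar> \<le> M * M" for n x
      using bound by (intro ind_bound mult_bound; simp)+
  qed (use comp_meas um fm Gm Dm in \<open>auto intro!: borel_measurable_times\<close>)
  have "Lp_tendsto p V (\<lambda>x. (indicator D x * (\<psi> (u x) * deriv \<theta> (u x))) *\<^sub>R G x +
      (indicator D x * (\<theta> (u x) * deriv \<psi> (u x))) *\<^sub>R G x)"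
    unfolding V_def[abs_def]
    by (rule Lp_tendsto_add[OF less_imp_le[OF p] _ _ _ _ V1lim V2lim])
      (use comp_meas um fm Gm Dm in \<open>auto intro!: borel_measurable_times borel_measurable_scaleR\<close>)
  \<comment> \<open>Where \<open>u x > \<epsilon>\<close>, \<open>\<psi>\<close> has value 1 and
    derivative 0; elsewhere \<open>\<theta>\<close> and its derivative vanish. So the second term
    disappears and the first loses \<open>\<psi>\<close>.\<close>
  moreover have "(indicator D x * (\<psi> (u x) * deriv \<theta> (u x))) *\<^sub>R G x +
      (indicator D x * (\<theta> (u x) * deriv \<psi> (u x))) *\<^sub>R G x = (indicator D x * deriv \<theta> (u x)) *\<^sub>R G x" for x
    using \<theta>0[of "u x"] \<psi>1[of "u x"] by (cases "u x \<le> \<epsilon>") auto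
  ultimately have Vlim: "Lp_tendsto p V (\<lambda>x. (indicator D x * deriv \<theta> (u x)) *\<^sub>R G x)"
    by simp
  have "\<psi> (u x) *\<^sub>R (indicator D x *\<^sub>R \<theta> (u x)) = indicator D x *\<^sub>R \<theta> (u x)" for x
    using \<theta>0(1)[of "u x"] \<psi>1(1)[of "u x"] by (cases "u x \<le> \<epsilon>") auto
  then have eq: "(\<lambda>x. \<psi> (u x) *\<^sub>R (indicator D x *\<^sub>R \<theta> (u x))) = (\<lambda>x. indicator D x *\<^sub>R \<theta> (u x))"
    by (rule ext)
  have "Lp_tendsto p U (\<lambda>x. indicator D x *\<^sub>R \<theta> (u x))"
    using Ulim unfolding eq by (simp add: U_def[abs_def] mult.left_commute)
  from zero_sobolev_closed[OF p stage1 Um _ this Vlim]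
  show ?thesis using comp_meas(3)[OF um] Dm Gm by (simp add: borel_measurable_times borel_measurable_scaleR)
qed

section \<open>Truncations away from zero and infinity, and their removal\<close>

definition window :: "real \<Rightarrow> real \<Rightarrow> real" where
  "window J s = smooth_step (J * s) * (1 - smooth_step (inverse J * s))"

text \<open>For \<open>J > 0\<close> this vanishes for \<open>s \<le> 1 / J\<close> and for
  \<open>s \<ge> 2 * J\<close> and is the identity between \<open>2 / J\<close> and
  \<open>J\<close>, so it recovers \<open>s\<close> on the positive half-line as \<open>J\<close>
  grows. The lower cutoff creates the zero region, the upper one makes the function bounded.\<close>

definition soft_trunc :: "real \<Rightarrow> real \<Rightarrow> real" where
  "soft_trunc J s = s * window J s"

lemma Ck_ident: "Ck n (\<lambda>s::real. s)"
  using Ck_inner[of n 0 "1::real"] by simp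

lemma Ck_smooth_step_scale: "Ck n (\<lambda>s. smooth_step (c * s))"
  by (intro Ck_compose[OF Ck_smooth_step] Ck_mult Ck_const Ck_ident)

lemma Ck_soft_trunc: "Ck n (soft_trunc J)"
  unfolding soft_trunc_def[abs_def] window_def
  by (intro Ck_mult Ck_diff Ck_ident Ck_const Ck_smooth_step_scale)

lemma smooth_step_scale_deriv:
  "((\<lambda>s. smooth_step (c * s)) has_real_derivative c * deriv smooth_step (c * s)) (at s)"
proof -
  have "((\<lambda>s. c * s) has_real_derivative c) (at s)"
    by (auto intro!: derivative_eq_intros)
  from DERIV_chain2[OF smooth_step_deriv this] show ?thesis
    by (simp add: mult.commute)
qed

text \<open>The factor \<open>s\<close> is paired with the inner derivatives \<open>J\<close> and
  \<open>inverse J\<close>, so that \<open>deriv smooth_step\<close> occurs only in the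
  scale-invariant form \<open>t * deriv smooth_step t\<close>.\<close>

lemma deriv_soft_trunc:
  "deriv (soft_trunc J) s = window J s + (J * s) * deriv smooth_step (J * s) * (1 - smooth_step (inverse J * s))
     - smooth_step (J * s) * ((inverse J * s) * deriv smooth_step (inverse J * s))"
proof (rule DERIV_imp_deriv)
  have "((\<lambda>s. 1 - smooth_step (inverse J * s)) has_real_derivative
      - (inverse J * deriv smooth_step (inverse J * s))) (at s)"
    using DERIV_diff[OF DERIV_const smooth_step_scale_deriv] by simp
  from DERIV_mult[OF DERIV_ident DERIV_mult[OF smooth_step_scale_deriv this]]
  show "(soft_trunc J has_real_derivative window J s +
     (J * s) * deriv smooth_step (J * s) * (1 - smooth_step (inverse J * s))
     - smooth_step (J * s) * ((inverse J * s) * deriv smooth_step (inverse J * s))) (at s)"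
    unfolding soft_trunc_def[abs_def] window_def
    by (rule DERIV_cong) (simp add: algebra_simps)
qed

lemma window_bounds: "0 \<le> window J s" "window J s \<le> 1"
  using smooth_step_bounds[of "J * s"] smooth_step_bounds[of "inverse J * s"]
  by (auto simp: window_def intro!: mult_le_one)

lemma soft_trunc_abs_le: "\<bar>soft_trunc J s\<bar> \<le> \<bar>s\<bar>"
  using window_bounds[of J s] mult_left_le[of "window J s" "\<bar>s\<bar>"] by (simp add: soft_trunc_def abs_mult)

lemma soft_trunc_bounded:
  assumes "J > 0"
  shows "\<bar>soft_trunc J s\<bar> \<le> 2 * J"
proof (cases "0 \<le> s \<and> inverse J * s \<le> 2")
  case True
  then have "\<bar>s\<bar> \<le> 2 * J" using assms by (simp add: divide_inverse[symmetric] mult.commute[of "inverse J"] pos_divide_le_eq)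
  then show ?thesis using soft_trunc_abs_le[of J s] by linarith
next
  case False
  then have "soft_trunc J s = 0"
  proof (cases "0 \<le> s")
    case False
    then have "J * s \<le> 1" using mult_pos_neg[of J s] assms by simp
    then show ?thesis by (simp add: soft_trunc_def window_def smooth_step_eq_0)
  qed (simp add: soft_trunc_def window_def smooth_step_eq_1)
  then show ?thesis using assms by simp
qed

lemma soft_trunc_eq_0:
  assumes "J * s < 1"
  shows "soft_trunc J s = 0" "deriv (soft_trunc J) s = 0"
  using assms by (simp_all add: deriv_soft_trunc soft_trunc_def window_def smooth_step_eq_0 deriv_smooth_step_eq_0)

lemma soft_trunc_eq_ident:
  assumes "J * s > 2" "inverse J * s < 1"
  shows "window J s = 1" "deriv (soft_trunc J) s = 1"
  using assms by (simp_all add: deriv_soft_trunc window_def smooth_step_eq_0 smooth_step_eq_1 deriv_smooth_step_eq_0)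

text \<open>\<open>t * deriv smooth_step t\<close> is zero off [1,2] and at most
  \<open>2 * C\<close> there in absolute value, whatever the scale. Two such terms and the window
  give \<open>1 + 4 * C\<close>. Independence of \<open>J\<close> is the point: it supplies the
  domination with which the truncation is removed.\<close>

lemma abs_deriv_soft_trunc_le:
  assumes C: "\<And>t. \<bar>deriv smooth_step t\<bar> \<le> C"
  shows "\<bar>deriv (soft_trunc J) s\<bar> \<le> 1 + 4 * C"
proof -
  have *: "\<bar>t * deriv smooth_step t * a\<bar> \<le> 2 * C" if "0 \<le> a" "a \<le> 1" for t a :: real
  proof (cases "t \<in> {1..2}")
    case True
    have "\<bar>t * deriv smooth_step t\<bar> \<le> 2 * C"
      unfolding abs_mult using True C by (intro mult_mono) auto
    moreover have "\<bar>t * deriv smooth_step t * a\<bar> \<le> \<bar>t * deriv smooth_step t\<bar> * 1"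
      unfolding abs_mult[of _ a] using that by (intro mult_left_mono) auto
    ultimately show ?thesis by linarith
  next
    case False
    then show ?thesis using C[of 0] by (simp add: deriv_smooth_step_eq_0)
  qed
  have "\<bar>(J * s) * deriv smooth_step (J * s) * (1 - smooth_step (inverse J * s))\<bar> \<le> 2 * C"
    "\<bar>(inverse J * s) * deriv smooth_step (inverse J * s) * smooth_step (J * s)\<bar> \<le> 2 * C"
    using smooth_step_bounds by (intro *; simp)+
  then show ?thesis
    using window_bounds[of J s] unfolding deriv_soft_trunc mult.commute[of "smooth_step (J * s)"] by linarith
qed

lemma zero_sobolev_component:
  fixes u :: "'a::euclidean_space \<Rightarrow> real"
  assumes p: "p > 0" and \<Omega>: "open \<Omega>" and u: "continuous_on \<Omega> u" and uG: "zero_sobolev p \<Omega> u G"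
    and D: "D \<in> components {x \<in> \<Omega>. u x \<noteq> 0}" and pos: "\<And>x. x \<in> D \<Longrightarrow> u x > 0"
  shows "zero_sobolev p D (\<lambda>x. indicator D x *\<^sub>R u x) (\<lambda>x. indicator D x *\<^sub>R G x)"
proof -
  obtain C where C: "C > 0" "\<And>t. \<bar>deriv smooth_step t\<bar> \<le> C"
    by (rule deriv_smooth_step_bounded) blast
  define J where "J j = real (Suc j)" for j
  have J: "J j > 0" for j by (simp add: J_def)
  have trunc: "zero_sobolev p D (\<lambda>x. indicator D x *\<^sub>R soft_trunc (J j) (u x))
      (\<lambda>x. (indicator D x * deriv (soft_trunc (J j)) (u x)) *\<^sub>R G x)" for j
  \<comment> \<open>\<open>soft_trunc (J j)\<close> vanishes up to \<open>1 / J j\<close>, and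
    \<open>\<epsilon>\<close> is half of that; \<open>\<psi>\<close> rises from 0 to 1 between
    \<open>1 / (4 * J j)\<close> and \<open>1 / (2 * J j) = \<epsilon>\<close>. \<open>M\<close> is
    the sum of the four separate bounds; it may depend on \<open>j\<close>, since \<open>j\<close>
    is fixed here.\<close>
  proof (rule zero_sobolev_truncation[OF p \<Omega> u uG D, where \<psi> = "\<lambda>s. smooth_step (4 * J j * s)"
        and \<epsilon> = "1 / (2 * J j)" and M = "2 * J j + (1 + 4 * C) + 1 + 4 * J j * C"])
    have d: "deriv (\<lambda>s. smooth_step (4 * J j * s)) s = 4 * J j * deriv smooth_step (4 * J j * s)" for s
      by (rule DERIV_imp_deriv[OF smooth_step_scale_deriv])
    have JC: "0 \<le> J j * C" using J[of j] C(1) by simp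
    show "Ck n (soft_trunc (J j))" "Ck n (\<lambda>s. smooth_step (4 * J j * s))" for n
      by (rule Ck_soft_trunc, rule Ck_smooth_step_scale)
    show "\<bar>soft_trunc (J j) s\<bar> \<le> 2 * J j + (1 + 4 * C) + 1 + 4 * J j * C" for s
      using soft_trunc_bounded[OF J, of j s] C(1) JC by linarith
    show "\<bar>deriv (soft_trunc (J j)) s\<bar> \<le> 2 * J j + (1 + 4 * C) + 1 + 4 * J j * C" for s
      using abs_deriv_soft_trunc_le[OF C(2), of "J j" s] J[of j] JC by linarith
    show "\<bar>smooth_step (4 * J j * s)\<bar> \<le> 2 * J j + (1 + 4 * C) + 1 + 4 * J j * C" for s
      using smooth_step_bounds[of "4 * J j * s"] J[of j] C(1) JC by linarith
    have dC: "\<bar>4 * J j * deriv smooth_step (4 * J j * s)\<bar> \<le> 4 * J j * C" for s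
      unfolding abs_mult[of "4 * J j"] using C(2)[of "4 * J j * s"] J[of j] by (intro mult_mono) auto
    show "\<bar>deriv (\<lambda>s. smooth_step (4 * J j * s)) s\<bar> \<le> 2 * J j + (1 + 4 * C) + 1 + 4 * J j * C" for s
      unfolding d using dC[of s] J[of j] C(1) by linarith
    show "\<bar>soft_trunc (J j) s\<bar> \<le> \<bar>s\<bar>" for s by (rule soft_trunc_abs_le)
    show "1 / (2 * J j) > 0" using J[of j] by simp
    show "soft_trunc (J j) s = 0" "deriv (soft_trunc (J j)) s = 0" if s: "s \<le> 1 / (2 * J j)" for s
    proof -
      have "J j * s \<le> J j * (1 / (2 * J j))" using s J[of j] by (intro mult_left_mono) auto
      also have "\<dots> < 1" using J[of j] by simp
      finally show "soft_trunc (J j) s = 0" "deriv (soft_trunc (J j)) s = 0"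
        by (rule soft_trunc_eq_0)+
    qed
    show "smooth_step (4 * J j * 0) = 0" "deriv (\<lambda>s. smooth_step (4 * J j * s)) 0 = 0"
      by (simp_all add: d smooth_step_eq_0 deriv_smooth_step_eq_0)
    show "smooth_step (4 * J j * s) = 1" "deriv (\<lambda>s. smooth_step (4 * J j * s)) s = 0"
      if s: "s > 1 / (2 * J j)" for s
    proof -
      have "2 = 4 * J j * (1 / (2 * J j))" using J[of j] by simp
      also have "\<dots> < 4 * J j * s" using s J[of j] by (intro mult_strict_left_mono) auto
      finally show "smooth_step (4 * J j * s) = 1" "deriv (\<lambda>s. smooth_step (4 * J j * s)) s = 0"
        by (simp_all add: d smooth_step_eq_1 deriv_smooth_step_eq_0)
    qed
  qed
  \<comment> \<open>Every positive value eventually lies in the range where the truncation is the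
    identity; this is how positivity of \<open>u\<close> on \<open>D\<close> enters.\<close>
  have large: "\<forall>\<^sub>F j in sequentially. J j * s > 2 \<and> inverse (J j) * s < 1" if s: "s > 0" for s
  proof -
    obtain N :: nat where N: "real N > max (2 / s) s" using reals_Archimedean2 by blast
    show ?thesis
      unfolding eventually_sequentially
    proof (intro exI[of _ N] allI impI)
      fix j assume "N \<le> j"
      then have "J j > 2 / s" "J j > s" using N by (auto simp: J_def)
      then have "J j * s > 2" "s / J j < 1"
        using s J[of j] by (simp_all add: pos_divide_less_eq)
      then show "J j * s > 2 \<and> inverse (J j) * s < 1"
        by (simp add: divide_inverse mult.commute)
    qed
  qed
  have "D \<subseteq> {x \<in> \<Omega>. u x \<noteq> 0}" using in_components_subset[OF D] .
  have "open D" using open_components[OF open_nonzero_set[OF \<Omega> u] D] .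
  then have Dm: "(indicator D :: 'a \<Rightarrow> real) \<in> borel_measurable lebesgue"
    by (simp add: borel_open borel_measurable_indicator)
  have um: "u \<in> borel_measurable lebesgue" and Gm: "G \<in> borel_measurable lebesgue"
    using uG by (auto simp: zero_sobolev_def)
  have "continuous_on UNIV (window c)" for c
  proof -
    have "Ck 0 (window c)"
      unfolding window_def[abs_def] by (intro Ck_mult Ck_diff Ck_const Ck_smooth_step_scale)
    then show ?thesis by simp
  qed
  then have wm: "(\<lambda>x. window c (u x)) \<in> borel_measurable lebesgue" for c
    by (rule borel_measurable_continuous_on[OF _ um])
  have "continuous_on UNIV (deriv (soft_trunc c))" for c
    using Ck_real_Suc_deriv(2)[OF Ck_soft_trunc[of "Suc 0" c]] by simp
  then have dm: "(\<lambda>x. deriv (soft_trunc c) (u x)) \<in> borel_measurable lebesgue" for c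
    by (rule borel_measurable_continuous_on[OF _ um])
  have "Lp_tendsto p (\<lambda>j x. (indicator D x * window (J j) (u x)) *\<^sub>R u x) (\<lambda>x. indicator D x *\<^sub>R u x)"
  proof (rule Lp_tendsto_scale[OF p _ _ _ _ _ _ _ _ zero_sobolev_finite(1)[OF p uG], where C = 1])
    show "AE x in lebesgue. (\<lambda>j. indicator D x * window (J j) (u x)) \<longlonglongrightarrow> indicator D x"
    proof (rule AE_I2)
      fix x
      show "(\<lambda>j. indicator D x * window (J j) (u x)) \<longlonglongrightarrow> (indicator D x :: real)"
      proof (cases "x \<in> D")
        case True
        have "\<forall>\<^sub>F j in sequentially. indicator D x * window (J j) (u x) = indicator D x"
          using large[OF pos[OF True]] by eventually_elim (simp add: soft_trunc_eq_ident)
        then show ?thesis by (rule tendsto_eventually)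
      qed simp
    qed
    show "\<bar>indicator D x * window (J j) (u x)\<bar> \<le> 1" for j x
      using window_bounds[of "J j" "u x"] by (simp add: indicator_def)
    show "\<bar>indicator D x\<bar> \<le> (1::real)" for x
      by (simp add: indicator_def)
    show "(\<lambda>x. indicator D x * window (J j) (u x)) \<in> borel_measurable lebesgue" for j
      by (rule borel_measurable_times[OF Dm wm])
    show "Lp_tendsto p (\<lambda>j. u) u"
      by (simp add: Lp_tendsto_def Lp_dist_def)
  qed (rule um Dm)+
  moreover have "(indicator D x * window (J j) (u x)) *\<^sub>R u x = indicator D x *\<^sub>R soft_trunc (J j) (u x)" for j x
    by (simp add: soft_trunc_def mult_ac)
  ultimately have lim_u: "Lp_tendsto p (\<lambda>j x. indicator D x *\<^sub>R soft_trunc (J j) (u x)) (\<lambda>x. indicator D x *\<^sub>R u x)"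
    by (simp only:)
  have lim_G: "Lp_tendsto p (\<lambda>j x. (indicator D x * deriv (soft_trunc (J j)) (u x)) *\<^sub>R G x) (\<lambda>x. indicator D x *\<^sub>R G x)"
  proof (rule Lp_tendsto_scale[OF p _ _ _ _ _ _ _ _ zero_sobolev_finite(2)[OF p uG], where C = "1 + 4 * C"])
    show "AE x in lebesgue. (\<lambda>j. indicator D x * deriv (soft_trunc (J j)) (u x)) \<longlonglongrightarrow> indicator D x"
    proof (rule AE_I2)
      fix x
      show "(\<lambda>j. indicator D x * deriv (soft_trunc (J j)) (u x)) \<longlonglongrightarrow> (indicator D x :: real)"
      proof (cases "x \<in> D")
        case True
        have "\<forall>\<^sub>F j in sequentially. indicator D x * deriv (soft_trunc (J j)) (u x) = indicator D x"
          using large[OF pos[OF True]] by eventually_elim (simp add: soft_trunc_eq_ident)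
        then show ?thesis by (rule tendsto_eventually)
      qed simp
    qed
    show "\<bar>indicator D x * deriv (soft_trunc (J j)) (u x)\<bar> \<le> 1 + 4 * C" for j x
      using abs_deriv_soft_trunc_le[OF C(2), of "J j" "u x"] C(1) by (simp add: indicator_def)
    show "\<bar>indicator D x\<bar> \<le> 1 + 4 * C" for x
      using C(1) by (simp add: indicator_def)
    show "(\<lambda>x. indicator D x * deriv (soft_trunc (J j)) (u x)) \<in> borel_measurable lebesgue" for j
      by (rule borel_measurable_times[OF Dm dm])
    show "Lp_tendsto p (\<lambda>j. G) G"
      by (simp add: Lp_tendsto_def Lp_dist_def)
  qed (rule Gm Dm)+
  show ?thesis
    by (rule zero_sobolev_closed[OF p trunc _ _ lim_u lim_G])
      (intro borel_measurable_scaleR um Gm Dm)+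
qed

section \<open>Sobolev functions with zero boundary values\<close>

lemma Lp_iff:
  fixes f :: "'a::euclidean_space \<Rightarrow> 'b::euclidean_space"
  assumes "\<Omega> \<in> sets lebesgue"
  shows "f \<in> Lp p \<Omega> \<longleftrightarrow> (\<lambda>x. indicator \<Omega> x *\<^sub>R f x) \<in> borel_measurable lebesgue \<and>
    (\<integral>\<^sup>+x. ennreal (norm (indicator \<Omega> x *\<^sub>R f x) powr p) \<partial>lebesgue) < \<infinity>"
proof -
  have m: "f \<in> borel_measurable (lebesgue_on \<Omega>) \<longleftrightarrow> (\<lambda>x. indicator \<Omega> x *\<^sub>R f x) \<in> borel_measurable lebesgue"
    by (rule borel_measurable_restrict_space_iff) (use assms in simp)
  have e: "indicator \<Omega> x *\<^sub>R (norm (f x) powr p) = norm (indicator \<Omega> x *\<^sub>R f x) powr p" for x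
    by (simp add: indicator_def)
  have "integrable (lebesgue_on \<Omega>) (\<lambda>x. norm (f x) powr p) \<longleftrightarrow>
      integrable lebesgue (\<lambda>x. norm (indicator \<Omega> x *\<^sub>R f x) powr p)"
    using integrable_restrict_space[of \<Omega> lebesgue "\<lambda>x. norm (f x) powr p"] assms unfolding e by simp
  moreover have "integrable lebesgue (\<lambda>x. norm (indicator \<Omega> x *\<^sub>R f x) powr p) \<longleftrightarrow>
      (\<integral>\<^sup>+x. ennreal (norm (indicator \<Omega> x *\<^sub>R f x) powr p) \<partial>lebesgue) < \<infinity>"
    if "(\<lambda>x. indicator \<Omega> x *\<^sub>R f x) \<in> borel_measurable lebesgue"
  proof -
    have "(\<lambda>x. norm (indicator \<Omega> x *\<^sub>R f x) powr p) \<in> borel_measurable lebesgue"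
      using that by measurable
    then show ?thesis by (simp add: integrable_iff_bounded)
  qed
  ultimately show ?thesis unfolding Lp_def mem_Collect_eq m by blast
qed

lemma Lp_integral_eq:
  fixes f :: "'a::euclidean_space \<Rightarrow> 'b::euclidean_space"
  assumes "\<Omega> \<in> sets lebesgue" "f \<in> Lp p \<Omega>"
  shows "ennreal (LINT x|lebesgue_on \<Omega>. norm (f x) powr p) =
    (\<integral>\<^sup>+x. ennreal (norm (indicator \<Omega> x *\<^sub>R f x) powr p) \<partial>lebesgue)"
proof -
  have "integrable (lebesgue_on \<Omega>) (\<lambda>x. norm (f x) powr p)"
    using assms(2) by (simp add: Lp_def)
  then have "ennreal (LINT x|lebesgue_on \<Omega>. norm (f x) powr p) = (\<integral>\<^sup>+x. ennreal (norm (f x) powr p) \<partial>lebesgue_on \<Omega>)"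
    by (subst nn_integral_eq_integral) simp_all
  also have "\<dots> = (\<integral>\<^sup>+x. ennreal (norm (f x) powr p) * indicator \<Omega> x \<partial>lebesgue)"
    by (rule nn_integral_restrict_space) (use assms(1) in simp)
  also have "\<dots> = (\<integral>\<^sup>+x. ennreal (norm (indicator \<Omega> x *\<^sub>R f x) powr p) \<partial>lebesgue)"
    by (rule nn_integral_cong) (simp add: indicator_def)
  finally show ?thesis .
qed

lemma Lp_of_finite:
  fixes f :: "'a::euclidean_space \<Rightarrow> 'b::euclidean_space"
  assumes "\<Omega> \<in> sets lebesgue" "p \<ge> 0" and f: "f \<in> borel_measurable lebesgue"
    and fin: "(\<integral>\<^sup>+x. ennreal (norm (f x) powr p) \<partial>lebesgue) < \<infinity>"
  shows "f \<in> Lp p \<Omega>"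
  unfolding Lp_iff[OF assms(1)]
proof
  show "(\<lambda>x. indicator \<Omega> x *\<^sub>R f x) \<in> borel_measurable lebesgue"
    by (intro borel_measurable_scaleR borel_measurable_indicator assms(1) f)
  have "(\<integral>\<^sup>+x. ennreal (norm (indicator \<Omega> x *\<^sub>R f x) powr p) \<partial>lebesgue) \<le>
      (\<integral>\<^sup>+x. ennreal (norm (f x) powr p) \<partial>lebesgue)"
    by (intro nn_integral_mono ennreal_leI powr_mono2 assms(2)) (auto simp: indicator_def)
  then show "(\<integral>\<^sup>+x. ennreal (norm (indicator \<Omega> x *\<^sub>R f x) powr p) \<partial>lebesgue) < \<infinity>"
    using fin by (rule order.strict_trans1)
qed

text \<open>A compact set has finite measure, and
  \<open>norm (f x) \<le> 1 + norm (f x) powr p\<close> for \<open>p \<ge> 1\<close>.\<close>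

lemma Lp_imp_locally_integrable:
  fixes f :: "'a::euclidean_space \<Rightarrow> 'b::euclidean_space"
  assumes p: "p \<ge> 1" and f: "f \<in> borel_measurable lebesgue"
    and fin: "(\<integral>\<^sup>+x. ennreal (norm (f x) powr p) \<partial>lebesgue) < \<infinity>"
  shows "locally_integrable \<Omega> f"
  unfolding locally_integrable_def set_integrable_def
proof (intro allI impI)
  fix K assume K: "compact K \<and> K \<subseteq> \<Omega>"
  have "(\<lambda>x. norm (f x) powr p) \<in> borel_measurable lebesgue"
    using f by measurable
  then have 1: "integrable lebesgue (\<lambda>x. norm (f x) powr p)"
    using fin by (simp add: integrable_iff_bounded)
  have 2: "integrable lebesgue (indicator K :: 'a \<Rightarrow> real)"
    using lmeasurable_compact[of K] K unfolding fmeasurable_def by (intro integrable_real_indicator) blast+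
  have Km: "K \<in> sets lebesgue" using K by (simp add: compact_imp_closed borel_closed)
  show "integrable lebesgue (\<lambda>x. indicator K x *\<^sub>R f x)"
  proof (rule Bochner_Integration.integrable_bound[OF Bochner_Integration.integrable_add[OF 2 1]])
    show "(\<lambda>x. indicator K x *\<^sub>R f x) \<in> borel_measurable lebesgue"
      by (intro borel_measurable_scaleR borel_measurable_indicator Km f)
    show "AE x in lebesgue. norm (indicator K x *\<^sub>R f x) \<le> norm (indicator K x + norm (f x) powr p)"
    proof (rule AE_I2)
      fix x
      have "norm (f x) \<le> 1 + norm (f x) powr p"
      proof (cases "norm (f x) \<le> 1")
        case False
        then have "norm (f x) powr 1 \<le> norm (f x) powr p"
          using p by (intro powr_mono) auto
        then show ?thesis using False by simp
      qed (simp add: add_increasing2)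
      then show "norm (indicator K x *\<^sub>R f x) \<le> norm (indicator K x + norm (f x) powr p)"
        by (cases "x \<in> K") auto
    qed
  qed
qed

text \<open>If \<open>\<bar>d\<bar> > t\<close>, then \<open>\<bar>d\<bar> = \<bar>d\<bar> powr (1 -
  p) * \<bar>d\<bar> powr p\<close>, whose first factor is nonincreasing in
  \<open>\<bar>d\<bar>\<close>. The free parameter \<open>t\<close> takes the place of Hoelder's
  inequality: it is made small first, and then the second summand is small by convergence in the
  p-th mean.\<close>

lemma abs_le_powr:
  fixes d t :: real
  assumes "p \<ge> 1" "t > 0"
  shows "\<bar>d\<bar> \<le> t + t powr (1 - p) * \<bar>d\<bar> powr p"
proof (cases "\<bar>d\<bar> \<le> t")
  case False
  then have d: "\<bar>d\<bar> > 0" using assms by linarith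
  have "\<bar>d\<bar> powr (1 - p) * \<bar>d\<bar> powr p \<le> t powr (1 - p) * \<bar>d\<bar> powr p"
    using False assms by (intro mult_right_mono powr_mono2') auto
  moreover have "\<bar>d\<bar> powr (1 - p) * \<bar>d\<bar> powr p = \<bar>d\<bar>"
    using d by (simp add: powr_add[symmetric])
  ultimately show ?thesis using assms by linarith
qed (simp add: add_increasing2)

lemma Lp_tendsto_integral:
  fixes F :: "nat \<Rightarrow> 'a::euclidean_space \<Rightarrow> real"
  assumes p: "p \<ge> 1" and meas: "\<And>n. F n \<in> borel_measurable lebesgue" "f \<in> borel_measurable lebesgue"
    and lim: "Lp_tendsto p F f"
    and h: "continuous_on UNIV h" "compact K" "\<And>x. x \<notin> K \<Longrightarrow> h x = 0"
    and int: "\<And>n. integrable lebesgue (\<lambda>x. F n x * h x)" "integrable lebesgue (\<lambda>x. f x * h x)"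
  shows "(\<lambda>n. LINT x|lebesgue. F n x * h x) \<longlonglongrightarrow> (LINT x|lebesgue. f x * h x :: real)"
proof -
  have hm: "h \<in> borel_measurable lebesgue" by (rule borel_measurable_lebesgue_continuous[OF h(1)])
  have hint: "integrable lebesgue h" by (rule continuous_integrable_lebesgue[OF h])
  define A where "A = (LINT x|lebesgue. \<bar>h x\<bar>)"
  have A: "(\<integral>\<^sup>+x. ennreal \<bar>h x\<bar> \<partial>lebesgue) = ennreal A" "A \<ge> 0"
    unfolding A_def using hint by (auto intro!: nn_integral_eq_integral)
  have "compact (h ` K)"
    by (intro compact_continuous_image h continuous_on_subset[OF h(1)]) auto
  then obtain M where M: "M > 0" "\<And>y. y \<in> h ` K \<Longrightarrow> norm y \<le> M"
    by (meson bounded_pos compact_imp_bounded)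
  have hM: "\<bar>h x\<bar> \<le> M" for x
    using M h(3)[of x] by (cases "x \<in> K") auto
  define X where "X n = (\<integral>\<^sup>+x. ennreal \<bar>(F n x - f x) * h x\<bar> \<partial>lebesgue)" for n
  have "\<forall>\<^sub>F n in sequentially. X n < ennreal e" if e: "e > 0" for e :: real
  proof -
    \<comment> \<open>The \<open>+ 1\<close> keeps the denominator positive when
      \<open>A = 0\<close>, and \<open>t * A\<close> is still below \<open>e / 2\<close>.\<close>
    define t where "t = e / (2 * (A + 1))"
    have t: "t > 0" "t * A < e / 2" using e A(2) by (auto simp: t_def field_simps)
    have "(\<lambda>n. ennreal (t powr (1 - p) * M) * Lp_dist p (F n) f) \<longlonglongrightarrow> 0"
      using lim unfolding Lp_tendsto_def by (rule tendsto_ennreal_zero_cmult)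
    then have "\<forall>\<^sub>F n in sequentially. ennreal (t powr (1 - p) * M) * Lp_dist p (F n) f < ennreal (e / 2)"
      by (rule order_tendstoD(2)) (use e in simp)
    then show ?thesis
    proof eventually_elim
      case (elim n)
      have "\<bar>(F n x - f x) * h x\<bar> \<le> t * \<bar>h x\<bar> + (t powr (1 - p) * M) * \<bar>F n x - f x\<bar> powr p" for x
      proof -
        have "\<bar>(F n x - f x) * h x\<bar> \<le> (t + t powr (1 - p) * \<bar>F n x - f x\<bar> powr p) * \<bar>h x\<bar>"
          unfolding abs_mult by (intro mult_right_mono abs_le_powr p t) auto
        also have "\<dots> = t * \<bar>h x\<bar> + (t powr (1 - p) * \<bar>F n x - f x\<bar> powr p) * \<bar>h x\<bar>"
          by (simp add: algebra_simps)
        also have "\<dots> \<le> t * \<bar>h x\<bar> + (t powr (1 - p) * \<bar>F n x - f x\<bar> powr p) * M"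
          using hM by (intro add_left_mono mult_left_mono) auto
        finally show ?thesis by (simp add: mult_ac)
      qed
      then have "X n \<le> (\<integral>\<^sup>+x. ennreal t * ennreal \<bar>h x\<bar> + ennreal (t powr (1 - p) * M) * ennreal (norm (F n x - f x) powr p) \<partial>lebesgue)"
        unfolding X_def using t(1) M(1)
        by (intro nn_integral_mono)
          (simp add: ennreal_mult[symmetric] ennreal_plus[symmetric] ennreal_leI del: ennreal_plus)
      also have "\<dots> = ennreal t * (\<integral>\<^sup>+x. ennreal \<bar>h x\<bar> \<partial>lebesgue) + ennreal (t powr (1 - p) * M) * Lp_dist p (F n) f"
      proof -
        have "(\<lambda>x. ennreal \<bar>h x\<bar>) \<in> borel_measurable lebesgue"
          "(\<lambda>x. ennreal (norm (F n x - f x) powr p)) \<in> borel_measurable lebesgue"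
          using hm meas by measurable
        then show ?thesis
          unfolding Lp_dist_def by (simp add: nn_integral_add nn_integral_cmult)
      qed
      also have "\<dots> < ennreal (e / 2) + ennreal (e / 2)"
      proof (rule add_strict_mono)
        show "ennreal t * (\<integral>\<^sup>+x. ennreal \<bar>h x\<bar> \<partial>lebesgue) < ennreal (e / 2)"
          using t A e by (simp add: ennreal_mult[symmetric] ennreal_lessI)
      qed (rule elim)
      also have "\<dots> = ennreal e" using e by (simp add: ennreal_plus[symmetric] del: ennreal_plus)
      finally show "X n < ennreal e" .
    qed
  qed
  note small = this
  have "ennreal \<bar>(LINT x|lebesgue. F n x * h x) - (LINT x|lebesgue. f x * h x)\<bar> \<le> X n" for n
  proof -
    have i: "integrable lebesgue (\<lambda>x. (F n x - f x) * h x)"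
      unfolding left_diff_distrib by (intro Bochner_Integration.integrable_diff int)
    have "(LINT x|lebesgue. F n x * h x) - (LINT x|lebesgue. f x * h x) = (LINT x|lebesgue. (F n x - f x) * h x)"
      unfolding left_diff_distrib by (rule Bochner_Integration.integral_diff[OF int, symmetric])
    then show ?thesis
      using integral_norm_bound_ennreal[OF i] by (simp add: X_def)
  qed
  note bound = this
  have "\<forall>\<^sub>F n in sequentially. dist (LINT x|lebesgue. F n x * h x) (LINT x|lebesgue. f x * h x) < e"
    if e: "e > 0" for e
    using small[OF e]
  proof eventually_elim
    case (elim n)
    from order.strict_trans1[OF bound[of n] elim] show ?case
      by (simp add: dist_real_def ennreal_less_iff)
  qed
  then show ?thesis unfolding tendsto_iff by blast
qed

lemma Lp_tendsto_inner:
  assumes "p \<ge> 0" "norm b \<le> 1" "Lp_tendsto p G g"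
  shows "Lp_tendsto p (\<lambda>n x. G n x \<bullet> b) (\<lambda>x. g x \<bullet> b)"
  unfolding Lp_tendsto_def
proof (rule ennreal_tendsto_zero_squeeze[OF assms(3)[unfolded Lp_tendsto_def]])
  fix n
  have "\<bar>G n x \<bullet> b - g x \<bullet> b\<bar> \<le> norm (G n x - g x)" for x
  proof -
    have "\<bar>(G n x - g x) \<bullet> b\<bar> \<le> norm (G n x - g x) * norm b" by (rule Cauchy_Schwarz_ineq2)
    also have "\<dots> \<le> norm (G n x - g x)" using assms(2) by (intro mult_left_le) auto
    finally show ?thesis by (simp add: inner_diff_left)
  qed
  then show "Lp_dist p (\<lambda>x. G n x \<bullet> b) (\<lambda>x. g x \<bullet> b) \<le> Lp_dist p (G n) g"
    unfolding Lp_dist_def by (intro nn_integral_mono ennreal_leI powr_mono2 assms(1)) auto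
qed

text \<open>Integration by parts holds for each approximating test function. For a fixed
  \<open>h\<close> both sides are integrals against continuous weights of compact support, so the
  identity survives the limit in the p-th mean.\<close>

lemma zero_sobolev_has_weak_gradient:
  assumes p: "p > 1" and D: "D \<in> sets lebesgue" and u: "zero_sobolev p D u g"
  shows "has_weak_gradient D u g"
  unfolding has_weak_gradient_iff
proof (intro conjI ballI)
  obtain f where f: "\<And>n. f n \<in> test_functions D" "Lp_tendsto p f u" "Lp_tendsto p (\<lambda>n. grad (f n)) g"
    and meas: "u \<in> borel_measurable lebesgue" "g \<in> borel_measurable lebesgue"
    using u unfolding zero_sobolev_def by blast
  have p': "p \<ge> 1" "p > 0" "p \<ge> 0" using p by auto
  show li: "locally_integrable D u" "locally_integrable D g"
    using Lp_imp_locally_integrable[OF p'(1) meas(1) zero_sobolev_finite(1)[OF p'(2) u]]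
      Lp_imp_locally_integrable[OF p'(1) meas(2) zero_sobolev_finite(2)[OF p'(2) u]] .
  fix h and b :: 'a assume h: "h \<in> test_functions D" and b: "b \<in> Basis"
  note hc = test_functions_continuous[OF h] and K = test_functions_compact_support[OF h]
  have hwg: "has_weak_gradient D (f n) (grad (f n))" for n
    by (rule has_weak_gradient_test_function[OF D f(1)])
  then have lf: "locally_integrable D (f n)" "locally_integrable D (grad (f n))" for n
    by (auto simp: has_weak_gradient_iff)
  have eq: "(LINT x|lebesgue_on D. v x * (grad h x \<bullet> b)) = (LINT x|lebesgue. v x * (grad h x \<bullet> b))"
    "(LINT x|lebesgue_on D. (w x \<bullet> b) * h x) = (LINT x|lebesgue. (w x \<bullet> b) * h x)" for v :: "'a \<Rightarrow> real" and w :: "'a \<Rightarrow> 'a"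
    by (rule integral_lebesgue_on_eq[OF D]; simp add: test_functions_eq_0[OF h])+
  have "(\<lambda>n. LINT x|lebesgue. f n x * (grad h x \<bullet> b)) \<longlonglongrightarrow> (LINT x|lebesgue. u x * (grad h x \<bullet> b))"
  proof (rule Lp_tendsto_integral[OF p'(1) test_functions_measurable(1)[OF f(1)] meas(1) f(2) _ K])
    show "continuous_on UNIV (\<lambda>x. grad h x \<bullet> b)" by (intro continuous_intros hc)
    show "grad h x \<bullet> b = 0" if "x \<notin> closure {x. h x \<noteq> 0}" for x
      using test_functions_support_eq_0(2)[OF that] .
  qed (rule locally_integrable_mult_test[OF _ h] lf li)+
  moreover have "(\<lambda>n. LINT x|lebesgue. (grad (f n) x \<bullet> b) * h x) \<longlonglongrightarrow> (LINT x|lebesgue. (g x \<bullet> b) * h x)"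
  proof (rule Lp_tendsto_integral[OF p'(1) _ _ _ hc(1) K])
    show "Lp_tendsto p (\<lambda>n x. grad (f n) x \<bullet> b) (\<lambda>x. g x \<bullet> b)"
      by (rule Lp_tendsto_inner[OF p'(3) _ f(3)]) (use b in simp)
    show "h x = 0" if "x \<notin> closure {x. h x \<noteq> 0}" for x
      using test_functions_support_eq_0(1)[OF that] .
    show "(\<lambda>x. grad (f n) x \<bullet> b) \<in> borel_measurable lebesgue" for n
      by (intro borel_measurable_inner test_functions_measurable(2)[OF f(1)] borel_measurable_const)
    show "(\<lambda>x. g x \<bullet> b) \<in> borel_measurable lebesgue"
      by (intro borel_measurable_inner meas borel_measurable_const)
  qed (rule locally_integrable_mult_test(1)[OF _ h] locally_integrable_inner lf li)+
  moreover have "(LINT x|lebesgue. f n x * (grad h x \<bullet> b)) = - (LINT x|lebesgue. (grad (f n) x \<bullet> b) * h x)" for n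
  proof -
    have "(LINT x|lebesgue_on D. f n x * (grad h x \<bullet> b)) = - (LINT x|lebesgue_on D. (grad (f n) x \<bullet> b) * h x)"
      using hwg[of n] h b unfolding has_weak_gradient_iff by blast
    then show ?thesis unfolding eq .
  qed
  ultimately have "(\<lambda>n. - (LINT x|lebesgue. (grad (f n) x \<bullet> b) * h x)) \<longlonglongrightarrow> (LINT x|lebesgue. u x * (grad h x \<bullet> b))"
    and *: "(\<lambda>n. LINT x|lebesgue. (grad (f n) x \<bullet> b) * h x) \<longlonglongrightarrow> (LINT x|lebesgue. (g x \<bullet> b) * h x)"
    by simp_all
  from LIMSEQ_unique[OF this(1) tendsto_minus[OF *]]
  show "(LINT x|lebesgue_on D. u x * (grad h x \<bullet> b)) = - (LINT x|lebesgue_on D. (g x \<bullet> b) * h x)"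
    unfolding eq .
qed

section \<open>Agreement of \<open>zero_sobolev\<close> with \<open>W01p\<close>\<close>

lemma open_sets_lebesgue: "open D \<Longrightarrow> D \<in> sets lebesgue"
  by (simp add: borel_open)

lemma weak_grad_AE:
  assumes "open D" "has_weak_gradient D u g"
  shows "has_weak_gradient D u (weak_grad D u)" "AE x in lebesgue. x \<in> D \<longrightarrow> weak_grad D u x = g x"
proof -
  show "has_weak_gradient D u (weak_grad D u)"
    unfolding weak_grad_def using assms(2) by (rule someI[of "has_weak_gradient D u"])
  then show "AE x in lebesgue. x \<in> D \<longrightarrow> weak_grad D u x = g x"
    using has_weak_gradient_unique[OF assms(1) _ assms(2)] by blast
qed

lemma weak_grad_Lp:
  assumes D: "open D" and g: "has_weak_gradient D u g" "g \<in> Lp p D"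
  shows "weak_grad D u \<in> Lp p D"
    "(LINT x|lebesgue_on D. norm (weak_grad D u x) powr p) = (LINT x|lebesgue_on D. norm (g x) powr p)"
proof -
  note Dm = open_sets_lebesgue[OF D]
  have ae: "AE x in lebesgue. indicator D x *\<^sub>R g x = indicator D x *\<^sub>R weak_grad D u x"
    using weak_grad_AE(2)[OF D g(1)] by eventually_elim (auto simp: indicator_def)
  have gL: "(\<lambda>x. indicator D x *\<^sub>R g x) \<in> borel_measurable lebesgue"
    "(\<integral>\<^sup>+x. ennreal (norm (indicator D x *\<^sub>R g x) powr p) \<partial>lebesgue) < \<infinity>"
    using g(2) unfolding Lp_iff[OF Dm] by auto
  have eq: "(\<integral>\<^sup>+x. ennreal (norm (indicator D x *\<^sub>R weak_grad D u x) powr p) \<partial>lebesgue) =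
      (\<integral>\<^sup>+x. ennreal (norm (indicator D x *\<^sub>R g x) powr p) \<partial>lebesgue)"
  proof (rule nn_integral_cong_AE)
    show "AE x in lebesgue. ennreal (norm (indicator D x *\<^sub>R weak_grad D u x) powr p) =
        ennreal (norm (indicator D x *\<^sub>R g x) powr p)"
      using ae by eventually_elim (simp only:)
  qed
  show wL: "weak_grad D u \<in> Lp p D"
    unfolding Lp_iff[OF Dm] eq using borel_measurable_AE[OF gL(1) ae] gL(2) by blast
  have "ennreal (LINT x|lebesgue_on D. norm (weak_grad D u x) powr p) = ennreal (LINT x|lebesgue_on D. norm (g x) powr p)"
    unfolding Lp_integral_eq[OF Dm wL] Lp_integral_eq[OF Dm g(2)] by (rule eq)
  then show "(LINT x|lebesgue_on D. norm (weak_grad D u x) powr p) = (LINT x|lebesgue_on D. norm (g x) powr p)"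
    by (subst (asm) ennreal_inj) auto
qed

lemma Lp_dist_finite:
  fixes f g :: "'a::euclidean_space \<Rightarrow> 'b::euclidean_space"
  assumes "p \<ge> 0" "f \<in> borel_measurable lebesgue" "g \<in> borel_measurable lebesgue"
    and "(\<integral>\<^sup>+x. ennreal (norm (f x) powr p) \<partial>lebesgue) < \<infinity>" "(\<integral>\<^sup>+x. ennreal (norm (g x) powr p) \<partial>lebesgue) < \<infinity>"
  shows "Lp_dist p f g < \<infinity>"
proof -
  have "Lp_dist p f g \<le> ennreal (2 powr p) *
      ((\<integral>\<^sup>+x. ennreal (norm (f x) powr p) \<partial>lebesgue) + (\<integral>\<^sup>+x. ennreal (norm (g x) powr p) \<partial>lebesgue))"
    using nn_integral_norm_powr_add_le[OF assms(1,2), of "\<lambda>x. - g x"] assms(3) by (simp add: Lp_dist_def)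
  also have "\<dots> < \<infinity>" using assms(4,5) by (simp add: ennreal_mult_less_top)
  finally show ?thesis .
qed

lemma Lp_diff:
  fixes u v :: "'a::euclidean_space \<Rightarrow> 'b::euclidean_space"
  assumes D: "D \<in> sets lebesgue" and p: "p \<ge> 0" and u: "u \<in> Lp p D"
    and v: "v \<in> borel_measurable lebesgue" "(\<integral>\<^sup>+x. ennreal (norm (v x) powr p) \<partial>lebesgue) < \<infinity>" "\<And>x. x \<notin> D \<Longrightarrow> v x = 0"
  shows "(\<lambda>x. u x - v x) \<in> Lp p D"
    "ennreal (LINT x|lebesgue_on D. norm (u x - v x) powr p) = Lp_dist p v (\<lambda>x. indicator D x *\<^sub>R u x)"
proof -
  have uL: "(\<lambda>x. indicator D x *\<^sub>R u x) \<in> borel_measurable lebesgue"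
    "(\<integral>\<^sup>+x. ennreal (norm (indicator D x *\<^sub>R u x) powr p) \<partial>lebesgue) < \<infinity>"
    using u unfolding Lp_iff[OF D] by auto
  have e: "indicator D x *\<^sub>R (u x - v x) = indicator D x *\<^sub>R u x - v x" for x
    using v(3)[of x] by (simp add: indicator_def)
  have n: "(\<integral>\<^sup>+x. ennreal (norm (indicator D x *\<^sub>R u x - v x) powr p) \<partial>lebesgue) = Lp_dist p v (\<lambda>x. indicator D x *\<^sub>R u x)"
    by (simp add: Lp_dist_def norm_minus_commute)
  show L: "(\<lambda>x. u x - v x) \<in> Lp p D"
    unfolding Lp_iff[OF D] e n
    using borel_measurable_diff[OF uL(1) v(1)] Lp_dist_finite[OF p v(1) uL(1) v(2) uL(2)] by blast
  show "ennreal (LINT x|lebesgue_on D. norm (u x - v x) powr p) = Lp_dist p v (\<lambda>x. indicator D x *\<^sub>R u x)"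
    unfolding Lp_integral_eq[OF D L] e n ..
qed

text \<open>\<open>W1p_norm\<close> involves a chosen gradient of the difference
  \<open>u - f\<close>. Uniqueness replaces it by \<open>g - grad f\<close>, and the norm splits
  into two nonnegative reals that are distances over the whole space.\<close>

lemma W1p_norm_diff_test:
  assumes D: "open D" and p: "p > 0" and u: "u \<in> Lp p D" and g: "has_weak_gradient D u g" "g \<in> Lp p D"
    and f: "f \<in> test_functions D"
  obtains A B where "A \<ge> 0" "B \<ge> 0" "W1p_norm p D (\<lambda>x. u x - f x) = (A + B) powr (1 / p)"
    "ennreal A = Lp_dist p f (\<lambda>x. indicator D x *\<^sub>R u x)" "ennreal B = Lp_dist p (grad f) (\<lambda>x. indicator D x *\<^sub>R g x)"
proof
  note Dm = open_sets_lebesgue[OF D] and p' = less_imp_le[OF p]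
  let ?A = "LINT x|lebesgue_on D. norm (u x - f x) powr p" and ?B = "LINT x|lebesgue_on D. norm (g x - grad f x) powr p"
  show "?A \<ge> 0" "?B \<ge> 0" by simp_all
  note fm = test_functions_measurable[OF f] and ff = test_functions_Lp_finite[OF p f]
  show "ennreal ?A = Lp_dist p f (\<lambda>x. indicator D x *\<^sub>R u x)"
    by (rule Lp_diff(2)[OF Dm p' u fm(1) ff(1) test_functions_eq_0(1)[OF f]])
  note gL = Lp_diff[OF Dm p' g(2) fm(2) ff(2) test_functions_eq_0(2)[OF f]]
  show "ennreal ?B = Lp_dist p (grad f) (\<lambda>x. indicator D x *\<^sub>R g x)"
    by (rule gL(2))
  have "has_weak_gradient D (\<lambda>x. u x - f x) (\<lambda>x. g x - grad f x)"
    by (rule has_weak_gradient_diff[OF Dm g(1) has_weak_gradient_test_function[OF Dm f]])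
  from weak_grad_Lp(2)[OF D this gL(1)]
  show "W1p_norm p D (\<lambda>x. u x - f x) = (?A + ?B) powr (1 / p)"
    by (simp add: W1p_norm_def)
qed

text \<open>Test functions in \<open>D\<close> and their gradients vanish outside \<open>D\<close>,
  so setting the limits to zero there can only decrease the distances.\<close>

lemma zero_sobolev_indicator:
  assumes D: "D \<in> sets lebesgue" and p: "p \<ge> 0" and u: "zero_sobolev p D u g"
  shows "zero_sobolev p D (\<lambda>x. indicator D x *\<^sub>R u x) (\<lambda>x. indicator D x *\<^sub>R g x)"
proof -
  obtain f where f: "\<And>n. f n \<in> test_functions D" "Lp_tendsto p f u" "Lp_tendsto p (\<lambda>n. grad (f n)) g"
    and meas: "u \<in> borel_measurable lebesgue" "g \<in> borel_measurable lebesgue"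
    using u unfolding zero_sobolev_def by blast
  have le: "Lp_dist p (f n) (\<lambda>x. indicator D x *\<^sub>R u x) \<le> Lp_dist p (f n) u" for n
    unfolding Lp_dist_def
    by (intro nn_integral_mono ennreal_leI powr_mono2 p)
      (use test_functions_eq_0(1)[OF f(1)[of n]] in \<open>auto simp: indicator_def\<close>)
  have "Lp_tendsto p f (\<lambda>x. indicator D x *\<^sub>R u x)"
    unfolding Lp_tendsto_def by (rule ennreal_tendsto_zero_squeeze[OF f(2)[unfolded Lp_tendsto_def] le])
  moreover have le': "Lp_dist p (grad (f n)) (\<lambda>x. indicator D x *\<^sub>R g x) \<le> Lp_dist p (grad (f n)) g" for n
    unfolding Lp_dist_def
    by (intro nn_integral_mono ennreal_leI powr_mono2 p)
      (use test_functions_eq_0(2)[OF f(1)[of n]] in \<open>auto simp: indicator_def\<close>)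
  have "Lp_tendsto p (\<lambda>n. grad (f n)) (\<lambda>x. indicator D x *\<^sub>R g x)"
    unfolding Lp_tendsto_def by (rule ennreal_tendsto_zero_squeeze[OF f(3)[unfolded Lp_tendsto_def] le'])
  moreover have "(\<lambda>x. indicator D x *\<^sub>R u x) \<in> borel_measurable lebesgue" "(\<lambda>x. indicator D x *\<^sub>R g x) \<in> borel_measurable lebesgue"
    by (intro borel_measurable_scaleR borel_measurable_indicator D meas)+
  ultimately show ?thesis unfolding zero_sobolev_def using f(1) by blast
qed

lemma zero_sobolev_imp_W01p:
  assumes p: "p > 1" and D: "open D" and u: "zero_sobolev p D u g"
  shows "u \<in> W01p p D" "has_weak_gradient D u g" "u \<in> Lp p D" "g \<in> Lp p D"
proof -
  note Dm = open_sets_lebesgue[OF D]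
  have p': "p > 0" "p \<ge> 0" using p by auto
  have meas: "u \<in> borel_measurable lebesgue" "g \<in> borel_measurable lebesgue"
    using u by (auto simp: zero_sobolev_def)
  show hwg: "has_weak_gradient D u g"
    by (rule zero_sobolev_has_weak_gradient[OF p Dm u])
  show uL: "u \<in> Lp p D" and gL: "g \<in> Lp p D"
    using Lp_of_finite[OF Dm p'(2) meas(1) zero_sobolev_finite(1)[OF p'(1) u]]
      Lp_of_finite[OF Dm p'(2) meas(2) zero_sobolev_finite(2)[OF p'(1) u]] .
  then have W: "u \<in> W1p p D" using hwg by (auto simp: W1p_def)
  obtain f where f: "\<And>n. f n \<in> test_functions D" "Lp_tendsto p f (\<lambda>x. indicator D x *\<^sub>R u x)"
      "Lp_tendsto p (\<lambda>n. grad (f n)) (\<lambda>x. indicator D x *\<^sub>R g x)"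
    using zero_sobolev_indicator[OF Dm p'(2) u] unfolding zero_sobolev_def by blast
  have "\<exists>A B. A \<ge> 0 \<and> B \<ge> 0 \<and> W1p_norm p D (\<lambda>x. u x - f n x) = (A + B) powr (1 / p) \<and>
      ennreal A = Lp_dist p (f n) (\<lambda>x. indicator D x *\<^sub>R u x) \<and> ennreal B = Lp_dist p (grad (f n)) (\<lambda>x. indicator D x *\<^sub>R g x)" for n
    by (rule W1p_norm_diff_test[OF D p'(1) uL hwg gL f(1)]) blast
  then obtain A B where AB: "\<And>n. A n \<ge> 0" "\<And>n. B n \<ge> 0" "\<And>n. W1p_norm p D (\<lambda>x. u x - f n x) = (A n + B n) powr (1 / p)"
      "\<And>n. ennreal (A n) = Lp_dist p (f n) (\<lambda>x. indicator D x *\<^sub>R u x)" "\<And>n. ennreal (B n) = Lp_dist p (grad (f n)) (\<lambda>x. indicator D x *\<^sub>R g x)"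
    by metis
  have "A \<longlonglongrightarrow> 0" "B \<longlonglongrightarrow> 0"
    using f(2,3) unfolding Lp_tendsto_def AB(4,5)[symmetric]
    by (auto intro!: tendsto_ennrealD[where x = 0] simp: AB(1,2))
  then have "(\<lambda>n. A n + B n) \<longlonglongrightarrow> 0 + 0" by (rule tendsto_add)
  then have "(\<lambda>n. (A n + B n) powr (1 / p)) \<longlonglongrightarrow> 0"
    by (intro tendsto_zero_powrI[where b = "1 / p"]) (use AB(1,2) p' in auto)
  then have "(\<lambda>n. W1p_norm p D (\<lambda>x. u x - f n x)) \<longlonglongrightarrow> 0"
    by (simp add: AB(3))
  then show "u \<in> W01p p D"
    unfolding W01p_def using W f(1) by blast
qed

text \<open>A member of \<open>W01p p D\<close> may have any values outside \<open>D\<close>,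
  whereas \<open>zero_sobolev\<close> sees the whole space; hence the zero extensions.\<close>

lemma W01p_imp_zero_sobolev:
  assumes p: "p > 1" and D: "open D" and u: "u \<in> W01p p D"
  shows "zero_sobolev p D (\<lambda>x. indicator D x *\<^sub>R u x) (\<lambda>x. indicator D x *\<^sub>R weak_grad D u x)"
    "has_weak_gradient D u (weak_grad D u)" "u \<in> Lp p D" "weak_grad D u \<in> Lp p D"
proof -
  note Dm = open_sets_lebesgue[OF D]
  have p': "p > 0" "p \<ge> 0" using p by auto
  obtain g where g: "g \<in> Lp p D" "has_weak_gradient D u g" and uL: "u \<in> Lp p D"
    using u unfolding W01p_def W1p_def by blast
  show "u \<in> Lp p D" by (rule uL)
  show hwg: "has_weak_gradient D u (weak_grad D u)" by (rule weak_grad_AE(1)[OF D g(2)])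
  show gL: "weak_grad D u \<in> Lp p D" by (rule weak_grad_Lp(1)[OF D g(2,1)])
  obtain f where f: "\<And>n. f n \<in> test_functions D" "(\<lambda>n. W1p_norm p D (\<lambda>x. u x - f n x)) \<longlonglongrightarrow> 0"
    using u unfolding W01p_def by blast
  have "\<exists>A B. A \<ge> 0 \<and> B \<ge> 0 \<and> W1p_norm p D (\<lambda>x. u x - f n x) = (A + B) powr (1 / p) \<and>
      ennreal A = Lp_dist p (f n) (\<lambda>x. indicator D x *\<^sub>R u x) \<and>
      ennreal B = Lp_dist p (grad (f n)) (\<lambda>x. indicator D x *\<^sub>R weak_grad D u x)" for n
    by (rule W1p_norm_diff_test[OF D p'(1) uL hwg gL f(1)]) blast
  then obtain A B where AB: "\<And>n. A n \<ge> 0" "\<And>n. B n \<ge> 0" "\<And>n. W1p_norm p D (\<lambda>x. u x - f n x) = (A n + B n) powr (1 / p)"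
      "\<And>n. ennreal (A n) = Lp_dist p (f n) (\<lambda>x. indicator D x *\<^sub>R u x)"
      "\<And>n. ennreal (B n) = Lp_dist p (grad (f n)) (\<lambda>x. indicator D x *\<^sub>R weak_grad D u x)"
    by metis
  \<comment> \<open>The p-th power undoes the root in the norm; by nonnegativity \<open>A n\<close>
    and \<open>B n\<close> are each dominated by their sum.\<close>
  have "(\<lambda>n. ((A n + B n) powr (1 / p)) powr p) \<longlonglongrightarrow> 0"
    by (rule tendsto_zero_powrI[OF f(2)[unfolded AB(3)] tendsto_const]) (use p' in simp_all)
  then have "(\<lambda>n. A n + B n) \<longlonglongrightarrow> 0"
    using AB(1,2) p' by (simp add: powr_powr)
  then have lim: "(\<lambda>n. ennreal (A n + B n)) \<longlonglongrightarrow> 0"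
    using tendsto_ennrealI[of _ 0] by simp
  have "Lp_tendsto p f (\<lambda>x. indicator D x *\<^sub>R u x)"
    "Lp_tendsto p (\<lambda>n. grad (f n)) (\<lambda>x. indicator D x *\<^sub>R weak_grad D u x)"
    unfolding Lp_tendsto_def AB(4,5)[symmetric]
    by (rule ennreal_tendsto_zero_squeeze[OF lim]; intro ennreal_leI; simp add: AB(1,2))+
  then show "zero_sobolev p D (\<lambda>x. indicator D x *\<^sub>R u x) (\<lambda>x. indicator D x *\<^sub>R weak_grad D u x)"
    using uL gL f(1) unfolding zero_sobolev_def Lp_iff[OF Dm] by blast
qed

section \<open>Nodal domains\<close>

text \<open>A continuous function without zeros on a connected set has constant sign, and a
  component where \<open>u\<close> is negative is a positive one for \<open>- u\<close>, which has
  the same nonzero set.\<close>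

lemma zero_sobolev_component_signed:
  fixes u :: "'a::euclidean_space \<Rightarrow> real"
  assumes p: "p > 0" and \<Omega>: "open \<Omega>" and u: "continuous_on \<Omega> u" and uG: "zero_sobolev p \<Omega> u G"
    and D: "D \<in> components {x \<in> \<Omega>. u x \<noteq> 0}"
  shows "zero_sobolev p D (\<lambda>x. indicator D x *\<^sub>R u x) (\<lambda>x. indicator D x *\<^sub>R G x)"
proof -
  have D\<Omega>: "D \<subseteq> {x \<in> \<Omega>. u x \<noteq> 0}" using in_components_subset[OF D] .
  have "connected (u ` D)"
    by (intro connected_continuous_image continuous_on_subset[OF u] in_components_connected[OF D])
      (use D\<Omega> in blast)
  note conn = this
  have no0: "0 \<notin> u ` D" using D\<Omega> by auto
  have "(\<forall>x\<in>D. u x > 0) \<or> (\<forall>x\<in>D. u x < 0)"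
  proof (rule ccontr)
    assume "\<not> ?thesis"
    then obtain x y where xy: "x \<in> D" "y \<in> D" "u x \<le> 0" "0 \<le> u y"
      by (auto simp: not_less)
    have "0 \<in> u ` D"
      by (rule connectedD_interval[OF conn imageI[OF xy(1)] imageI[OF xy(2)] xy(3,4)])
    with no0 show False by blast
  qed
  then show ?thesis
  proof
    assume "\<forall>x\<in>D. u x > 0"
    then show ?thesis by (intro zero_sobolev_component[OF assms]) blast
  next
    assume neg: "\<forall>x\<in>D. u x < 0"
    have "zero_sobolev p D (\<lambda>x. indicator D x *\<^sub>R (- 1 *\<^sub>R u x)) (\<lambda>x. indicator D x *\<^sub>R (- 1 *\<^sub>R G x))"
    proof (rule zero_sobolev_component[OF p \<Omega> _ zero_sobolev_scale[OF p uG]])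
      show "continuous_on \<Omega> (\<lambda>x. - 1 *\<^sub>R u x)" by (intro continuous_intros u)
      show "D \<in> components {x \<in> \<Omega>. - 1 *\<^sub>R u x \<noteq> 0}" using D by simp
      show "- 1 *\<^sub>R u x > 0" if "x \<in> D" for x using neg that by simp
    qed
    from zero_sobolev_scale[OF p this, of "- 1"] show ?thesis by simp
  qed
qed

section \<open>The first eigenvalue of a nodal domain\<close>

lemma lambda_1_bounds:
  assumes "v \<in> Lp_sphere p D"
  shows "0 \<le> lambda_1 p D" "lambda_1 p D \<le> energy p D v"
proof -
  have e: "0 \<le> energy p D u" for u unfolding energy_def by simp
  \<comment> \<open>The member \<open>v\<close> of the sphere matters here too: an infimum over an
    empty set of reals would carry no information. Nonnegativity is recorded because monotonicity of
    \<open>powr\<close> in its base requires it.\<close>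
  show "0 \<le> lambda_1 p D"
    unfolding lambda_1_def by (rule cINF_greatest) (use assms e in auto)
  show "lambda_1 p D \<le> energy p D v"
    unfolding lambda_1_def by (rule cINF_lower[OF bdd_belowI2[where m = 0] assms]) (rule e)
qed

lemma norm_powr_inner_self:
  fixes g :: "'a::real_inner"
  shows "norm g powr (p - 2) * (g \<bullet> g) = norm g powr p"
proof (cases "g = 0")
  case False
  then have "norm g powr p = norm g powr (p - 2) * norm g powr 2"
    by (simp only: powr_add[symmetric] diff_add_cancel)
  also have "norm g powr 2 = g \<bullet> g" using False by (simp add: power2_norm_eq_inner)
  finally show ?thesis by simp
qed simp

text \<open>The same pair \<open>v\<close>, \<open>H\<close> has two roles: over
  \<open>\<Omega>\<close> it is admissible in the eigenvalue equation, over \<open>D\<close> a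
  multiple of it competes for \<open>lambda_1\<close>. The weak gradients over the two sets are
  compared with \<open>H\<close> and never with each other.\<close>

lemma lambda_1_nodal_domain_le:
  fixes \<phi> :: "'a::euclidean_space \<Rightarrow> real"
  assumes p: "p > 1" and \<Omega>: "open \<Omega>" and \<phi>: "eigenfunction p \<Omega> lam \<phi>" "continuous_on \<Omega> \<phi>"
    and D: "D \<in> components {x \<in> \<Omega>. \<phi> x \<noteq> 0}"
  shows "0 \<le> lambda_1 p D" "lambda_1 p D \<le> lam"
proof -
  have p': "p > 0" "p \<ge> 0" using p by auto
  note \<Omega>m = open_sets_lebesgue[OF \<Omega>]
  have "\<phi> \<in> W01p p \<Omega>" using \<phi>(1) by (simp add: eigenfunction_def)
  note W = W01p_imp_zero_sobolev[OF p \<Omega> this]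
  define G where "G = weak_grad \<Omega> \<phi>"
  have D\<Omega>: "D \<subseteq> {x \<in> \<Omega>. \<phi> x \<noteq> 0}" using in_components_subset[OF D] .
  have N: "{x \<in> \<Omega>. indicator \<Omega> x *\<^sub>R \<phi> x \<noteq> 0} = {x \<in> \<Omega>. \<phi> x \<noteq> 0}" by auto
  have oD: "open D" using open_components[OF open_nonzero_set[OF \<Omega> \<phi>(2)] D] .
  note Dm = open_sets_lebesgue[OF oD]
  define v where "v x = indicator D x *\<^sub>R \<phi> x" for x
  define H where "H x = indicator D x *\<^sub>R G x" for x
  \<comment> \<open>Membership in \<open>W01p\<close> speaks about the zero extension of
    \<open>\<phi>\<close>; it agrees with \<open>\<phi>\<close> on \<open>\<Omega>\<close> and so
    has the same nonzero set and the same components.\<close>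
  have "continuous_on \<Omega> (\<lambda>x. indicator \<Omega> x *\<^sub>R \<phi> x)"
    using \<phi>(2) by (rule continuous_on_eq) simp
  from zero_sobolev_component_signed[OF p'(1) \<Omega> this W(1)] D
  have "zero_sobolev p D (\<lambda>x. indicator D x *\<^sub>R (indicator \<Omega> x *\<^sub>R \<phi> x)) (\<lambda>x. indicator D x *\<^sub>R (indicator \<Omega> x *\<^sub>R G x))"
    unfolding N G_def by blast
  moreover have "(\<lambda>x. indicator D x *\<^sub>R (indicator \<Omega> x *\<^sub>R \<phi> x)) = v"
    "(\<lambda>x. indicator D x *\<^sub>R (indicator \<Omega> x *\<^sub>R G x)) = H"
    using D\<Omega> by (auto simp: fun_eq_iff v_def H_def indicator_def)
  ultimately have vD: "zero_sobolev p D v H"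
    by (simp only:)
  have v\<Omega>: "zero_sobolev p \<Omega> v H"
    by (rule zero_sobolev_mono[OF _ vD]) (use D\<Omega> in blast)
  note V\<Omega> = zero_sobolev_imp_W01p[OF p \<Omega> v\<Omega>] and VD = zero_sobolev_imp_W01p[OF p oD vD]
  have outside: "v x = 0" "H x = 0" if "x \<notin> D" for x
    using that by (auto simp: v_def H_def)
  have ind: "indicator D x *\<^sub>R v x = v x" "indicator D x *\<^sub>R H x = H x"
    "indicator \<Omega> x *\<^sub>R v x = v x" "indicator \<Omega> x *\<^sub>R H x = H x" for x
    using D\<Omega> by (auto simp: v_def H_def indicator_def)
  define a where "a = (LINT x|lebesgue_on D. norm (H x) powr p)"
  define b where "b = (LINT x|lebesgue_on D. norm (v x) powr p)"
  have restrict: "(LINT x|lebesgue_on \<Omega>. norm (w x) powr p) = (LINT x|lebesgue_on D. norm (w x) powr p)"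
    if w: "\<And>x. x \<notin> D \<Longrightarrow> w x = 0" for w :: "'a \<Rightarrow> 'b::euclidean_space"
  proof -
    have "x \<notin> \<Omega> \<Longrightarrow> w x = 0" for x using w D\<Omega> by blast
    then show ?thesis
      using w integral_lebesgue_on_eq[OF \<Omega>m, of "\<lambda>x. norm (w x) powr p"]
        integral_lebesgue_on_eq[OF Dm, of "\<lambda>x. norm (w x) powr p"] by simp
  qed
  have a\<Omega>: "(LINT x|lebesgue_on \<Omega>. norm (H x) powr p) = a"
    and b\<Omega>: "(LINT x|lebesgue_on \<Omega>. norm (v x) powr p) = b"
    unfolding a_def b_def by (rule restrict, erule outside)+
  have "(LINT x|lebesgue_on \<Omega>. norm (G x) powr (p - 2) * (G x \<bullet> weak_grad \<Omega> v x)) =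
      (LINT x|lebesgue_on \<Omega>. norm (H x) powr p)"
  proof (rule integral_cong_AE)
    have m: "G \<in> borel_measurable (lebesgue_on \<Omega>)" "weak_grad \<Omega> v \<in> borel_measurable (lebesgue_on \<Omega>)"
      "H \<in> borel_measurable (lebesgue_on \<Omega>)"
      using W(4) weak_grad_Lp(1)[OF \<Omega> V\<Omega>(2,4)] V\<Omega>(4) by (auto simp: Lp_def G_def)
    show "(\<lambda>x. norm (G x) powr (p - 2) * (G x \<bullet> weak_grad \<Omega> v x)) \<in> borel_measurable (lebesgue_on \<Omega>)"
      "(\<lambda>x. norm (H x) powr p) \<in> borel_measurable (lebesgue_on \<Omega>)"
      using m by measurable
    have "AE x in lebesgue_on \<Omega>. weak_grad \<Omega> v x = H x"
      using weak_grad_AE(2)[OF \<Omega> V\<Omega>(2)] by (subst AE_restrict_space_iff) (use \<Omega>m in auto)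
    then show "AE x in lebesgue_on \<Omega>. norm (G x) powr (p - 2) * (G x \<bullet> weak_grad \<Omega> v x) = norm (H x) powr p"
    proof eventually_elim
      case (elim x)
      show ?case unfolding elim
        by (cases "x \<in> D") (simp_all add: H_def norm_powr_inner_self)
    qed
  qed
  moreover have "\<bar>\<phi> x\<bar> powr (p - 2) * \<phi> x * v x = norm (v x) powr p" for x
    using norm_powr_inner_self[of "\<phi> x" p] by (cases "x \<in> D") (simp_all add: v_def mult.assoc)
  ultimately have ab: "a = lam * b"
    using \<phi>(1) V\<Omega>(1) a\<Omega> b\<Omega> unfolding eigenfunction_def G_def by simp
  have "b \<ge> 0" unfolding b_def by simp
  \<comment> \<open>\<open>v\<close> has no zero in \<open>D\<close>, so \<open>b = 0\<close> would
    make a nonempty open set null.\<close>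
  moreover have "b \<noteq> 0"
  proof
    assume "b = 0"
    moreover have int: "integrable (lebesgue_on D) (\<lambda>x. norm (v x) powr p)"
      using VD(3) by (simp add: Lp_def)
    ultimately have "AE x in lebesgue_on D. norm (v x) powr p = 0"
      using integral_nonneg_eq_0_iff_AE[OF int] unfolding b_def by simp
    then have "AE x in lebesgue. x \<in> D \<longrightarrow> norm (v x) powr p = 0"
      by (subst (asm) AE_restrict_space_iff) (use Dm in auto)
    then have "AE x in lebesgue. x \<notin> D"
    proof eventually_elim
      case (elim x)
      then show ?case using D\<Omega> by (auto simp: v_def)
    qed
    then have "D \<in> null_sets lebesgue"
      using AE_iff_null_sets[OF Dm] by blast
    then have "negligible D" by (simp add: negligible_iff_null_sets)
    moreover have "D \<noteq> {}" using in_components_nonempty[OF D] .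
    ultimately show False using open_not_negligible[OF oD] by blast
  qed
  ultimately have b: "b > 0" by linarith
  \<comment> \<open>Normalisation to the sphere: \<open>c powr p = 1 / b\<close>, and the energy
    scales by the same factor, which leaves \<open>a / b\<close>.\<close>
  define c where "c = b powr (- 1 / p)"
  have "c powr p = b powr (- 1)"
    using p' by (simp only: c_def powr_powr) simp
  then have c: "c > 0" "c powr p = 1 / b"
    using b by (simp_all add: c_def powr_minus_divide)
  note wD = zero_sobolev_scale[OF p'(1) vD, of c]
  note WD = zero_sobolev_imp_W01p[OF p oD wD]
  have scale: "norm (c *\<^sub>R y) powr p = (1 / b) * norm y powr p" for y :: "'b::real_normed_vector"
    using c by (simp add: powr_mult)
  have "(LINT x|lebesgue_on D. norm (c *\<^sub>R v x) powr p) = 1"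
    unfolding scale using b integral_mult_right_zero[of "lebesgue_on D" "1 / b" "\<lambda>x. norm (v x) powr p"]
    unfolding b_def[symmetric] by simp
  then have sphere: "(\<lambda>x. c *\<^sub>R v x) \<in> Lp_sphere p D"
    using WD(1) unfolding Lp_sphere_def by simp
  have "energy p D (\<lambda>x. c *\<^sub>R v x) = (LINT x|lebesgue_on D. norm (c *\<^sub>R H x) powr p)"
    unfolding energy_def by (rule weak_grad_Lp(2)[OF oD WD(2,4)])
  also have "\<dots> = (1 / b) * a"
    unfolding scale by (simp add: a_def)
  also have "\<dots> = lam" using ab b by simp
  finally have "energy p D (\<lambda>x. c *\<^sub>R v x) = lam" .
  with lambda_1_bounds[OF sphere] show "0 \<le> lambda_1 p D" "lambda_1 p D \<le> lam" by simp_all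
qed

text \<open>The closure in the nodal set is taken in the whole space and may add boundary points of
  \<open>\<Omega>\<close>; the zeros are relatively closed in \<open>\<Omega>\<close>, so no point
  of \<open>\<Omega>\<close> itself is added.\<close>

lemma Omega_minus_nodal_set:
  assumes "continuous_on \<Omega> u"
  shows "\<Omega> - nodal_set \<Omega> u = {x \<in> \<Omega>. u x \<noteq> 0}"
proof -
  have "closedin (top_of_set \<Omega>) (\<Omega> \<inter> u -` {0})"
    by (rule continuous_closedin_preimage[OF assms]) simp
  then obtain T where T: "closed T" "\<Omega> \<inter> u -` {0} = \<Omega> \<inter> T"
    unfolding closedin_closed by blast
  have N: "{x \<in> \<Omega>. u x = 0} = \<Omega> \<inter> T" using T(2) by blast
  have "closure (\<Omega> \<inter> T) \<subseteq> T" using T(1) by (intro closure_minimal) auto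
  moreover have "\<Omega> \<inter> T \<subseteq> closure (\<Omega> \<inter> T)" by (rule closure_subset)
  ultimately show ?thesis unfolding nodal_set_def N using N by blast
qed

text \<open>An eigenfunction is given up to null sets; continuity selects the representative whose
  nodal domains are meant. The enumeration \<open>D\<close> by a finite index set carries the
  finiteness of their number, so that the cardinality is a genuine count.\<close>

theorem proposition1p5:
  fixes \<Omega> :: "'a::euclidean_space set" and p :: real and k :: nat
    and \<phi> :: "'a \<Rightarrow> real" and D :: "nat \<Rightarrow> 'a set" and L :: "nat \<Rightarrow> real"
  assumes "DIM('a) \<ge> 2" and "1 < p" and "bounded \<Omega>" and "lipschitz_domain \<Omega>" and "k \<ge> 1"
    and "eigenfunction p \<Omega> (cogenus_eigenvalue k p \<Omega>) \<phi>"
    and "continuous_on \<Omega> \<phi>"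
    and "bij_betw D {1..nodal_count \<Omega> \<phi>} (nodal_domains \<Omega> \<phi>)"
    and "\<And>i. i \<in> {1..nodal_count \<Omega> \<phi>} \<Longrightarrow> L i > 0"
    and "\<And>i. i \<in> {1..nodal_count \<Omega> \<phi>} \<Longrightarrow>
           measure lebesgue (D i) * lambda_1 p (D i) powr (DIM('a) / p) \<ge> L i"
  shows "nodal_count \<Omega> \<phi> \<le> measure lebesgue \<Omega> * cogenus_eigenvalue k p \<Omega> powr (DIM('a) / p)
           * inverse (Min (L ` {1..nodal_count \<Omega> \<phi>}))"
proof -
  define n where "n = nodal_count \<Omega> \<phi>"
  define q where "q = DIM('a) / p"
  define lam where "lam = cogenus_eigenvalue k p \<Omega>"
  define m where "m = Min (L ` {1..n})"
  have \<Omega>: "open \<Omega>" using assms(4) by (simp add: lipschitz_domain_def)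
  have \<Omega>l: "\<Omega> \<in> lmeasurable" using \<Omega> assms(3) by (simp add: lmeasurable_open)
  note bij = assms(8)[folded n_def]
  have dom: "nodal_domains \<Omega> \<phi> = components {x \<in> \<Omega>. \<phi> x \<noteq> 0}"
    by (simp add: nodal_domains_def Omega_minus_nodal_set[OF assms(7)])
  have Di: "D i \<in> components {x \<in> \<Omega>. \<phi> x \<noteq> 0}" if "i \<in> {1..n}" for i
    using bij_betwE[OF bij] that dom by blast
  \<comment> \<open>There is at least one nodal domain, since an eigenfunction is not zero almost
    everywhere. This makes \<open>Min\<close> range over a nonempty set and hence positive.\<close>
  have "{x \<in> \<Omega>. \<phi> x \<noteq> 0} \<noteq> {}"
  proof
    assume "{x \<in> \<Omega>. \<phi> x \<noteq> 0} = {}"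
    then have "AE x in lebesgue_on \<Omega>. \<phi> x = 0" by (intro AE_I2) auto
    then show False using assms(6) by (simp add: eigenfunction_def)
  qed
  then have "components {x \<in> \<Omega>. \<phi> x \<noteq> 0} \<noteq> {}"
    by (simp only: components_eq_empty) simp
  then have "D ` {1..n} \<noteq> {}"
    using bij_betw_imp_surj_on[OF bij] unfolding dom by (rule ssubst[rotated])
  then have n0: "n \<noteq> 0" by auto
  have m: "m > 0" and mL: "\<And>i. i \<in> {1..n} \<Longrightarrow> m \<le> L i"
    using n0 assms(9)[folded n_def] by (auto simp: m_def)
  have q: "q > 0" using assms(2) by (simp add: q_def)
  have D\<Omega>: "D i \<subseteq> \<Omega>" if "i \<in> {1..n}" for i
    using in_components_subset[OF Di[OF that]] by blast
  have Dl: "D i \<in> lmeasurable" if i: "i \<in> {1..n}" for i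
    using open_components[OF open_nonzero_set[OF \<Omega> assms(7)] Di[OF i]] bounded_subset[OF assms(3) D\<Omega>[OF i]]
    by (rule lmeasurable_open[rotated])
  have each: "m \<le> measure lebesgue (D i) * lam powr q" if i: "i \<in> {1..n}" for i
  proof -
    note l = lambda_1_nodal_domain_le[OF assms(2) \<Omega> assms(6,7) Di[OF i], folded lam_def]
    have "m \<le> measure lebesgue (D i) * lambda_1 p (D i) powr q"
      using mL[OF i] assms(10)[folded n_def q_def, OF i] by linarith
    also have "\<dots> \<le> measure lebesgue (D i) * lam powr q"
      using l q by (intro mult_left_mono powr_mono2) auto
    finally show ?thesis .
  qed
  have "real n * m = (\<Sum>i\<in>{1..n}. m)" by simp
  also have "\<dots> \<le> (\<Sum>i\<in>{1..n}. measure lebesgue (D i) * lam powr q)"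
    by (rule sum_mono) (rule each)
  also have "\<dots> = (\<Sum>i\<in>{1..n}. measure lebesgue (D i)) * lam powr q"
    by (rule sum_distrib_right[symmetric])
  finally have 1: "real n * m \<le> (\<Sum>i\<in>{1..n}. measure lebesgue (D i)) * lam powr q" .
  have "(\<Sum>i\<in>{1..n}. measure lebesgue (D i)) = measure lebesgue (\<Union>i\<in>{1..n}. D i)"
  proof (rule measure_UNION'[symmetric])
    show "pairwise (\<lambda>i j. disjnt (D i) (D j)) {1..n}"
    proof (rule pairwiseI)
      fix i j assume ij: "i \<in> {1..n}" "j \<in> {1..n}" "i \<noteq> j"
      then have "D i \<noteq> D j" using bij unfolding bij_betw_def inj_on_def by blast
      then show "disjnt (D i) (D j)"
        using components_nonoverlap[OF Di[OF ij(1)] Di[OF ij(2)]] by (simp add: disjnt_def)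
    qed
  qed (use Dl in auto)
  also have "\<dots> \<le> measure lebesgue \<Omega>"
  proof (rule measure_mono_fmeasurable[OF _ _ \<Omega>l])
    show "(\<Union>i\<in>{1..n}. D i) \<subseteq> \<Omega>" using D\<Omega> by blast
    show "(\<Union>i\<in>{1..n}. D i) \<in> sets lebesgue"
      by (intro sets.finite_UN fmeasurableD Dl) auto
  qed
  finally have "(\<Sum>i\<in>{1..n}. measure lebesgue (D i)) * lam powr q \<le> measure lebesgue \<Omega> * lam powr q"
    by (rule mult_right_mono) simp
  with 1 have "real n * m \<le> measure lebesgue \<Omega> * lam powr q" by (rule order_trans)
  then have "real n \<le> measure lebesgue \<Omega> * lam powr q * inverse m"
    using m by (simp add: divide_inverse[symmetric] pos_le_divide_eq)
  then show ?thesis unfolding n_def m_def lam_def q_def .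
qed

end
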